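(* Let $\Sigma\subset\mathbb C$ be finite and $a\ne b$ in $\Sigma$. Then for every $c\in\Sigma$ and every $w\in\mathcal A_\Sigma$, $$\frac{d}{dz}\mathrm{Li}^{ab}_\Sigma(x_cw;z)=\frac{1}{z-c}\,\mathrm{Li}^{ab}_\Sigma(w;z),$$ and the local solution $H^{ab}_\Sigma$ of the equation $\frac{dH}{dz}=\Big(\sum_{c\in\Sigma}\frac{X_c}{z-c}\Big)H$ is given by $$H^{ab}_\Sigma(z)=\sum_W \mathrm{Li}^{ab}_\Sigma(w;z)\,W .$$ Moreover $H^{ab}_\Sigma(z)=\left(\frac{z-a}{b-a}\right)^{X_a}\Big(\sum_W\mathrm{Li}^{ab}_\Sigma(\mathrm{reg}^{ab}(w);z)\,W\Big)\left(\frac{z-b}{a-b}\right)^{X_b}$.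
   Context: Let $\Sigma\subset\mathbb C$ be finite. $\mathcal A_\Sigma=\mathbb C\langle x_c: c\in\Sigma\rangle$ is the free non-commutative polynomial algebra on letters $x_c$; monomials are words. The shuffle product $⧢$ is the bilinear product defined recursively by $w ⧢ 1=1 ⧢ w=w$ and $l_1w_1 ⧢ l_2w_2=l_1(w_1 ⧢ l_2w_2)+l_2(l_1w_1 ⧢ w_2)$ for letters $l_1,l_2$ and words $w_1,w_2$; $x^{⧢ j}$ is the $j$-th shuffle power. For $b\in\Sigma$, $\mathcal A^b_\Sigma$ is the span of $1$ and all words not ending in $x_b$; for distinct $a,b\in\Sigma$, $\mathcal A^{ab}_\Sigma$ is the span of $1$ and all words that neither start with $x_a$ nor end with $x_b$. Every $w\in\mathcal A_\Sigma$ is uniquely $\sum_{j\ge0}u_j ⧢ x_b^{⧢ j}$ with $u_j\in\mathcal A^b_\Sigma$, and uniquely $\sum_{i,j\ge0}x_a^{⧢ i} ⧢ v_{ij} ⧢ x_b^{⧢ j}$ with $v_{ij}\in\mathcal A^{ab}_\Sigma$; put $\mathrm{reg}^b(w)=u_0$, $\mathrm{reg}^{ab}(w)=v_{00}$ (linear maps). Put $\rho_b=\min_{c\in\Sigma\setminus\{b\}}|c-b|$. For a word $w=x_b^{k_1-1}x_{c_1}\cdots x_b^{k_r-1}x_{c_r}\in\mathcal A^b_\Sigma$ ($k_i\ge1$, $c_i\ne b$), $\mathrm{Li}^b_\Sigma(w;z)=(-1)^r\sum_{m_1>\dots>m_r>0}\prod_{i=1}^r\left(\frac{z-b}{c_i-b}\right)^{m_i-m_{i+1}}m_i^{-k_i}$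 ($m_{r+1}=0$) for $|z-b|<\rho_b$, $\mathrm{Li}^b_\Sigma(1;z)=1$, extended linearly and continued analytically in $\mathbb C\setminus\Sigma$. For distinct $a,b$, $\mathrm{Li}^{ab}_\Sigma(\cdot;z):\mathcal A_\Sigma\to$ functions is the unique linear map that is a $⧢$-homomorphism ($\mathrm{Li}^{ab}_\Sigma(u ⧢ v;z)=\mathrm{Li}^{ab}_\Sigma(u;z)\mathrm{Li}^{ab}_\Sigma(v;z)$), equals $\mathrm{Li}^b_\Sigma$ on $\mathcal A^b_\Sigma$, and satisfies $\mathrm{Li}^{ab}_\Sigma(x_b;z)=\log\frac{z-b}{a-b}$. All functions are single-valued branches on a fixed simply connected domain $U\subset\mathbb C\setminus\Sigma$ containing $\{0<|z-b|<\rho_b\}$ minus a ray from $b$, with fixed branches of the logarithms. $\mathbb C\langle\langle X_c:c\in\Sigma\rangle\rangle$ is the algebra of non-commutative formal power series; for a word $w=x_{c_1}\cdots x_{c_n}$, $W=X_{c_1}\cdots X_{c_n}$, and $\sum_W$ runs over all words. For a function $f$, $f^{X}=\exp(X\log f)=\sum_{n\ge0}(X\log f)^n/n!$. $H^{ab}_\Sigma$ denotes the unique $\mathbb C\langle\langle X_c\rangle\rangle$-valued solution on $U$ (coefficientwise holomorphic) of $\frac{dH}{dz}=\big(\sum_{c\in\Sigma}\frac{X_c}{z-c}\big)H$ satisfying $H(z)\left(\frac{z-b}{a-b}\right)^{-X_b}\to1$ coefficientwise as $z\to b$. *)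

theory Defs
  imports "HOL-Analysis.Analysis" "HOL-Library.Multiset"
begin

text \<open>A letter x_c is represented by the complex number c; a word by a list of
letters.  An element of the free algebra A_S is represented by its coefficient
function (words to complex numbers), required to be finitely supported and to
involve only letters from S.\<close>

type_synonym ncpoly = "complex list \<Rightarrow> complex"

definition is_poly :: "complex set \<Rightarrow> ncpoly \<Rightarrow> bool" where
  "is_poly S p \<longleftrightarrow> finite {w. p w \<noteq> 0} \<and> (\<forall>w. p w \<noteq> 0 \<longrightarrow> set w \<subseteq> S)"

definition word_poly :: "complex list \<Rightarrow> ncpoly" where
  "word_poly w = (\<lambda>v. if v = w then 1 else 0)"

definition lmul :: "complex \<Rightarrow> ncpoly \<Rightarrow> ncpoly" where
  "lmul c p = (\<lambda>v. case v of [] \<Rightarrow> 0 | d # v' \<Rightarrow> (if d = c then p v' else 0))"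

fun shw :: "'a list \<Rightarrow> 'a list \<Rightarrow> 'a list multiset" where
  "shw [] v = {#v#}"
| "shw (x # u) [] = {#x # u#}"
| "shw (x # u) (y # v) = image_mset ((#) x) (shw u (y # v)) + image_mset ((#) y) (shw (x # u) v)"

definition shuf :: "ncpoly \<Rightarrow> ncpoly \<Rightarrow> ncpoly" where
  "shuf p q = (\<lambda>w. \<Sum>u\<in>{u. p u \<noteq> 0}. \<Sum>v\<in>{v. q v \<noteq> 0}.
                    p u * q v * of_nat (count (shw u v) w))"

fun spow :: "ncpoly \<Rightarrow> nat \<Rightarrow> ncpoly" where
  "spow p 0 = word_poly []"
| "spow p (Suc j) = shuf p (spow p j)"

definition inAb :: "complex \<Rightarrow> ncpoly \<Rightarrow> bool" where
  "inAb b p \<longleftrightarrow> (\<forall>w. p w \<noteq> 0 \<longrightarrow> w = [] \<or> last w \<noteq> b)"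

definition inAab :: "complex \<Rightarrow> complex \<Rightarrow> ncpoly \<Rightarrow> bool" where
  "inAab a b p \<longleftrightarrow> (\<forall>w. p w \<noteq> 0 \<longrightarrow> w = [] \<or> (hd w \<noteq> a \<and> last w \<noteq> b))"

definition regab :: "complex set \<Rightarrow> complex \<Rightarrow> complex \<Rightarrow> ncpoly \<Rightarrow> ncpoly" where
  "regab S a b p = (THE vs :: nat \<Rightarrow> nat \<Rightarrow> ncpoly.
      (\<forall>i j. is_poly S (vs i j) \<and> inAab a b (vs i j)) \<and>
      (\<exists>N. (\<forall>i j. N \<le> i \<or> N \<le> j \<longrightarrow> vs i j = (\<lambda>_. 0)) \<and>
           p = (\<lambda>w. \<Sum>i<N. \<Sum>j<N.
                 shuf (shuf (spow (word_poly [a]) i) (vs i j)) (spow (word_poly [b]) j) w))) 0 0"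

definition rho :: "complex set \<Rightarrow> complex \<Rightarrow> real" where
  "rho S b = Min {cmod (c - b) | c. c \<in> S - {b}}"

text \<open>Decomposition of a word x_b^{k_1-1} x_{c_1} ... x_b^{k_r-1} x_{c_r} into the
list of pairs (k_i, c_i).\<close>
fun blocks :: "complex \<Rightarrow> nat \<Rightarrow> complex list \<Rightarrow> (nat \<times> complex) list" where
  "blocks b n [] = []"
| "blocks b n (x # xs) = (if x = b then blocks b (Suc n) xs else (Suc n, x) # blocks b 0 xs)"

definition dec_lists :: "nat \<Rightarrow> nat list set" where
  "dec_lists r = {ms. length ms = r \<and> sorted_wrt (>) ms \<and> (\<forall>m\<in>set ms. 0 < m)}"

text \<open>The defining series of Li^b on a word of A^b (valid for |z-b| < rho_b).\<close>
definition LiB_ser :: "complex \<Rightarrow> complex list \<Rightarrow> complex \<Rightarrow> complex" where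
  "LiB_ser b w z = (let bl = blocks b 0 w; r = length bl in
     (-1) ^ r * infsum (\<lambda>ms. \<Prod>i<r.
        ((z - b) / (snd (bl ! i) - b)) ^ (ms ! i - (ms @ [0]) ! Suc i)
        / of_nat (ms ! i) ^ fst (bl ! i)) (dec_lists r))"

text \<open>Li^b on A^b: linear extension of the series, analytically continued to U
(the unique holomorphic function on U agreeing with the series near b;
normalised to 0 outside U so that it is uniquely determined).\<close>
definition LiB :: "complex set \<Rightarrow> complex set \<Rightarrow> complex \<Rightarrow> ncpoly \<Rightarrow> complex \<Rightarrow> complex" where
  "LiB S U b p = (THE f. f holomorphic_on U \<and>
      (\<forall>z\<in>U. cmod (z - b) < rho S b \<longrightarrow> f z = (\<Sum>w\<in>{w. p w \<noteq> 0}. p w * LiB_ser b w z)) \<and>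
      (\<forall>z. z \<notin> U \<longrightarrow> f z = 0))"

text \<open>Li^{ab}(.;z) for z in U: the unique linear shuffle homomorphism A_S -> C that
agrees with Li^b on A^b and sends x_b to the fixed branch Lb z of log((z-b)/(a-b))
(normalised to 0 on non-polynomials so that it is uniquely determined).\<close>
definition LiAB :: "complex set \<Rightarrow> complex set \<Rightarrow> complex \<Rightarrow> complex \<Rightarrow> (complex \<Rightarrow> complex)
                    \<Rightarrow> ncpoly \<Rightarrow> complex \<Rightarrow> complex" where
  "LiAB S U a b Lb p z = (THE \<phi> :: ncpoly \<Rightarrow> complex.
      (\<forall>p q. is_poly S p \<longrightarrow> is_poly S q \<longrightarrow> \<phi> (\<lambda>w. p w + q w) = \<phi> p + \<phi> q) \<and>
      (\<forall>c p. is_poly S p \<longrightarrow> \<phi> (\<lambda>w. c * p w) = c * \<phi> p) \<and>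
      (\<forall>p q. is_poly S p \<longrightarrow> is_poly S q \<longrightarrow> \<phi> (shuf p q) = \<phi> p * \<phi> q) \<and>
      (\<forall>q. is_poly S q \<longrightarrow> inAb b q \<longrightarrow> \<phi> q = LiB S U b q z) \<and>
      \<phi> (word_poly [b]) = Lb z \<and>
      (\<forall>q. \<not> is_poly S q \<longrightarrow> \<phi> q = 0)) p"

type_synonym ncser = "complex list \<Rightarrow> complex"

definition ser_mult :: "ncser \<Rightarrow> ncser \<Rightarrow> ncser" where
  "ser_mult F G = (\<lambda>w. \<Sum>i\<le>length w. F (take i w) * G (drop i w))"

text \<open>f^{X_c} = exp(X_c log f) = sum_n (X_c l)^n / n!, where l is the chosen value of log f.\<close>
definition ser_exp :: "complex \<Rightarrow> complex \<Rightarrow> ncser" where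
  "ser_exp c l = (\<lambda>w. if (\<forall>x\<in>set w. x = c) then l ^ length w / fact (length w) else 0)"

text \<open>Solutions of dH/dz = (sum_c X_c/(z-c)) H on U, coefficientwise holomorphic,
with H(z) ((z-b)/(a-b))^{-X_b} -> 1 coefficientwise as z -> b.\<close>
definition is_Hab :: "complex set \<Rightarrow> complex set \<Rightarrow> complex \<Rightarrow> (complex \<Rightarrow> complex)
                      \<Rightarrow> (complex \<Rightarrow> ncser) \<Rightarrow> bool" where
  "is_Hab S U b Lb H \<longleftrightarrow>
     (\<forall>w. set w \<subseteq> S \<longrightarrow> (\<forall>z\<in>U.
        ((\<lambda>z. H z w) has_field_derivative
            (case w of [] \<Rightarrow> 0 | c # w' \<Rightarrow> H z w' / (z - c))) (at z))) \<and>
     (\<forall>w. set w \<subseteq> S \<longrightarrow>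
        ((\<lambda>z. ser_mult (H z) (ser_exp b (- Lb z)) w) \<longlongrightarrow> (if w = [] then 1 else 0))
          (at b within U))"

definition Hab :: "complex set \<Rightarrow> complex set \<Rightarrow> complex \<Rightarrow> (complex \<Rightarrow> complex)
                   \<Rightarrow> complex \<Rightarrow> ncser" where
  "Hab S U b Lb = (THE H. is_Hab S U b Lb H \<and>
      (\<forall>z w. z \<notin> U \<or> \<not> set w \<subseteq> S \<longrightarrow> H z w = 0))"

definition admissible_domain :: "complex set \<Rightarrow> complex \<Rightarrow> complex set \<Rightarrow> bool" where
  "admissible_domain S b U \<longleftrightarrow> open U \<and> connected U \<and> simply_connected U \<and> U \<inter> S = {} \<and>
     (\<exists>e. e \<noteq> 0 \<and>
        {z. 0 < cmod (z - b) \<and> cmod (z - b) < rho S b} - {b + of_real t * e | t. t \<ge> 0} \<subseteq> U)"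

end

(* Both sides are controlled by derivations.  On the shuffle algebra, deleting a first letter x_a and
   deleting a last letter x_b are commuting derivations, dual to the elements x_a and x_b; hence every
   polynomial is uniquely a polynomial in x_a, x_b with coefficients in the joint kernel A^{ab}, and for
   a word the coefficient of x_a^i x_b^j is reg^{ab}/(i! j!) of the word with a^i and b^j stripped off.
   On the analytic side, write H = K ((z-b)/(a-b))^{X_b}: then K solves an equation whose right-hand
   side has no pole at b, so K exists as a series of holomorphic functions on the disc, trivial at b, and
   it agrees with the defining series of Li^b on words not ending in x_b.  The coefficients of H on U form a
   shuffle character, because the difference of the two sides of the character identity has derivative 0
   by induction and tends to 0 at b (each K_w vanishes at b, which beats every power of the logarithm).
   Linear extension of these coefficients is therefore Li^{ab}, and applying it to the decomposition
   of a word gives the factorisation. *)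
theory Submission
  imports Defs "HOL-Complex_Analysis.Complex_Analysis"
begin

text \<open>\<open>regab\<close>, \<open>LiB\<close>, \<open>LiAB\<close> and \<open>Hab\<close> are
  definite descriptions, so each needs an existence and a uniqueness proof. Uniqueness comes,
  respectively, from characteristic zero (integers can be cancelled), from the identity theorem,
  from expansions in powers of x_b over \<open>A^b\<close>, and from the prescribed limit at
  \<open>b\<close>. K is useful because it lives on the whole disc and sees no branch of the
  logarithm: near \<open>b\<close> all dependence on \<open>Lb\<close> sits in an exponential factor
  that is explicit on words. What has to be known about \<open>Lb\<close> is that its imaginary part
  stays bounded near \<open>b\<close> within \<open>U\<close>; this follows by comparing it on the
  slit disc with a rotated principal logarithm. Nonempty words in the letter \<open>b\<close> alone
  are exceptional throughout: their coefficients are powers of the logarithm, which have no limit at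
  \<open>b\<close>, so limit arguments are replaced by explicit computation for them. Branches of
  log((z-a)/(b-a)) differ by multiples of 2 pi i; the limit of \<open>La\<close> at \<open>b\<close>
  singles out the one that is the value of the character on x_a.\<close>

section \<open>The shuffle product\<close>

text \<open>The coefficient of a word in the shuffle product.  Recursion on that word (rather than on the factors)
  makes sense for arbitrary coefficient functions, and turns deletion of a first letter into a derivation by
  definition.\<close>

fun shp :: "'a list \<Rightarrow> ('a list \<Rightarrow> 'b) \<Rightarrow> ('a list \<Rightarrow> 'b) \<Rightarrow> 'b::comm_ring_1" where
  "shp [] p q = p [] * q []"
| "shp (c # w) p q = shp w (\<lambda>v. p (c # v)) q + shp w p (\<lambda>v. q (c # v))"

lemma shp_comm: "shp w p q = shp w q p"
  by (induction w arbitrary: p q) (auto simp: mult.commute add.commute)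

lemma shp_add_left: "shp w (\<lambda>v. p v + p' v) q = shp w p q + shp w p' q"
  by (induction w arbitrary: p p' q) (auto simp: algebra_simps)

lemma shp_scale_left: "shp w (\<lambda>v. k * p v) q = k * shp w p q"
  by (induction w arbitrary: p q) (auto simp: algebra_simps)

lemma shp_scale_right: "shp w q (\<lambda>v. k * p v) = k * shp w q p"
  by (simp only: shp_comm[of w q] shp_scale_left)

lemma shp_zero_left [simp]: "shp w (\<lambda>_. 0) q = 0"
  using shp_scale_left[of w 0] by simp

lemma shp_zero_right [simp]: "shp w p (\<lambda>_. 0) = 0"
  by (simp add: shp_comm[of _ p])

lemma shp_add_right: "shp w q (\<lambda>v. p v + p' v) = shp w q p + shp w q p'"
  using shp_add_left[of w p p' q] by (simp only: shp_comm[of w q])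

lemma shp_sum_left: "finite A \<Longrightarrow> shp w (\<lambda>v. \<Sum>x\<in>A. f x v) q = (\<Sum>x\<in>A. shp w (f x) q)"
  by (induction A rule: finite_induct) (auto simp: shp_add_left)

lemma shp_sum_right: "finite A \<Longrightarrow> shp w q (\<lambda>v. \<Sum>x\<in>A. f x v) = (\<Sum>x\<in>A. shp w q (f x))"
  by (simp only: shp_comm[of w q] shp_sum_left)

lemma shp_assoc: "shp w (\<lambda>v. shp v p q) r = shp w p (\<lambda>v. shp v q r)"
  by (induction w arbitrary: p q r) (auto simp: shp_add_left shp_add_right algebra_simps)

lemma shp_one_left: "shp w (\<lambda>v. if v = [] then k else 0) q = k * q w"
  by (induction w arbitrary: q) auto

text \<open>Mirror symmetry, hidden by the first-letter recursion: the last letter of a shuffle is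
  the last letter of one of the factors. Hence deletion of a last letter is a derivation
  too.\<close>

lemma shp_snoc: "shp (w @ [c]) p q = shp w (\<lambda>v. p (v @ [c])) q + shp w p (\<lambda>v. q (v @ [c]))"
  by (induction w arbitrary: p q) (auto simp: algebra_simps)

text \<open>With \<open>shp_nonzero_length\<close> this gives closure of polynomials under products:
  letters and length of the support are tracked separately, since each follows the recursion on
  \<open>w\<close>.\<close>

lemma shp_nonzero_set:
  assumes "\<And>v. p v \<noteq> 0 \<Longrightarrow> set v \<subseteq> S" "\<And>v. q v \<noteq> 0 \<Longrightarrow> set v \<subseteq> S" "shp w p q \<noteq> 0"
  shows "set w \<subseteq> S"
  using assms
proof (induction w arbitrary: p q)
  case (Cons c w)
  show ?case
  proof (cases "c \<in> S")
    case True
    from Cons.prems(3) consider "shp w (\<lambda>v. p (c # v)) q \<noteq> 0" | "shp w p (\<lambda>v. q (c # v)) \<noteq> 0"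
      by (metis add_0 shp.simps(2))
    then have "set w \<subseteq> S"
    proof cases
      case 1
      show ?thesis
        by (rule Cons.IH[OF _ _ 1]) (use Cons.prems(1,2) in fastforce)+
    next
      case 2
      show ?thesis
        by (rule Cons.IH[OF _ _ 2]) (use Cons.prems(1,2) in fastforce)+
    qed
    with True show ?thesis by simp
  next
    case False
    then have "(\<lambda>v. p (c # v)) = (\<lambda>_. 0)" "(\<lambda>v. q (c # v)) = (\<lambda>_. 0)"
      using Cons.prems(1,2)[of "c # _"] by fastforce+
    with Cons.prems(3) show ?thesis by simp
  qed
qed simp

lemma shp_nonzero_length:
  assumes "\<And>v. p v \<noteq> 0 \<Longrightarrow> length v \<le> M" "\<And>v. q v \<noteq> 0 \<Longrightarrow> length v \<le> N" "shp w p q \<noteq> 0"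
  shows "length w \<le> M + N"
  using assms
proof (induction w arbitrary: p q M N)
  case (Cons c w)
  from Cons.prems(3) consider "shp w (\<lambda>v. p (c # v)) q \<noteq> 0" | "shp w p (\<lambda>v. q (c # v)) \<noteq> 0"
    by (metis add_0 shp.simps(2))
  then show ?case
  proof cases
    case 1
    show ?thesis
    proof (cases M)
      case 0
      then have "(\<lambda>v. p (c # v)) = (\<lambda>_. 0)" using Cons.prems(1)[of "c # _"] by fastforce
      with 1 show ?thesis by simp
    next
      case (Suc M')
      have "length w \<le> M' + N"
        by (rule Cons.IH[OF _ _ 1]) (use Cons.prems(1,2) Suc in fastforce)+
      with Suc show ?thesis by simp
    qed
  next
    case 2
    show ?thesis
    proof (cases N)
      case 0
      then have "(\<lambda>v. q (c # v)) = (\<lambda>_. 0)" using Cons.prems(2)[of "c # _"] by fastforce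
      with 2 show ?thesis by simp
    next
      case (Suc M')
      have "length w \<le> M + M'"
        by (rule Cons.IH[OF _ _ 2]) (use Cons.prems(1,2) Suc in fastforce)+
      with Suc show ?thesis by simp
    qed
  qed
qed simp

lemma count_image_Cons:
  "count (image_mset ((#) x) M) w = (case w of [] \<Rightarrow> 0 | y # w' \<Rightarrow> if y = x then count M w' else 0)"
proof (cases w)
  case Nil
  then show ?thesis by (auto simp: count_eq_zero_iff)
next
  case (Cons y w')
  show ?thesis
  proof (cases "y = x")
    case True
    then show ?thesis using Cons by (induction M) auto
  next
    case False
    then show ?thesis using Cons by (auto simp: count_eq_zero_iff)
  qed
qed

lemma word_poly_Cons_Cons: "(\<lambda>v. word_poly (x # u) (c # v)) = (if c = x then word_poly u else (\<lambda>_. 0))"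
  by (auto simp: word_poly_def)

lemma shp_word_Nil [simp]: "shp w (word_poly []) q = q w" "shp w q (word_poly []) = q w"
proof -
  show "shp w (word_poly []) q = q w"
    using shp_one_left[of w 1 q] by (simp add: word_poly_def)
  then show "shp w q (word_poly []) = q w" by (simp add: shp_comm[of w q])
qed

text \<open>Links the recursion on the two factors with the recursion on the resulting word: the
  first letter of \<open>w\<close> decides which of the two multisets in \<open>shw\<close> can
  contain it.\<close>

lemma count_shw: "of_nat (count (shw u v) w) = shp w (word_poly u) (word_poly v)"
proof (induction u v arbitrary: w rule: shw.induct)
  case (1 v)
  then show ?case by (simp, simp add: word_poly_def)
next
  case (2 x u)
  then show ?case by (simp, simp add: word_poly_def)
next
  case (3 x u y v)
  show ?case
  proof (cases w)
    case Nil
    then show ?thesis by (simp add: count_image_Cons) (simp add: word_poly_def)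
  next
    case (Cons c w')
    then show ?thesis
      by (auto simp: count_image_Cons word_poly_Cons_Cons "3.IH"[symmetric])
  qed
qed

lemma word_expansion:
  assumes "finite {w. p w \<noteq> 0}"
  shows "p = (\<lambda>v. \<Sum>u\<in>{w. p w \<noteq> 0}. p u * word_poly u v)"
proof
  fix v
  have "(\<Sum>u\<in>{w. p w \<noteq> 0}. p u * word_poly u v) = (\<Sum>u\<in>{w. p w \<noteq> 0}. if u = v then p u else 0)"
    by (intro sum.cong) (auto simp: word_poly_def)
  then show "p v = (\<Sum>u\<in>{w. p w \<noteq> 0}. p u * word_poly u v)" using assms by simp
qed

text \<open>Bilinear extension of \<open>count_shw\<close>. Finiteness matters because
  \<open>shuf\<close> sums over the supports, and a sum over an infinite set has the default value
  0.\<close>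

lemma shuf_eq_shp:
  assumes "finite {w. p w \<noteq> 0}" "finite {w. q w \<noteq> 0}"
  shows "shuf p q = (\<lambda>w. shp w p q)"
proof
  fix w
  have "shp w p q = shp w (\<lambda>v. \<Sum>u\<in>{w. p w \<noteq> 0}. p u * word_poly u v) (\<lambda>v. \<Sum>u\<in>{w. q w \<noteq> 0}. q u * word_poly u v)"
    by (rule arg_cong2[where f = "shp w", OF word_expansion[OF assms(1)] word_expansion[OF assms(2)]])
  also have "\<dots> = (\<Sum>u\<in>{w. p w \<noteq> 0}. \<Sum>v\<in>{w. q w \<noteq> 0}. p u * (q v * shp w (word_poly u) (word_poly v)))"
    by (simp only: assms shp_sum_left shp_sum_right shp_scale_left shp_scale_right sum_distrib_left)
  finally show "shuf p q w = shp w p q"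
    by (simp add: shuf_def count_shw mult.assoc)
qed

section \<open>Derivations and expansions in powers of a variable\<close>

text \<open>An element \<open>x\<close> with \<open>D x = 1\<close> behaves like a polynomial variable over the kernel of \<open>D\<close>.\<close>

locale derivation_var =
  fixes D :: "'r::comm_ring_1 \<Rightarrow> 'r" and x :: 'r and P :: "'r set"
  assumes D_add: "D (p + q) = D p + D q"
    and D_mult: "D (p * q) = D p * q + p * D q"
    and D_x: "D x = 1"
    and x_in: "x \<in> P" and one_in: "1 \<in> P"
    and diff_in: "\<lbrakk>p \<in> P; q \<in> P\<rbrakk> \<Longrightarrow> p - q \<in> P"
    and mult_in: "\<lbrakk>p \<in> P; q \<in> P\<rbrakk> \<Longrightarrow> p * q \<in> P"
    and D_in: "p \<in> P \<Longrightarrow> D p \<in> P"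
    and nat_inverse_in: "\<exists>r\<in>P. r * of_nat (Suc n) = 1"
begin

lemma D_0 [simp]: "D 0 = 0"
  using D_add[of 0 0] by simp

lemma D_1 [simp]: "D 1 = 0"
  using D_mult[of 1 1] by simp

lemma D_minus: "D (- p) = - D p"
proof -
  have "D p + D (- p) = 0" using D_add[of p "- p"] by simp
  then show ?thesis by (simp add: add_eq_0_iff)
qed

lemma D_diff: "D (p - q) = D p - D q"
  using D_add[of p "- q"] by (simp add: D_minus)

lemma D_sum: "D (sum f A) = (\<Sum>i\<in>A. D (f i))"
  by (induction A rule: infinite_finite_induct) (auto simp: D_add)

lemma D_of_nat [simp]: "D (of_nat n) = 0"
  by (induction n) (auto simp: D_add)

lemma D_power_Suc: "D (x ^ Suc n) = of_nat (Suc n) * x ^ n"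
  by (induction n) (auto simp: D_mult D_x algebra_simps)

lemma D_power_mult: "D u = 0 \<Longrightarrow> D (x ^ Suc n * u) = of_nat (Suc n) * x ^ n * u"
  using D_mult[of "x ^ Suc n" u] D_power_Suc[of n] by simp

lemma zero_in: "0 \<in> P"
  using diff_in[OF one_in one_in] by simp

lemma add_in: "p \<in> P \<Longrightarrow> q \<in> P \<Longrightarrow> p + q \<in> P"
  using diff_in[of p "0 - q"] diff_in[OF zero_in, of q] by simp

lemma sum_in: "(\<And>i. i \<in> A \<Longrightarrow> f i \<in> P) \<Longrightarrow> sum f A \<in> P"
  by (induction A rule: infinite_finite_induct) (auto simp: zero_in add_in)

lemma power_in: "p \<in> P \<Longrightarrow> p ^ n \<in> P"
  by (induction n) (auto simp: one_in mult_in)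

text \<open>Invertibility of the positive integers stands in for characteristic zero, as
  \<open>'r\<close> is only a ring.\<close>

lemma nat_torsion_free: "of_nat (Suc n) * p = 0 \<Longrightarrow> p = (0::'r)"
proof -
  assume *: "of_nat (Suc n) * p = 0"
  obtain r :: 'r where "r * of_nat (Suc n) = 1" using nat_inverse_in[of n] by blast
  then have "p = r * (of_nat (Suc n) * p)" by (metis mult.assoc mult_1)
  with * show ?thesis by simp
qed

text \<open>Termwise differentiation of a polynomial in \<open>x\<close> with constant coefficients.
  Besides uniqueness it later governs how the coefficients of a decomposition change when a letter
  is deleted.\<close>

lemma D_power_expansion:
  assumes "\<And>j. D (u j) = 0"
  shows "D (\<Sum>j<Suc N. x ^ j * u j) = (\<Sum>j<N. x ^ j * (of_nat (Suc j) * u (Suc j)))"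
proof -
  have "D (\<Sum>j<Suc N. x ^ j * u j) = (\<Sum>j<N. D (x ^ Suc j * u (Suc j)))"
    unfolding sum.lessThan_Suc_shift D_add D_sum by (simp add: assms)
  also have "\<dots> = (\<Sum>j<N. x ^ j * (of_nat (Suc j) * u (Suc j)))"
    using assms by (intro sum.cong refl, subst D_power_mult) (simp_all only: mult_ac)
  finally show ?thesis .
qed

text \<open>Differentiating shortens the sum, so the induction hypothesis kills all coefficients of
  positive index; the equation then reduces to \<open>u 0 = 0\<close>.\<close>

lemma power_expansion_unique:
  assumes "(\<Sum>j<N. x ^ j * u j) = 0" and "\<And>j. D (u j) = 0" and "i < N"
  shows "u i = 0"
  using assms
proof (induction N arbitrary: u i)
  case (Suc N)
  have nz: "u (Suc j) = 0" if "j < N" for j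
  proof -
    have "(\<Sum>j<N. x ^ j * (of_nat (Suc j) * u (Suc j))) = 0"
      using arg_cong[OF Suc.prems(1), of D] unfolding D_power_expansion[OF Suc.prems(2)] D_0 .
    then have "of_nat (Suc j) * u (Suc j) = 0"
      using Suc.IH[of "\<lambda>j. of_nat (Suc j) * u (Suc j)" j] that D_mult Suc.prems(2)
      by (simp del: of_nat_Suc)
    then show ?thesis by (rule nat_torsion_free)
  qed
  show ?case
  proof (cases i)
    case 0
    have "u 0 + (\<Sum>j<N. x ^ Suc j * u (Suc j)) = 0"
      using Suc.prems(1) unfolding sum.lessThan_Suc_shift by simp
    with 0 nz show ?thesis by simp
  next
    case (Suc j)
    with nz Suc.prems(3) show ?thesis by simp
  qed
qed simp

text \<open>Formal integration: expand \<open>D p\<close> by induction, integrate term by term, and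
  correct by a constant. The set \<open>P\<close> keeps track of where the coefficients
  live.\<close>

lemma power_expansion_exists:
  assumes "p \<in> P" and "(D ^^ N) p = 0"
  shows "\<exists>u. (\<forall>j. u j \<in> P \<and> D (u j) = 0) \<and> (\<forall>j\<ge>N. u j = 0) \<and> p = (\<Sum>j<N. x ^ j * u j)"
  using assms
proof (induction N arbitrary: p)
  case 0
  then show ?case by (intro exI[of _ "\<lambda>_. 0"]) (auto simp: zero_in)
next
  case (Suc N)
  have "(D ^^ N) (D p) = 0" using Suc.prems(2) by (simp add: funpow_swap1)
  then obtain u where u: "\<And>j. u j \<in> P" "\<And>j. D (u j) = 0" "\<And>j. j \<ge> N \<Longrightarrow> u j = 0"
    and Dp: "D p = (\<Sum>j<N. x ^ j * u j)"
    using Suc.IH[OF D_in[OF Suc.prems(1)]] by blast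
  obtain r where r: "\<And>n. r n \<in> P" "\<And>n. of_nat (Suc n) * r n = 1"
    using nat_inverse_in by (metis mult.commute)
  \<comment> \<open>The inverses come from a bare existence statement, so their constancy is derived
    by differentiating \<open>of_nat (Suc n) * r n = 1\<close> and cancelling the integer.\<close>
  have Dr: "D (r n) = 0" for n
  proof -
    have "of_nat (Suc n) * D (r n) = D (of_nat (Suc n) * r n)"
      using D_mult[of "of_nat (Suc n)" "r n"] by (simp only: D_of_nat mult_zero_left add_0_left)
    also have "\<dots> = 0" by (simp only: r D_1)
    finally show ?thesis by (rule nat_torsion_free)
  qed
  \<comment> \<open>\<open>s\<close> is the termwise antiderivative of \<open>D p\<close>; the
    constant of integration \<open>p - s\<close> becomes the coefficient of index 0.\<close>
  define s where "s = (\<Sum>j<N. x ^ Suc j * (r j * u j))"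
  define v where "v = case_nat (p - s) (\<lambda>j. r j * u j)"
  have Dru: "D (r j * u j) = 0" for j by (simp add: D_mult Dr u)
  have "D s = (\<Sum>j<N. (of_nat (Suc j) * r j) * (x ^ j * u j))"
    unfolding s_def D_sum by (intro sum.cong refl, subst D_power_mult[OF Dru]) (simp only: mult_ac)
  then have Ds: "D s = D p" by (simp only: r Dp mult_1)
  have sP: "s \<in> P" unfolding s_def by (intro sum_in mult_in power_in x_in r u)
  have "v j \<in> P \<and> D (v j) = 0" for j
    unfolding v_def using sP Suc.prems(1) r u Dru
    by (cases j) (auto simp: diff_in mult_in D_diff Ds)
  moreover have "\<forall>j\<ge>Suc N. v j = 0"
    by (auto simp: v_def u split: nat.split)
  moreover have "p = (\<Sum>j<Suc N. x ^ j * v j)"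
    unfolding sum.lessThan_Suc_shift by (simp add: v_def s_def)
  ultimately show ?case by blast
qed

end

section \<open>The shuffle algebra as a commutative ring with two derivations\<close>

text \<open>All coefficient functions, not only the finitely supported ones, so that the ring operations are total.\<close>

typedef shalg = "UNIV :: ncpoly set" morphisms cf Sh by simp

lemma cf_Sh [simp]: "cf (Sh f) = f" by (simp add: Sh_inverse)

lemma shalg_eqI: "(\<And>w. cf p w = cf q w) \<Longrightarrow> p = q"
  by (metis cf_inject ext)

instantiation shalg :: comm_ring_1
begin
definition "0 = Sh (\<lambda>_. 0)"
definition "1 = Sh (word_poly [])"
definition "p + q = Sh (\<lambda>w. cf p w + cf q w)"
definition "p - q = Sh (\<lambda>w. cf p w - cf q w)"
definition "- p = Sh (\<lambda>w. - cf p w)"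
definition "p * q = Sh (\<lambda>w. shp w (cf p) (cf q))"
instance
proof
  fix p q r :: shalg
  show "p * q * r = p * (q * r)" by (simp add: times_shalg_def shp_assoc)
  show "p * q = q * p" by (simp add: times_shalg_def shp_comm[of _ "cf p"])
  show "1 * p = p" by (simp add: times_shalg_def one_shalg_def cf_inverse)
  show "(p + q) * r = p * r + q * r"
    by (simp add: times_shalg_def plus_shalg_def shp_add_left)
  have "word_poly [] [] \<noteq> 0" by (simp add: word_poly_def)
  then show "(0::shalg) \<noteq> 1" by (metis cf_Sh one_shalg_def zero_shalg_def)
qed (auto intro!: shalg_eqI simp: plus_shalg_def zero_shalg_def minus_shalg_def uminus_shalg_def)
end

lemma cf_0 [simp]: "cf 0 = (\<lambda>_. 0)" by (simp add: zero_shalg_def)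
lemma cf_1: "cf 1 = word_poly []" by (simp add: one_shalg_def)
lemma cf_add [simp]: "cf (p + q) w = cf p w + cf q w" by (simp add: plus_shalg_def)
lemma cf_diff [simp]: "cf (p - q) w = cf p w - cf q w" by (simp add: minus_shalg_def)
lemma cf_mult: "cf (p * q) w = shp w (cf p) (cf q)" by (simp add: times_shalg_def)

lemma cf_sum: "cf (sum f A) w = (\<Sum>i\<in>A. cf (f i) w)"
  by (induction A rule: infinite_finite_induct) auto

text \<open>Scalars sit on the empty word, so that scalar multiplication is a ring product and no
  module structure on \<open>shalg\<close> is set up.\<close>

definition scal :: "complex \<Rightarrow> shalg" where
  "scal k = Sh (\<lambda>w. if w = [] then k else 0)"

lemma cf_scal_mult [simp]: "cf (scal k * p) w = k * cf p w"
  by (simp add: cf_mult scal_def shp_one_left)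

lemma of_nat_scal: "of_nat n = scal (of_nat n)"
proof (induction n)
  case (Suc n)
  show ?case
    unfolding of_nat_Suc Suc by (rule shalg_eqI) (auto simp: scal_def cf_1 word_poly_def)
qed (auto simp: scal_def zero_shalg_def)

lemma scal_mult: "scal j * scal k = scal (j * k)"
  by (rule shalg_eqI) (simp, simp add: scal_def)

definition left_deriv :: "complex \<Rightarrow> shalg \<Rightarrow> shalg" where
  "left_deriv c p = Sh (\<lambda>w. cf p (c # w))"

definition right_deriv :: "complex \<Rightarrow> shalg \<Rightarrow> shalg" where
  "right_deriv c p = Sh (\<lambda>w. cf p (w @ [c]))"

definition letter :: "complex \<Rightarrow> shalg" where
  "letter c = Sh (word_poly [c])"

lemma cf_left_deriv [simp]: "cf (left_deriv c p) w = cf p (c # w)" by (simp add: left_deriv_def)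
lemma cf_right_deriv [simp]: "cf (right_deriv c p) w = cf p (w @ [c])" by (simp add: right_deriv_def)

lemma left_deriv_right_deriv_commute: "left_deriv a (right_deriv b p) = right_deriv b (left_deriv a p)"
  by (rule shalg_eqI) simp

lemma left_deriv_add: "left_deriv c (p + q) = left_deriv c p + left_deriv c q"
  and right_deriv_add: "right_deriv c (p + q) = right_deriv c p + right_deriv c q"
  by (rule shalg_eqI; simp)+

lemma left_deriv_mult: "left_deriv c (p * q) = left_deriv c p * q + p * left_deriv c q"
  by (rule shalg_eqI) (simp add: cf_mult left_deriv_def)

lemma right_deriv_mult: "right_deriv c (p * q) = right_deriv c p * q + p * right_deriv c q"
  by (rule shalg_eqI) (simp add: cf_mult right_deriv_def shp_snoc)

lemma left_deriv_letter: "left_deriv c (letter d) = (if c = d then 1 else 0)"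
  and right_deriv_letter: "right_deriv c (letter d) = (if c = d then 1 else 0)"
  by (rule shalg_eqI; simp add: letter_def cf_1 word_poly_def)+

lemma left_deriv_0 [simp]: "left_deriv c 0 = 0" and right_deriv_0 [simp]: "right_deriv c 0 = 0"
  and left_deriv_1 [simp]: "left_deriv c 1 = 0" and right_deriv_1 [simp]: "right_deriv c 1 = 0"
  by (rule shalg_eqI; simp add: cf_1 word_poly_def)+

lemma right_deriv_diff: "right_deriv c (p - q) = right_deriv c p - right_deriv c q"
  by (rule shalg_eqI) simp

section \<open>Polynomials as a subring stable under both derivations\<close>

definition Pol :: "complex set \<Rightarrow> shalg set" where
  "Pol S = {p. is_poly S (cf p)}"

text \<open>There are finitely many words of bounded length over a finite alphabet. A length bound
  is easier to carry through products and deletions than finiteness of a support.\<close>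

lemma Pol_iff:
  assumes "finite S"
  shows "p \<in> Pol S \<longleftrightarrow> (\<forall>w. cf p w \<noteq> 0 \<longrightarrow> set w \<subseteq> S) \<and> (\<exists>N. \<forall>w. cf p w \<noteq> 0 \<longrightarrow> length w \<le> N)"
    (is "_ \<longleftrightarrow> ?sub \<and> ?len")
proof
  assume "p \<in> Pol S"
  then have fin: "finite {w. cf p w \<noteq> 0}" and sub: ?sub
    by (simp_all add: Pol_def is_poly_def)
  have "length w \<le> Max (length ` {w. cf p w \<noteq> 0})" if "cf p w \<noteq> 0" for w
    by (rule Max_ge) (use fin that in simp_all)
  with sub show "?sub \<and> ?len" by blast
next
  assume *: "?sub \<and> ?len"
  then obtain N where N: "\<forall>w. cf p w \<noteq> 0 \<longrightarrow> length w \<le> N" by (elim conjE exE)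
  have "{w. cf p w \<noteq> 0} \<subseteq> {w. set w \<subseteq> S \<and> length w \<le> N}"
    using * N by blast
  then have "finite {w. cf p w \<noteq> 0}"
    by (rule finite_subset) (rule finite_lists_length_le[OF assms])
  with * show "p \<in> Pol S"
    by (simp add: Pol_def is_poly_def)
qed

context
  fixes S :: "complex set"
  assumes S: "finite S"
begin

lemma Pol_letters: "p \<in> Pol S \<Longrightarrow> cf p w \<noteq> 0 \<Longrightarrow> set w \<subseteq> S"
  by (simp add: Pol_iff[OF S])

lemma Pol_length: "p \<in> Pol S \<Longrightarrow> \<exists>N. \<forall>w. cf p w \<noteq> 0 \<longrightarrow> length w \<le> N"
  by (simp add: Pol_iff[OF S])

lemma Pol_mult:
  assumes "p \<in> Pol S" "q \<in> Pol S"
  shows "p * q \<in> Pol S"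
proof -
  obtain M N where MN: "\<And>w. cf p w \<noteq> 0 \<Longrightarrow> length w \<le> M" "\<And>w. cf q w \<noteq> 0 \<Longrightarrow> length w \<le> N"
    using Pol_length[OF assms(1)] Pol_length[OF assms(2)] by auto
  have sub: "\<And>w. cf p w \<noteq> 0 \<Longrightarrow> set w \<subseteq> S" "\<And>w. cf q w \<noteq> 0 \<Longrightarrow> set w \<subseteq> S"
    by (fact Pol_letters[OF assms(1)] Pol_letters[OF assms(2)])+
  show ?thesis
    unfolding Pol_iff[OF S] cf_mult
    by (intro conjI allI impI exI[of _ "M + N"]; rule shp_nonzero_set[of "cf p" S "cf q", OF sub]
      shp_nonzero_length[of "cf p" M "cf q" N, OF MN]; assumption)
qed

lemma Pol_diff: "p \<in> Pol S \<Longrightarrow> q \<in> Pol S \<Longrightarrow> p - q \<in> Pol S"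
proof -
  assume "p \<in> Pol S" "q \<in> Pol S"
  then have fin: "finite ({w. cf p w \<noteq> 0} \<union> {w. cf q w \<noteq> 0})"
    and *: "cf p w \<noteq> 0 \<or> cf q w \<noteq> 0 \<Longrightarrow> set w \<subseteq> S" for w
    by (auto simp: Pol_def is_poly_def)
  have "finite {w. cf (p - q) w \<noteq> 0}"
    by (rule finite_subset[OF _ fin]) auto
  moreover have "set w \<subseteq> S" if "cf (p - q) w \<noteq> 0" for w
    using * that by (cases "cf p w = 0") auto
  ultimately show ?thesis by (auto simp: Pol_def is_poly_def)
qed

lemma Pol_left_deriv:
  assumes "p \<in> Pol S"
  shows "left_deriv c p \<in> Pol S"
proof -
  obtain N where N: "\<And>w. cf p w \<noteq> 0 \<Longrightarrow> length w \<le> N"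
    using Pol_length[OF assms] by auto
  note Pol_letters[OF assms]
  with N show ?thesis
    unfolding Pol_iff[OF S] cf_left_deriv
    by (intro conjI allI impI exI[of _ N]) (metis set_subset_Cons subset_trans, metis Suc_leD length_Cons)
qed

lemma Pol_right_deriv:
  assumes "p \<in> Pol S"
  shows "right_deriv c p \<in> Pol S"
proof -
  obtain N where N: "\<And>w. cf p w \<noteq> 0 \<Longrightarrow> length w \<le> N"
    using Pol_length[OF assms] by auto
  note Pol_letters[OF assms]
  with N show ?thesis
    unfolding Pol_iff[OF S] cf_right_deriv
    by (intro conjI allI impI exI[of _ N]) (metis Un_subset_iff set_append, metis Suc_leD length_append_singleton)
qed

lemma Pol_word: "set w \<subseteq> S \<Longrightarrow> Sh (word_poly w) \<in> Pol S"
  unfolding Pol_def is_poly_def by (simp add: word_poly_def)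

lemma Pol_one: "1 \<in> Pol S"
  by (simp add: one_shalg_def Pol_word)

lemma Pol_letter: "c \<in> S \<Longrightarrow> letter c \<in> Pol S"
  by (simp add: letter_def Pol_word)

lemma Pol_scal: "scal k \<in> Pol S"
  unfolding Pol_iff[OF S] by (auto simp: scal_def)

lemma scal_inverse_nat: "scal (1 / of_nat (Suc n)) * of_nat (Suc n) = 1"
  by (simp only: of_nat_scal scal_mult) (auto simp: scal_def one_shalg_def word_poly_def simp del: of_nat_Suc)

lemma derivation_right_deriv:
  assumes "b \<in> S"
  shows "derivation_var (right_deriv b) (letter b) (Pol S)"
  by unfold_locales
    (use assms scal_inverse_nat Pol_scal in \<open>auto intro!: bexI[of _ "scal (1 / of_nat (Suc _))"] simp: right_deriv_add right_deriv_mult right_deriv_letter Pol_one Pol_diff Pol_mult Pol_right_deriv Pol_letter simp del: of_nat_Suc\<close>)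

lemma right_deriv_scal: "right_deriv b (scal k) = 0"
  by (rule shalg_eqI) (simp add: scal_def)

text \<open>The expansion in x_a takes place inside the kernel of \<open>right_deriv b\<close>. This
  kernel is a subring, is stable under \<open>left_deriv a\<close> because the two derivations
  commute, and contains \<open>letter a\<close> because a and b differ.\<close>

lemma derivation_left_deriv:
  assumes "a \<in> S" "a \<noteq> b"
  shows "derivation_var (left_deriv a) (letter a) {p \<in> Pol S. right_deriv b p = 0}"
proof
  fix n
  show "\<exists>r\<in>{p \<in> Pol S. right_deriv b p = 0}. r * of_nat (Suc n) = 1"
    by (rule bexI[of _ "scal (1 / of_nat (Suc n))"]) (simp_all only: scal_inverse_nat Pol_scal right_deriv_scal mem_Collect_eq)
qed (use assms in \<open>auto simp: left_deriv_add left_deriv_mult left_deriv_letter right_deriv_letter right_deriv_mult right_deriv_diff Pol_one Pol_diff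
       Pol_mult Pol_left_deriv Pol_letter left_deriv_right_deriv_commute[symmetric]\<close>)

lemma left_deriv_nilpotent:
  assumes "p \<in> Pol S"
  shows "\<exists>N. (left_deriv a ^^ N) p = 0"
proof -
  obtain N where N: "\<And>w. cf p w \<noteq> 0 \<Longrightarrow> length w \<le> N"
    using Pol_length[OF assms] by auto
  have *: "cf ((left_deriv a ^^ n) p) w = cf p (replicate n a @ w)" for n w
    by (induction n arbitrary: w) (auto simp: replicate_app_Cons_same)
  have "cf p (replicate (Suc N) a @ w) = 0" for w
    using N[of "replicate (Suc N) a @ w"] by (cases "cf p (replicate (Suc N) a @ w) = 0") simp_all
  then have "(left_deriv a ^^ Suc N) p = 0"
    by (intro shalg_eqI) (simp only: * cf_0)
  then show ?thesis by blast
qed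

lemma right_deriv_nilpotent:
  assumes "p \<in> Pol S"
  shows "\<exists>N. (right_deriv b ^^ N) p = 0"
proof -
  obtain N where N: "\<And>w. cf p w \<noteq> 0 \<Longrightarrow> length w \<le> N"
    using Pol_length[OF assms] by auto
  have *: "cf ((right_deriv b ^^ n) p) w = cf p (w @ replicate n b)" for n w
    by (induction n arbitrary: w) (auto simp: replicate_app_Cons_same)
  have "cf p (w @ replicate (Suc N) b) = 0" for w
    using N[of "w @ replicate (Suc N) b"] by (cases "cf p (w @ replicate (Suc N) b) = 0") simp_all
  then have "(right_deriv b ^^ Suc N) p = 0"
    by (intro shalg_eqI) (simp only: * cf_0)
  then show ?thesis by blast
qed

end

section \<open>The decomposition defining the regularisation\<close>

lemma cf_letter: "cf (letter c) = word_poly [c]" by (simp add: letter_def)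

lemma left_deriv_eq_0_iff: "left_deriv c p = 0 \<longleftrightarrow> (\<forall>w. cf p (c # w) = 0)"
  by (metis cf_0 cf_left_deriv shalg_eqI)

lemma right_deriv_eq_0_iff: "right_deriv c p = 0 \<longleftrightarrow> (\<forall>w. cf p (w @ [c]) = 0)"
  by (metis cf_0 cf_right_deriv shalg_eqI)

lemma inAb_iff: "inAb b (cf p) \<longleftrightarrow> right_deriv b p = 0"
  unfolding inAb_def right_deriv_eq_0_iff
proof (intro iffI allI impI)
  fix w assume "\<forall>w. cf p w \<noteq> 0 \<longrightarrow> w = [] \<or> last w \<noteq> b"
  from this[rule_format, of "w @ [b]"] show "cf p (w @ [b]) = 0" by auto
next
  fix w assume "\<forall>w. cf p (w @ [b]) = 0" "cf p w \<noteq> 0"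
  then show "w = [] \<or> last w \<noteq> b" by (cases w rule: rev_cases) auto
qed

lemma inAab_iff: "inAab a b (cf p) \<longleftrightarrow> left_deriv a p = 0 \<and> right_deriv b p = 0"
proof -
  have "inAab a b (cf p) \<longleftrightarrow> (\<forall>w. cf p w \<noteq> 0 \<longrightarrow> w = [] \<or> hd w \<noteq> a) \<and> inAb b (cf p)"
    unfolding inAab_def inAb_def by blast
  moreover have "(\<forall>w. cf p w \<noteq> 0 \<longrightarrow> w = [] \<or> hd w \<noteq> a) \<longleftrightarrow> left_deriv a p = 0"
    unfolding left_deriv_eq_0_iff
  proof (intro iffI allI impI)
    fix w assume "\<forall>w. cf p w \<noteq> 0 \<longrightarrow> w = [] \<or> hd w \<noteq> a"
    from this[rule_format, of "a # w"] show "cf p (a # w) = 0" by auto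
  next
    fix w assume "\<forall>w. cf p (a # w) = 0" "cf p w \<noteq> 0"
    then show "w = [] \<or> hd w \<noteq> a" by (cases w) auto
  qed
  ultimately show ?thesis by (simp add: inAb_iff)
qed

lemma shuf_cf:
  assumes "p \<in> Pol S" "q \<in> Pol S"
  shows "shuf (cf p) (cf q) = cf (p * q)"
  using assms by (auto simp: shuf_eq_shp Pol_def is_poly_def cf_mult)

lemma spow_letter:
  assumes "finite S" "c \<in> S"
  shows "spow (word_poly [c]) n = cf (letter c ^ n)"
proof (induction n)
  case (Suc n)
  have "letter c ^ n \<in> Pol S"
    using derivation_var.power_in[OF derivation_right_deriv[OF assms]] Pol_letter[OF assms] by blast
  then show ?case using shuf_cf[OF Pol_letter[OF assms]] by (simp add: Suc cf_letter)
qed (simp add: cf_1)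

text \<open>This is what lets a character be recovered from its values on \<open>A^b\<close> and on
  \<open>letter b\<close>.\<close>

lemma decomposition_Ab:
  assumes "finite S" "b \<in> S" "p \<in> Pol S"
  shows "\<exists>N u. (\<forall>j. u j \<in> Pol S \<and> right_deriv b (u j) = 0) \<and> p = (\<Sum>j<N. letter b ^ j * u j)"
proof -
  obtain N where "(right_deriv b ^^ N) p = 0" using right_deriv_nilpotent[OF assms(1,3)] by blast
  from derivation_var.power_expansion_exists[OF derivation_right_deriv[OF assms(1,2)] assms(3) this]
  show ?thesis by (elim exE conjE) (intro exI conjI)
qed

text \<open>Mirrors the condition in \<open>regab\<close>: the family is total and vanishes beyond
  an existentially quantified bound, so that the family itself is unique although the truncation is
  not.\<close>

definition ab_decomposition ::
  "complex set \<Rightarrow> complex \<Rightarrow> complex \<Rightarrow> shalg \<Rightarrow> (nat \<Rightarrow> nat \<Rightarrow> shalg) \<Rightarrow> bool" where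
  "ab_decomposition S a b p v \<longleftrightarrow>
     (\<forall>i j. v i j \<in> Pol S \<and> left_deriv a (v i j) = 0 \<and> right_deriv b (v i j) = 0) \<and>
     (\<exists>N. (\<forall>i j. N \<le> i \<or> N \<le> j \<longrightarrow> v i j = 0) \<and>
          p = (\<Sum>i<N. \<Sum>j<N. letter a ^ i * v i j * letter b ^ j))"

lemma ab_decompositionI:
  assumes "\<And>i j. v i j \<in> Pol S \<and> left_deriv a (v i j) = 0 \<and> right_deriv b (v i j) = 0"
    and "\<And>i j. N \<le> i \<or> N \<le> j \<Longrightarrow> v i j = 0"
    and "p = (\<Sum>i<N. \<Sum>j<N. letter a ^ i * v i j * letter b ^ j)"
  shows "ab_decomposition S a b p v"
  unfolding ab_decomposition_def using assms(1,2) by (intro conjI exI[of _ N] assms(3)) auto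

context
  fixes S :: "complex set" and a b :: complex
  assumes S: "finite S" and aS: "a \<in> S" and bS: "b \<in> S" and ab: "a \<noteq> b"
begin

interpretation L: derivation_var "left_deriv a" "letter a" "{p \<in> Pol S. right_deriv b p = 0}"
  by (rule derivation_left_deriv[OF S aS ab])

interpretation R: derivation_var "right_deriv b" "letter b" "Pol S"
  by (rule derivation_right_deriv[OF S bS])

text \<open>Nested expansions: in x_b with coefficients in the kernel of
  \<open>right_deriv b\<close>, then each coefficient in x_a within that kernel.\<close>

lemma ab_decomposition_exists:
  assumes p: "p \<in> Pol S"
  shows "\<exists>v. ab_decomposition S a b p v"
proof -
  obtain N where "(right_deriv b ^^ N) p = 0" using right_deriv_nilpotent[OF S p] by blast
  from R.power_expansion_exists[OF p this] obtain u
    where u': "\<forall>j. u j \<in> Pol S \<and> right_deriv b (u j) = 0" and pu: "p = (\<Sum>j<N. letter b ^ j * u j)"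
    by (elim exE conjE) (rule that)
  then have u: "\<And>j. u j \<in> Pol S" "\<And>j. right_deriv b (u j) = 0" by simp_all
  define Q where "Q j M v \<longleftrightarrow> (\<forall>i. v i \<in> {p \<in> Pol S. right_deriv b p = 0} \<and> left_deriv a (v i) = 0) \<and>
      (\<forall>i\<ge>M. v i = 0) \<and> u j = (\<Sum>i<M. letter a ^ i * v i)" for j M v
  have "\<exists>M v. Q j M v" for j
  proof -
    obtain M where M: "(left_deriv a ^^ M) (u j) = 0" using left_deriv_nilpotent[OF S u(1)] by blast
    have "u j \<in> {p \<in> Pol S. right_deriv b p = 0}" using u by simp
    from L.power_expansion_exists[OF this M] show ?thesis unfolding Q_def by (rule exI)
  qed
  then obtain M v where "\<And>j. Q j (M j) (v j)" by metis
  then have v: "\<And>i j. v j i \<in> {p \<in> Pol S. right_deriv b p = 0}" "\<And>i j. left_deriv a (v j i) = 0"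
      "\<And>i j. i \<ge> M j \<Longrightarrow> v j i = 0" "\<And>j. u j = (\<Sum>i<M j. letter a ^ i * v j i)"
    unfolding Q_def by simp_all
  \<comment> \<open>One truncation for both indices: at least the bound \<open>N\<close> in x_b and
    each bound \<open>M j\<close> in x_a. Setting \<open>v'\<close> to 0 for \<open>j\<close> from
    \<open>N\<close> on leaves only finitely many \<open>M j\<close> to dominate.\<close>
  define K where "K = Max (insert N (M ` {..<N}))"
  have KN: "N \<le> K" and KM: "j < N \<Longrightarrow> M j \<le> K" for j by (auto simp: K_def)
  define v' where "v' = (\<lambda>i j. if j < N then v j i else 0)"
  have "u j = (\<Sum>i<K. letter a ^ i * v' i j)" if "j < N" for j
    unfolding v(4) v'_def using that KM[OF that] v(3)[of j]
    by (intro sum.mono_neutral_cong_left) auto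
  moreover have "p = (\<Sum>j<N. letter b ^ j * u j)" by (rule pu)
  ultimately have "p = (\<Sum>j<N. letter b ^ j * (\<Sum>i<K. letter a ^ i * v' i j))" by simp
  also have "\<dots> = (\<Sum>j<K. letter b ^ j * (\<Sum>i<K. letter a ^ i * v' i j))"
    using KN by (intro sum.mono_neutral_left) (auto simp: v'_def)
  also have "\<dots> = (\<Sum>j<K. \<Sum>i<K. letter a ^ i * v' i j * letter b ^ j)"
    by (simp add: sum_distrib_left mult_ac)
  also have "\<dots> = (\<Sum>i<K. \<Sum>j<K. letter a ^ i * v' i j * letter b ^ j)"
    by (rule sum.swap)
  finally have 1: "p = \<dots>" .
  have 2: "\<forall>i j. K \<le> i \<or> K \<le> j \<longrightarrow> v' i j = 0"
    using KN KM v(3) by (auto simp: v'_def intro: order_trans)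
  have 3: "\<forall>i j. v' i j \<in> Pol S \<and> left_deriv a (v' i j) = 0 \<and> right_deriv b (v' i j) = 0"
    using v by (auto simp: v'_def R.zero_in)
  show ?thesis
    by (intro exI[of _ v'] ab_decompositionI[OF _ _ 1]) (use 2 3 in auto)
qed

lemma ab_decomposition_extend:
  assumes "ab_decomposition S a b p v"
  shows "\<exists>N. \<forall>M\<ge>N. p = (\<Sum>i<M. \<Sum>j<M. letter a ^ i * v i j * letter b ^ j)"
proof -
  obtain N where N: "\<And>i j. N \<le> i \<or> N \<le> j \<Longrightarrow> v i j = 0"
    and p: "p = (\<Sum>i<N. \<Sum>j<N. letter a ^ i * v i j * letter b ^ j)"
    using assms unfolding ab_decomposition_def by blast
  have "p = (\<Sum>i<M. \<Sum>j<M. letter a ^ i * v i j * letter b ^ j)" if "M \<ge> N" for M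
  proof -
    have "p = (\<Sum>i<N. \<Sum>j<M. letter a ^ i * v i j * letter b ^ j)"
      unfolding p using that N by (intro sum.cong refl sum.mono_neutral_left) auto
    also have "\<dots> = (\<Sum>i<M. \<Sum>j<M. letter a ^ i * v i j * letter b ^ j)"
      using that N by (intro sum.mono_neutral_left) (auto simp: N)
    finally show ?thesis .
  qed
  then show ?thesis by blast
qed

lemma right_deriv_letter_a_power: "right_deriv b (letter a ^ n) = 0"
  using ab by (induction n) (auto simp: R.D_mult right_deriv_letter)

text \<open>Two uses of \<open>power_expansion_unique\<close> on the difference: in x_b, where the
  inner sums over powers of x_a are constants for \<open>right_deriv b\<close>, and then in
  x_a.\<close>

lemma ab_decomposition_unique:
  assumes v: "ab_decomposition S a b p v" and w: "ab_decomposition S a b p w"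
  shows "v = w"
proof (intro ext)
  fix i j
  obtain N where N: "\<forall>M\<ge>N. p = (\<Sum>i<M. \<Sum>j<M. letter a ^ i * v i j * letter b ^ j)"
    using ab_decomposition_extend[OF v] by blast
  obtain N' where N': "\<forall>M\<ge>N'. p = (\<Sum>i<M. \<Sum>j<M. letter a ^ i * w i j * letter b ^ j)"
    using ab_decomposition_extend[OF w] by blast
  define M where "M = Max {N, N', Suc i, Suc j}"
  have M: "M \<ge> N" "M \<ge> N'" "i < M" "j < M" by (auto simp: M_def)
  define d where "d = (\<lambda>i j. v i j - w i j)"
  have d: "left_deriv a (d i j) = 0" "right_deriv b (d i j) = 0" for i j
    using v w by (simp_all add: d_def ab_decomposition_def L.D_diff R.D_diff)
  have "(\<Sum>j<M. letter b ^ j * (\<Sum>i<M. letter a ^ i * d i j))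
      = (\<Sum>i<M. \<Sum>j<M. letter a ^ i * v i j * letter b ^ j)
      - (\<Sum>i<M. \<Sum>j<M. letter a ^ i * w i j * letter b ^ j)"
    unfolding sum_distrib_left sum_subtractf[symmetric] d_def
    by (subst sum.swap, intro sum.cong refl) (simp add: algebra_simps)
  also have "\<dots> = 0" 
    by (simp only: N[rule_format, OF M(1), symmetric] N'[rule_format, OF M(2), symmetric] diff_self)
  finally have "(\<Sum>i<M. letter a ^ i * d i j) = 0"
  proof (rule R.power_expansion_unique[OF _ _ \<open>j < M\<close>])
    show "right_deriv b (\<Sum>i<M. letter a ^ i * d i j) = 0" for j
      by (simp add: R.D_sum R.D_mult right_deriv_letter_a_power d)
  qed
  then have "d i j = 0"
    by (rule L.power_expansion_unique[OF _ _ \<open>i < M\<close>]) (simp add: d)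
  then show "v i j = w i j" by (simp add: d_def)
qed

section \<open>Coefficients of the decomposition under deletion of letters\<close>

definition ab_coeff :: "shalg \<Rightarrow> nat \<Rightarrow> nat \<Rightarrow> shalg" where
  "ab_coeff p = (THE v. ab_decomposition S a b p v)"

lemma ab_coeff_eqI: "ab_decomposition S a b p v \<Longrightarrow> ab_coeff p = v"
  unfolding ab_coeff_def using ab_decomposition_unique by blast

lemma ab_coeff: "p \<in> Pol S \<Longrightarrow> ab_decomposition S a b p (ab_coeff p)"
  using ab_decomposition_exists ab_coeff_eqI by metis

lemma ab_coeff_in: "p \<in> Pol S \<Longrightarrow> ab_coeff p i j \<in> Pol S"
  using ab_coeff by (simp add: ab_decomposition_def)

lemma ab_decomposition_scal:
  assumes "ab_decomposition S a b p v"
  shows "\<forall>i j. of_nat n * v i j \<in> Pol S \<and> left_deriv a (of_nat n * v i j) = 0 \<and> right_deriv b (of_nat n * v i j) = 0"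
  using assms by (simp add: ab_decomposition_def L.D_mult R.D_mult of_nat_scal Pol_mult[OF S] Pol_scal[OF S] right_deriv_scal[OF S])
    (simp add: of_nat_scal[symmetric])

lemma left_deriv_letter_b_power: "left_deriv a (letter b ^ n) = 0"
  using ab by (induction n) (auto simp: L.D_mult left_deriv_letter)

text \<open>Differentiating the decomposition of \<open>p\<close> termwise gives a decomposition of
  \<open>left_deriv a p\<close>, since x_b and all coefficients are constants for this derivation;
  uniqueness then identifies the coefficients.\<close>

lemma ab_coeff_left_deriv:
  assumes p: "p \<in> Pol S"
  shows "ab_coeff (left_deriv a p) i j = of_nat (Suc i) * ab_coeff p (Suc i) j"
proof -
  let ?v = "ab_coeff p"
  note dec = ab_coeff[OF p]
  obtain N where N: "\<And>i j. N \<le> i \<or> N \<le> j \<Longrightarrow> ?v i j = 0"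
    using dec unfolding ab_decomposition_def by blast
  obtain K where K: "\<forall>M\<ge>K. p = (\<Sum>i<M. \<Sum>j<M. letter a ^ i * ?v i j * letter b ^ j)"
    using ab_decomposition_extend[OF dec] by blast
  let ?w = "\<lambda>i j. of_nat (Suc i) * ?v (Suc i) j"
  have dv: "left_deriv a (?v i j) = 0" for i j using dec by (simp add: ab_decomposition_def)
  \<comment> \<open>The extra index is consumed by the differentiation in \<open>i\<close>; in
    \<open>j\<close> it is dropped at once, because \<open>?v i (N + K)\<close> vanishes.\<close>
  have "p = (\<Sum>i<Suc (N + K). \<Sum>j<Suc (N + K). letter a ^ i * ?v i j * letter b ^ j)"
    by (rule K[rule_format]) simp
  also have "\<dots> = (\<Sum>i<Suc (N + K). \<Sum>j<N + K. letter a ^ i * ?v i j * letter b ^ j)"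
    by (simp add: N)
  also have "\<dots> = (\<Sum>i<Suc (N + K). letter a ^ i * (\<Sum>j<N + K. ?v i j * letter b ^ j))"
    by (simp only: sum_distrib_left mult.assoc)
  finally have "left_deriv a p = left_deriv a \<dots>" by (rule arg_cong)
  also have "\<dots> = (\<Sum>i<N + K. letter a ^ i * (of_nat (Suc i) * (\<Sum>j<N + K. ?v (Suc i) j * letter b ^ j)))"
    by (rule L.D_power_expansion) (simp add: L.D_sum L.D_mult dv left_deriv_letter_b_power)
  also have "\<dots> = (\<Sum>i<N + K. \<Sum>j<N + K. letter a ^ i * ?w i j * letter b ^ j)"
    by (simp only: sum_distrib_left mult.assoc)
  finally have "ab_decomposition S a b (left_deriv a p) ?w"
    using ab_decomposition_scal[OF dec] N by (intro ab_decompositionI) (auto simp del: of_nat_Suc)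
  then show ?thesis by (simp add: ab_coeff_eqI)
qed

lemma ab_coeff_right_deriv:
  assumes p: "p \<in> Pol S"
  shows "ab_coeff (right_deriv b p) i j = of_nat (Suc j) * ab_coeff p i (Suc j)"
proof -
  let ?v = "ab_coeff p"
  note dec = ab_coeff[OF p]
  obtain N where N: "\<And>i j. N \<le> i \<or> N \<le> j \<Longrightarrow> ?v i j = 0"
    using dec unfolding ab_decomposition_def by blast
  obtain K where K: "\<forall>M\<ge>K. p = (\<Sum>i<M. \<Sum>j<M. letter a ^ i * ?v i j * letter b ^ j)"
    using ab_decomposition_extend[OF dec] by blast
  let ?w = "\<lambda>i j. of_nat (Suc j) * ?v i (Suc j)"
  have dv: "right_deriv b (?v i j) = 0" for i j using dec by (simp add: ab_decomposition_def)
  have "p = (\<Sum>i<Suc (N + K). \<Sum>j<Suc (N + K). letter a ^ i * ?v i j * letter b ^ j)"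
    by (rule K[rule_format]) simp
  also have "\<dots> = (\<Sum>i<N + K. \<Sum>j<Suc (N + K). letter a ^ i * ?v i j * letter b ^ j)"
    by (simp add: N)
  also have "\<dots> = (\<Sum>j<Suc (N + K). letter b ^ j * (\<Sum>i<N + K. letter a ^ i * ?v i j))"
    by (subst sum.swap) (simp only: sum_distrib_left mult_ac)
  finally have "right_deriv b p = right_deriv b \<dots>" by (rule arg_cong)
  also have "\<dots> = (\<Sum>j<N + K. letter b ^ j * (of_nat (Suc j) * (\<Sum>i<N + K. letter a ^ i * ?v i (Suc j))))"
    by (rule R.D_power_expansion) (simp add: R.D_sum R.D_mult dv right_deriv_letter_a_power)
  also have "\<dots> = (\<Sum>i<N + K. \<Sum>j<N + K. letter a ^ i * ?w i j * letter b ^ j)"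
    by (subst sum.swap) (simp only: sum_distrib_left mult_ac)
  finally have "ab_decomposition S a b (right_deriv b p) ?w"
    using ab_decomposition_scal[OF dec] N by (intro ab_decompositionI) (auto simp del: of_nat_Suc)
  then show ?thesis by (simp add: ab_coeff_eqI)
qed

lemma left_deriv_funpow_in: "p \<in> Pol S \<Longrightarrow> (left_deriv a ^^ k) p \<in> Pol S"
  and right_deriv_funpow_in: "p \<in> Pol S \<Longrightarrow> (right_deriv b ^^ k) p \<in> Pol S"
  by (induction k) (auto simp: Pol_left_deriv[OF S] Pol_right_deriv[OF S])

text \<open>Iteration multiplies by (i+1)...(i+k). The factorials stand on both sides because
  \<open>shalg\<close> has no division.\<close>

lemma ab_coeff_left_deriv_funpow:
  "p \<in> Pol S \<Longrightarrow> of_nat (fact i) * ab_coeff ((left_deriv a ^^ k) p) i j = of_nat (fact (i + k)) * ab_coeff p (i + k) j"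
proof (induction k arbitrary: i)
  case (Suc k)
  have "of_nat (fact i) * ab_coeff ((left_deriv a ^^ Suc k) p) i j = of_nat (fact (Suc i)) * ab_coeff ((left_deriv a ^^ k) p) (Suc i) j"
    using ab_coeff_left_deriv[OF left_deriv_funpow_in[OF Suc.prems]] by (simp add: algebra_simps)
  then show ?case using Suc.IH[OF Suc.prems, of "Suc i"] by simp
qed simp

lemma ab_coeff_right_deriv_funpow:
  "p \<in> Pol S \<Longrightarrow> of_nat (fact j) * ab_coeff ((right_deriv b ^^ k) p) i j = of_nat (fact (j + k)) * ab_coeff p i (j + k)"
proof (induction k arbitrary: j)
  case (Suc k)
  have "of_nat (fact j) * ab_coeff ((right_deriv b ^^ Suc k) p) i j = of_nat (fact (Suc j)) * ab_coeff ((right_deriv b ^^ k) p) i (Suc j)"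
    using ab_coeff_right_deriv[OF right_deriv_funpow_in[OF Suc.prems]] by (simp add: algebra_simps)
  then show ?case using Suc.IH[OF Suc.prems, of "Suc j"] by simp
qed simp

lemma ab_coeff_reduce:
  assumes "p \<in> Pol S"
  shows "ab_coeff ((left_deriv a ^^ i) ((right_deriv b ^^ j) p)) 0 0 = of_nat (fact i) * of_nat (fact j) * ab_coeff p i j"
  using ab_coeff_left_deriv_funpow[OF right_deriv_funpow_in[OF assms], of 0 i j 0] ab_coeff_right_deriv_funpow[OF assms, of 0 j i]
  by (simp add: mult_ac)

lemma ab_decomposition_iff:
  "ab_decomposition S a b (Sh p) (\<lambda>i j. Sh (vs i j)) \<longleftrightarrow>
     (\<forall>i j. is_poly S (vs i j) \<and> inAab a b (vs i j)) \<and>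
     (\<exists>N. (\<forall>i j. N \<le> i \<or> N \<le> j \<longrightarrow> vs i j = (\<lambda>_. 0)) \<and>
           p = (\<lambda>w. \<Sum>i<N. \<Sum>j<N.
                 shuf (shuf (spow (word_poly [a]) i) (vs i j)) (spow (word_poly [b]) j) w))"
  (is "_ \<longleftrightarrow> ?vs \<and> (\<exists>N. ?z N \<and> ?p N)")
\<comment> \<open>Rewriting \<open>shuf\<close> as the ring product needs finite supports, which
  \<open>?vs\<close> provides; without \<open>?vs\<close> both sides are false.\<close>
proof (cases "?vs")
  case True
  then have in_Pol: "Sh (vs i j) \<in> Pol S" for i j by (simp add: Pol_def)
  have A: "letter a ^ i \<in> Pol S" "letter b ^ i \<in> Pol S" for i
    using R.power_in Pol_letter[OF S] aS bS by blast+
  have sh: "shuf (shuf (spow (word_poly [a]) i) (vs i j)) (spow (word_poly [b]) j)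
      = cf (letter a ^ i * Sh (vs i j) * letter b ^ j)" for i j
    using shuf_cf[OF A(1) in_Pol] shuf_cf[OF Pol_mult[OF S A(1) in_Pol] A(2)]
    by (simp add: spow_letter[OF S] aS bS)
  have Sh_eq: "Sh p = q \<longleftrightarrow> p = cf q" for q by (metis cf_Sh cf_inverse)
  have "?p N \<longleftrightarrow> Sh p = (\<Sum>i<N. \<Sum>j<N. letter a ^ i * Sh (vs i j) * letter b ^ j)" for N
    unfolding sh Sh_eq by (simp only: cf_sum fun_eq_iff)
  moreover have "Sh q = 0 \<longleftrightarrow> q = (\<lambda>_. 0)" for q by (metis cf_0 cf_Sh zero_shalg_def)
  ultimately show ?thesis
    unfolding ab_decomposition_def inAab_iff[symmetric] by (simp add: Pol_def)
next
  case False
  then show ?thesis unfolding ab_decomposition_def inAab_iff[symmetric] by (auto simp: Pol_def)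
qed

lemma regab_eq:
  assumes "is_poly S p"
  shows "regab S a b p = cf (ab_coeff (Sh p) 0 0)"
proof -
  have in_Pol: "Sh p \<in> Pol S" using assms by (simp add: Pol_def)
  let ?v = "\<lambda>i j. cf (ab_coeff (Sh p) i j)"
  have "ab_decomposition S a b (Sh p) (\<lambda>i j. Sh (?v i j))"
    using ab_coeff[OF in_Pol] by (simp add: cf_inverse)
  moreover have "vs = ?v" if "ab_decomposition S a b (Sh p) (\<lambda>i j. Sh (vs i j))" for vs
    by (simp add: ab_coeff_eqI[OF that])
  ultimately have "(THE vs. ab_decomposition S a b (Sh p) (\<lambda>i j. Sh (vs i j))) = ?v"
    by (rule the_equality)
  then show ?thesis unfolding ab_decomposition_iff regab_def by simp
qed

end

section \<open>Values of characters on words\<close>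

context
  fixes S :: "complex set" and a b :: complex
  assumes S: "finite S" and aS: "a \<in> S" and bS: "b \<in> S" and ab: "a \<noteq> b"
begin

interpretation R: derivation_var "right_deriv b" "letter b" "Pol S"
  by (rule derivation_right_deriv[OF S bS])

lemma cf_funpow: "cf ((left_deriv a ^^ i) ((right_deriv b ^^ j) p)) v = cf p (replicate i a @ v @ replicate j b)"
proof -
  have "cf ((right_deriv b ^^ j) p) v = cf p (v @ replicate j b)" for v
    by (induction j arbitrary: v) (auto simp: replicate_app_Cons_same)
  then show ?thesis
    by (induction i arbitrary: v) (auto simp: replicate_app_Cons_same)
qed

lemma replicate_iff: "u = replicate (length u) x \<longleftrightarrow> (\<forall>y\<in>set u. y = x)"
  by (induction u) auto

text \<open>Stated with cut positions \<open>i\<close> and \<open>m\<close> in place of exponents,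
  to match the nested cuts of a triple \<open>ser_mult\<close>. The condition for a nonzero result
  is the one under which both \<open>ser_exp\<close> factors can be nonzero.\<close>

lemma funpow_word:
  assumes "i \<le> m" "m \<le> length w"
  shows "(left_deriv a ^^ i) ((right_deriv b ^^ (length w - m)) (Sh (word_poly w))) =
    (if (\<forall>x\<in>set (take i w). x = a) \<and> (\<forall>x\<in>set (drop m w). x = b)
     then Sh (word_poly (drop i (take m w))) else 0)"
proof (rule shalg_eqI, unfold cf_funpow)
  fix v
  have "replicate i a @ v @ replicate (length w - m) b = w \<longleftrightarrow>
      take i w = replicate i a \<and> drop m w = replicate (length w - m) b \<and> v = drop i (take m w)"
  proof
    assume *: "replicate i a @ v @ replicate (length w - m) b = w"
    then have "length v = m - i" using assms by (auto dest: arg_cong[where f = length])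
    with assms have "take i (replicate i a @ v @ replicate (length w - m) b) = replicate i a"
      "drop m (replicate i a @ v @ replicate (length w - m) b) = replicate (length w - m) b"
      "drop i (take m (replicate i a @ v @ replicate (length w - m) b)) = v"
      by auto
    then show "take i w = replicate i a \<and> drop m w = replicate (length w - m) b \<and> v = drop i (take m w)"
      unfolding * by simp
  next
    assume *: "take i w = replicate i a \<and> drop m w = replicate (length w - m) b \<and> v = drop i (take m w)"
    have "w = take i (take m w) @ drop i (take m w) @ drop m w"
      by (metis append.assoc append_take_drop_id)
    with * assms show "replicate i a @ v @ replicate (length w - m) b = w"
      by (simp add: min_def)
  qed
  moreover have "take i w = replicate i a \<longleftrightarrow> (\<forall>x\<in>set (take i w). x = a)"
    using replicate_iff[of "take i w" a] assms by (simp add: min_absorb2)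
  moreover have "drop m w = replicate (length w - m) b \<longleftrightarrow> (\<forall>x\<in>set (drop m w). x = b)"
    using replicate_iff[of "drop m w" b] by simp
  ultimately show "cf (Sh (word_poly w)) (replicate i a @ v @ replicate (length w - m) b) =
     cf (if (\<forall>x\<in>set (take i w). x = a) \<and> (\<forall>x\<in>set (drop m w). x = b)
         then Sh (word_poly (drop i (take m w))) else 0) v"
    by (auto simp: word_poly_def)
qed

lemma funpow_word_0:
  assumes "length w < i + j"
  shows "(left_deriv a ^^ i) ((right_deriv b ^^ j) (Sh (word_poly w))) = 0"
proof (rule shalg_eqI, unfold cf_funpow)
  fix v
  have "replicate i a @ v @ replicate j b \<noteq> w"
    using assms by (auto dest: arg_cong[where f = length])
  then show "cf (Sh (word_poly w)) (replicate i a @ v @ replicate j b) = cf 0 v"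
    by (simp add: word_poly_def)
qed

text \<open>The factorisation is algebraic and holds for every unital character: the factorials in
  \<open>ab_coeff_reduce\<close> are those of the exponential series, and the conditions in
  \<open>funpow_word\<close> are the supports of \<open>ser_exp\<close>.\<close>

lemma hom_word_regab:
  fixes \<phi> :: "shalg \<Rightarrow> complex"
  assumes add: "\<And>p q. p \<in> Pol S \<Longrightarrow> q \<in> Pol S \<Longrightarrow> \<phi> (p + q) = \<phi> p + \<phi> q"
    and scal: "\<And>k p. p \<in> Pol S \<Longrightarrow> \<phi> (scal k * p) = k * \<phi> p"
    and mult: "\<And>p q. p \<in> Pol S \<Longrightarrow> q \<in> Pol S \<Longrightarrow> \<phi> (p * q) = \<phi> p * \<phi> q"
    and one: "\<phi> 1 = 1" and w: "set w \<subseteq> S"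
  shows "\<phi> (Sh (word_poly w)) =
    ser_mult (ser_mult (ser_exp a (\<phi> (letter a))) (\<lambda>v. \<phi> (Sh (regab S a b (word_poly v)))))
      (ser_exp b (\<phi> (letter b))) w"
proof -
  let ?p = "Sh (word_poly w)" and ?n = "length w"
  let ?V = "ab_coeff S a b"
  have p: "?p \<in> Pol S" by (rule Pol_word[OF S w])
  have zero: "\<phi> 0 = 0" using scal[OF R.zero_in, of 0] by simp
  have sum_hom: "\<phi> (\<Sum>i\<in>A. f i) = (\<Sum>i\<in>A. \<phi> (f i))" if "\<And>i. i \<in> A \<Longrightarrow> f i \<in> Pol S" for A :: "nat set" and f
    using that by (induction A rule: infinite_finite_induct) (auto simp: zero add R.sum_in)
  have power_hom: "\<phi> (q ^ n) = \<phi> q ^ n" if "q \<in> Pol S" for q n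
    using that by (induction n) (auto simp: one mult R.power_in)
  have nat_hom: "\<phi> (of_nat n * q) = of_nat n * \<phi> q" if "q \<in> Pol S" for q n
    using scal[OF that, of "of_nat n"] by (simp add: of_nat_scal)
  have V: "?V q i j \<in> Pol S" if "q \<in> Pol S" for q i j
    using ab_coeff_in[OF S aS bS ab that] .
  have la: "letter a \<in> Pol S" and lb: "letter b \<in> Pol S" using Pol_letter[OF S] aS bS by auto
  define T where "T i j = \<phi> (letter a) ^ i / fact i * \<phi> (?V ((left_deriv a ^^ i) ((right_deriv b ^^ j) ?p)) 0 0)
      * (\<phi> (letter b) ^ j / fact j)" for i j
  have T: "\<phi> (letter a ^ i * ?V ?p i j * letter b ^ j) = T i j" for i j
  proof -
    have "\<phi> (?V ((left_deriv a ^^ i) ((right_deriv b ^^ j) ?p)) 0 0) = fact i * fact j * \<phi> (?V ?p i j)"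
      unfolding ab_coeff_reduce[OF S aS bS ab p] of_nat_mult[symmetric] nat_hom[OF V[OF p]] by simp
    then show ?thesis
      by (simp add: T_def mult power_hom la lb V p R.power_in R.mult_in field_simps)
  qed
  have V0: "?V 0 0 0 = 0"
    using ab_coeff_eqI[OF S aS bS ab ab_decompositionI[of "\<lambda>_ _. 0" S a b 0 0]] R.zero_in by simp
  have T0: "T i j = 0" if "?n < i + j" for i j
    unfolding T_def funpow_word_0[OF that] V0 zero by simp
  obtain N where N: "\<forall>M\<ge>N. ?p = (\<Sum>i<M. \<Sum>j<M. letter a ^ i * ?V ?p i j * letter b ^ j)"
    using ab_decomposition_extend[OF S aS bS ab ab_coeff[OF S aS bS ab p]] by blast
  \<comment> \<open>Beyond \<open>N\<close> the decomposition may be truncated; beyond the length of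
    \<open>w\<close> the range contains every pair with \<open>i + j\<close> at most that length,
    the only pairs with \<open>T i j\<close> possibly nonzero.\<close>
  define M where "M = max N (Suc ?n)"
  have M: "N \<le> M" "?n < M" by (auto simp: M_def)
  have "\<phi> ?p = \<phi> (\<Sum>i<M. \<Sum>j<M. letter a ^ i * ?V ?p i j * letter b ^ j)"
    by (rule arg_cong[OF N[rule_format, OF M(1)]])
  also have "\<dots> = (\<Sum>i<M. \<Sum>j<M. T i j)"
    by (simp add: sum_hom R.sum_in R.mult_in R.power_in la lb V p T)
  also have "\<dots> = (\<Sum>j<M. \<Sum>i<M. T i j)"
    by (rule sum.swap)
  also have "\<dots> = (\<Sum>j\<le>?n. \<Sum>i<M. T i j)"
    using M by (intro sum.mono_neutral_right) (auto simp: T0 intro!: sum.neutral)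
  also have "\<dots> = (\<Sum>j\<le>?n. \<Sum>i\<le>?n - j. T i j)"
    using M by (intro sum.cong refl sum.mono_neutral_right) (auto intro!: T0)
  \<comment> \<open>The exponent of x_b is replaced by the position \<open>m\<close> at which the
    final run of letters \<open>b\<close> starts.\<close>
  also have "\<dots> = (\<Sum>m\<le>?n. \<Sum>i\<le>m. T i (?n - m))"
    by (rule sum.reindex_bij_witness[of _ "\<lambda>m. ?n - m" "\<lambda>m. ?n - m"]) auto
  also have "\<dots> = (\<Sum>m\<le>?n. \<Sum>i\<le>m. ser_exp a (\<phi> (letter a)) (take i w) *
      \<phi> (Sh (regab S a b (word_poly (drop i (take m w))))) * ser_exp b (\<phi> (letter b)) (drop m w))"
  proof (intro sum.cong refl)
    fix m i assume "m \<in> {..?n}" "i \<in> {..m}"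
    then have mi: "i \<le> m" "m \<le> ?n" by auto
    have "set (drop i (take m w)) \<subseteq> S"
      using w set_drop_subset set_take_subset by (metis subset_trans)
    then have "is_poly S (word_poly (drop i (take m w)))"
      using Pol_word[OF S] by (simp add: Pol_def)
    note reg = regab_eq[OF S aS bS ab this]
    show "T i (?n - m) = ser_exp a (\<phi> (letter a)) (take i w) *
      \<phi> (Sh (regab S a b (word_poly (drop i (take m w))))) * ser_exp b (\<phi> (letter b)) (drop m w)"
      unfolding T_def funpow_word[OF mi] reg
      using mi by (simp add: ser_exp_def V0 zero cf_inverse min_absorb2)
  qed
  also have "\<dots> = ser_mult (ser_mult (ser_exp a (\<phi> (letter a))) (\<lambda>v. \<phi> (Sh (regab S a b (word_poly v)))))
      (ser_exp b (\<phi> (letter b))) w"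
    unfolding ser_mult_def by (intro sum.cong refl) (simp add: sum_distrib_right min_def)
  finally show ?thesis .
qed

end

section \<open>The defining series as a power series\<close>

text \<open>The coefficient of \<open>t ^ n\<close> in the nested sum with largest index m_1 = n,
  without the sign. A pair \<open>(k, g)\<close> stands for exponent k and letter b + g. The general
  field type allows the same recursion on norms to serve as a real majorant.\<close>

fun block_coeff :: "(nat \<times> 'a) list \<Rightarrow> nat \<Rightarrow> 'a::real_normed_field" where
  "block_coeff [] n = (if n = 0 then 1 else 0)"
| "block_coeff ((k, g) # bl) n = (\<Sum>m<n. block_coeff bl m / g ^ (n - m)) / of_nat n ^ k"

definition block_term :: "(nat \<times> 'a) list \<Rightarrow> 'a \<Rightarrow> nat list \<Rightarrow> 'a::real_normed_field" where
  "block_term bl t ms = (\<Prod>i<length bl. (t / snd (bl ! i)) ^ (ms ! i - (ms @ [0]) ! Suc i)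
        / of_nat (ms ! i) ^ fst (bl ! i))"

text \<open>The appended 0 is the convention m_{r+1} = 0; it also gives the empty list the leading
  entry 0, which matches the constant series of the empty word.\<close>

definition dec_lists_from :: "nat \<Rightarrow> nat \<Rightarrow> nat list set" where
  "dec_lists_from r n = {ms \<in> dec_lists r. (ms @ [0]) ! 0 = n}"

lemma dec_lists_from_0: "dec_lists_from 0 n = (if n = 0 then {[]} else {})"
  by (auto simp: dec_lists_from_def dec_lists_def)

lemma dec_lists_from_Suc: "dec_lists_from (Suc r) n = (#) n ` (\<Union>m<n. dec_lists_from r m)"
proof (intro equalityI subsetI)
  fix ms assume "ms \<in> dec_lists_from (Suc r) n"
  then obtain ms' where ms: "ms = n # ms'" "length ms' = r" "sorted_wrt (>) ms'" "\<forall>m\<in>set ms'. m < n \<and> 0 < m" "0 < n"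
    by (cases ms) (auto simp: dec_lists_from_def dec_lists_def)
  then have "(ms' @ [0]) ! 0 < n" by (cases ms') auto
  with ms show "ms \<in> (#) n ` (\<Union>m<n. dec_lists_from r m)"
    by (auto simp: dec_lists_from_def dec_lists_def)
next
  fix ms assume "ms \<in> (#) n ` (\<Union>m<n. dec_lists_from r m)"
  then obtain ms' where ms: "ms = n # ms'" "ms' \<in> dec_lists r" "(ms' @ [0]) ! 0 < n"
    by (auto simp: dec_lists_from_def)
  then have "m < n" if "m \<in> set ms'" for m
    using that by (cases ms') (auto simp: dec_lists_def)
  with ms show "ms \<in> dec_lists_from (Suc r) n"
    by (auto simp: dec_lists_from_def dec_lists_def)
qed

lemma finite_dec_lists_from: "finite (dec_lists_from r n)"
  by (induction r arbitrary: n) (auto simp: dec_lists_from_0 dec_lists_from_Suc)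

lemma block_term_Cons:
  "block_term ((k, g) # bl) t (n # ms) = (t / g) ^ (n - (ms @ [0]) ! 0) / of_nat n ^ k * block_term bl t ms"
  unfolding block_term_def length_Cons prod.lessThan_Suc_shift by simp

text \<open>The exponents m_i - m_{i+1} telescope to m_1, so exactly the finitely many lists with
  leading entry \<open>n\<close> contribute to \<open>t ^ n\<close>.\<close>

lemma sum_block_term:
  "(\<Sum>ms\<in>dec_lists_from (length bl) n. block_term bl t ms) = block_coeff bl n * t ^ n"
proof (induction bl arbitrary: n)
  case Nil
  then show ?case by (simp add: dec_lists_from_0 block_term_def)
next
  case (Cons kg bl)
  obtain k g where kg: "kg = (k, g)" by (cases kg)
  have "(\<Sum>ms\<in>dec_lists_from (length (kg # bl)) n. block_term (kg # bl) t ms)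
      = (\<Sum>ms\<in>(\<Union>m<n. dec_lists_from (length bl) m). block_term (kg # bl) t (n # ms))"
    unfolding length_Cons dec_lists_from_Suc by (subst sum.reindex) auto
  also have "\<dots> = (\<Sum>m<n. \<Sum>ms\<in>dec_lists_from (length bl) m. block_term (kg # bl) t (n # ms))"
    by (rule sum.UNION_disjoint) (auto simp: finite_dec_lists_from, auto simp: dec_lists_from_def)
  also have "\<dots> = (\<Sum>m<n. \<Sum>ms\<in>dec_lists_from (length bl) m. (t / g) ^ (n - m) / of_nat n ^ k * block_term bl t ms)"
    by (intro sum.cong refl) (auto simp: kg block_term_Cons dec_lists_from_def)
  also have "\<dots> = (\<Sum>m<n. (t / g) ^ (n - m) / of_nat n ^ k * (block_coeff bl m * t ^ m))"
    by (simp only: sum_distrib_left[symmetric] Cons.IH)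
  also have "\<dots> = (\<Sum>m<n. block_coeff bl m / g ^ (n - m) / of_nat n ^ k * t ^ n)"
  proof (intro sum.cong refl)
    fix m assume "m \<in> {..<n}"
    then have "t ^ n = t ^ m * t ^ (n - m)" by (simp add: power_add[symmetric])
    then show "(t / g) ^ (n - m) / of_nat n ^ k * (block_coeff bl m * t ^ m) =
        block_coeff bl m / g ^ (n - m) / of_nat n ^ k * t ^ n"
      by (simp add: power_divide)
  qed
  also have "\<dots> = block_coeff (kg # bl) n * t ^ n"
    by (simp add: kg sum_divide_distrib sum_distrib_right)
  finally show ?case .
qed

lemma sum_geometric_tail:
  fixes q :: real
  assumes "0 \<le> q" "q < 1"
  shows "(\<Sum>m<n. q ^ (n - m)) \<le> 1 / (1 - q)"
proof (induction n)
  case (Suc n)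
  have "(\<Sum>m<Suc n. q ^ (Suc n - m)) = q * (\<Sum>m<n. q ^ (n - m)) + q"
    by (simp add: sum_distrib_left Suc_diff_le)
  also have "\<dots> \<le> q * (1 / (1 - q)) + q"
    using Suc assms by (intro add_mono mult_left_mono) auto
  also have "\<dots> \<le> 1 / (1 - q)"
  proof -
    have "1 / (1 - q) - (q * (1 / (1 - q)) + q) = 1 - q" using assms by (simp add: field_simps)
    then show ?thesis using assms by simp
  qed
  finally show ?case .
qed (use assms in simp)

lemma block_coeff_norm_le:
  fixes bl :: "(nat \<times> 'a::real_normed_field) list"
  shows "norm (block_coeff bl n) \<le> block_coeff (map (\<lambda>(k, g). (k, norm g)) bl) n"
proof (induction bl arbitrary: n)
  case (Cons kg bl)
  obtain k g where kg: "kg = (k, g)" by (cases kg)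
  have "norm (\<Sum>m<n. block_coeff bl m / g ^ (n - m)) \<le> (\<Sum>m<n. norm (block_coeff bl m) / norm g ^ (n - m))"
    by (rule order_trans[OF norm_sum]) (simp add: norm_divide norm_power)
  also have "\<dots> \<le> (\<Sum>m<n. block_coeff (map (\<lambda>(k, g). (k, norm g)) bl) m / norm g ^ (n - m))"
    by (intro sum_mono divide_right_mono Cons.IH) simp
  finally show ?case by (simp add: kg norm_divide norm_power divide_right_mono)
qed auto

text \<open>Each block costs one factor 1/(1 - R/\<rho>): after weighting with powers of
  \<open>R\<close>, the sum over \<open>m\<close> is dominated by a geometric series of ratio
  R/\<rho>, and the division by \<open>n ^ k\<close> only decreases it.\<close>

lemma block_coeff_bound:
  fixes bl :: "(nat \<times> real) list"
  assumes "0 < R" "R < \<rho>" and "\<And>k g. (k, g) \<in> set bl \<Longrightarrow> \<rho> \<le> g"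
  shows "0 \<le> block_coeff bl n \<and> block_coeff bl n * R ^ n \<le> (1 / (1 - R / \<rho>)) ^ length bl"
  using assms(3)
proof (induction bl arbitrary: n)
  case (Cons kg bl)
  obtain k g where kg: "kg = (k, g)" by (cases kg)
  have g: "\<rho> \<le> g" using Cons.prems[of k g] kg by simp
  define q where "q = R / \<rho>"
  have q: "0 \<le> q" "q < 1" using assms by (auto simp: q_def)
  define M where "M = (1 / (1 - q)) ^ length bl"
  have IH: "0 \<le> block_coeff bl m" "block_coeff bl m * R ^ m \<le> M" for m
    using Cons.IH[of m] Cons.prems unfolding M_def q_def by auto
  have M: "0 \<le> M" using q by (simp add: M_def)
  let ?s = "\<Sum>m<n. block_coeff bl m / g ^ (n - m)"
  have s: "0 \<le> ?s" using IH g assms by (intro sum_nonneg divide_nonneg_nonneg) auto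
  have "?s * R ^ n = (\<Sum>m<n. (block_coeff bl m * R ^ m) * (R / g) ^ (n - m))"
    unfolding sum_distrib_right
  proof (intro sum.cong refl)
    fix m assume "m \<in> {..<n}"
    then have "R ^ n = R ^ m * R ^ (n - m)" by (simp add: power_add[symmetric])
    then show "block_coeff bl m / g ^ (n - m) * R ^ n = (block_coeff bl m * R ^ m) * (R / g) ^ (n - m)"
      by (simp add: power_divide)
  qed
  also have "\<dots> \<le> (\<Sum>m<n. M * q ^ (n - m))"
    using IH g assms M by (intro sum_mono mult_mono power_mono) (auto simp: q_def intro!: divide_left_mono)
  also have "\<dots> = M * (\<Sum>m<n. q ^ (n - m))" by (simp add: sum_distrib_left)
  also have "\<dots> \<le> M * (1 / (1 - q))"
    by (intro mult_left_mono sum_geometric_tail q M)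
  finally have *: "?s * R ^ n \<le> M * (1 / (1 - q))" .
  have "?s / of_nat n ^ k \<le> ?s"
  proof (cases "n = 0")
    case False
    then have "1 \<le> real n ^ k" by (intro one_le_power) simp
    then show ?thesis using s by (simp add: divide_le_eq mult_left_mono mult_le_cancel_left1)
  qed simp
  then have "?s / of_nat n ^ k * R ^ n \<le> ?s * R ^ n"
    using assms(1) by (intro mult_right_mono) auto
  then have "block_coeff (kg # bl) n * R ^ n \<le> ?s * R ^ n"
    by (simp only: kg block_coeff.simps)
  with * have "block_coeff (kg # bl) n * R ^ n \<le> (1 / (1 - R / \<rho>)) ^ length (kg # bl)"
    by (simp add: M_def q_def mult.commute)
  moreover have "0 \<le> block_coeff (kg # bl) n" using s by (simp add: kg)
  ultimately show ?case by (rule conjI[rotated])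
qed simp

lemma summable_block_coeff_real:
  fixes bl :: "(nat \<times> real) list"
  assumes "\<And>k g. (k, g) \<in> set bl \<Longrightarrow> \<rho> \<le> g" "0 \<le> t" "t < \<rho>"
  shows "summable (\<lambda>n. block_coeff bl n * t ^ n)"
proof -
  \<comment> \<open>Any radius strictly between \<open>t\<close> and \<open>\<rho>\<close> serves:
    the bound at \<open>R\<close> leaves a geometric series of ratio t/R.\<close>
  define R where "R = (t + \<rho>) / 2"
  have R: "0 < R" "R < \<rho>" "t < R" using assms(2,3) by (auto simp: R_def)
  have "0 \<le> block_coeff bl n \<and> block_coeff bl n * R ^ n \<le> (1 / (1 - R / \<rho>)) ^ length bl" for n
    by (rule block_coeff_bound[OF R(1,2)]) (rule assms(1))
  then have b: "0 \<le> block_coeff bl n" "block_coeff bl n * R ^ n \<le> (1 / (1 - R / \<rho>)) ^ length bl" for n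
    by simp_all
  have le: "norm (block_coeff bl n * t ^ n) \<le> (1 / (1 - R / \<rho>)) ^ length bl * (t / R) ^ n" for n
  proof -
    have "norm (block_coeff bl n * t ^ n) = (block_coeff bl n * R ^ n) * (t / R) ^ n"
      using b(1)[of n] R assms(2,3) by (simp add: power_divide)
    also have "\<dots> \<le> (1 / (1 - R / \<rho>)) ^ length bl * (t / R) ^ n"
      using b(2)[of n] R assms(2,3) by (intro mult_right_mono) auto
    finally show ?thesis .
  qed
  have "summable (\<lambda>n. (1 / (1 - R / \<rho>)) ^ length bl * (t / R) ^ n)"
    using R assms(2,3) by (intro summable_mult summable_geometric) auto
  then show ?thesis by (rule summable_comparison_test') (rule le)
qed

lemma summable_norm_block_coeff:
  fixes bl :: "(nat \<times> 'a::{real_normed_field,banach}) list"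
  assumes "\<forall>p\<in>set bl. \<rho> \<le> norm (snd p)" "norm t < \<rho>"
  shows "summable (\<lambda>n. norm (block_coeff bl n * t ^ n))"
proof (rule summable_comparison_test')
  show "summable (\<lambda>n. block_coeff (map (\<lambda>(k, g). (k, norm g)) bl) n * norm t ^ n)"
    using assms by (intro summable_block_coeff_real[of _ \<rho>]) auto
  show "norm (norm (block_coeff bl n * t ^ n)) \<le> block_coeff (map (\<lambda>(k, g). (k, norm g)) bl) n * norm t ^ n" for n
    by (simp add: norm_mult norm_power block_coeff_norm_le mult_right_mono)
qed

text \<open>Grouping by the leading entry. The real majorant gives absolute summability, which turns
  the unordered sum over lists into an iterated one with finite inner sums.\<close>

lemma infsum_block_term:
  fixes bl :: "(nat \<times> 'a::{real_normed_field,banach}) list"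
  assumes "\<forall>p\<in>set bl. \<rho> \<le> norm (snd p)" "norm t < \<rho>"
  shows "infsum (block_term bl t) (dec_lists (length bl)) = (\<Sum>n. block_coeff bl n * t ^ n)"
proof -
  let ?D = "dec_lists_from (length bl)"
  have bij: "bij_betw snd (Sigma UNIV ?D) (dec_lists (length bl))"
    by (rule bij_betw_byWitness[where f' = "\<lambda>ms. ((ms @ [0]) ! 0, ms)"]) (auto simp: dec_lists_from_def)
  let ?nbl = "map (\<lambda>(k, g). (k, norm g)) bl"
  have "norm (block_term bl t ms) = block_term ?nbl (norm t) ms" for ms
    unfolding block_term_def prod_norm[symmetric] length_map
    by (intro prod.cong refl) (auto simp: norm_divide norm_power split_beta)
  then have "(\<Sum>ms\<in>?D n. norm (block_term bl t ms)) = block_coeff ?nbl n * norm t ^ n" for n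
    using sum_block_term[where bl = ?nbl and t = "norm t"] by simp
  moreover have "(\<lambda>n. norm (block_coeff ?nbl n * norm t ^ n)) summable_on UNIV"
  proof -
    have *: "summable (\<lambda>n. block_coeff ?nbl n * norm t ^ n)"
      using assms by (intro summable_block_coeff_real[of _ \<rho>]) auto
    have "norm (block_coeff ?nbl n * norm t ^ n) = block_coeff ?nbl n * norm t ^ n" for n
      using order_trans[OF norm_ge_zero block_coeff_norm_le[of bl n]] by simp
    with * show ?thesis using norm_summable_imp_summable_on[of "\<lambda>n. norm (block_coeff ?nbl n * norm t ^ n)"] by simp
  qed
  ultimately have "(\<lambda>p. norm (block_term bl t (snd p))) summable_on Sigma UNIV ?D"
    unfolding Infinite_Sum.abs_summable_on_Sigma_iff by (simp add: finite_dec_lists_from)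
  then have summ: "(\<lambda>p. block_term bl t (snd p)) summable_on Sigma UNIV ?D"
    by (rule Infinite_Sum.abs_summable_summable)
  have "infsum (block_term bl t) (dec_lists (length bl)) = infsum (\<lambda>p. block_term bl t (snd p)) (Sigma UNIV ?D)"
    by (rule infsum_reindex_bij_betw[OF bij, symmetric])
  also have "\<dots> = (\<Sum>\<^sub>\<infinity>n. \<Sum>\<^sub>\<infinity>ms\<in>?D n. block_term bl t ms)"
    using infsum_Sigma_banach[OF summ] by simp
  also have "\<dots> = (\<Sum>\<^sub>\<infinity>n. block_coeff bl n * t ^ n)"
    by (simp add: finite_dec_lists_from sum_block_term)
  also have "\<dots> = (\<Sum>n. block_coeff bl n * t ^ n)"
    using summable_norm_block_coeff[OF assms] summable_norm_cancel[OF summable_norm_block_coeff[OF assms]]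
    by (intro infsumI norm_summable_imp_has_sum) auto
  finally show ?thesis .
qed

section \<open>Differential equations of the power series\<close>

definition block_series :: "(nat \<times> complex) list \<Rightarrow> complex \<Rightarrow> complex" where
  "block_series bl t = (\<Sum>n. block_coeff bl n * t ^ n)"

lemma block_coeff_Cons_0 [simp]: "block_coeff (kg # bl) 0 = 0"
  by (cases kg) simp

lemma block_series_at_0: "block_series (kg # bl) 0 = 0"
proof -
  have "(\<lambda>n. block_coeff (kg # bl) n * 0 ^ n) = (\<lambda>_. 0)"
  proof
    show "block_coeff (kg # bl) n * 0 ^ n = 0" for n by (cases n) auto
  qed
  then show ?thesis by (simp add: block_series_def)
qed

lemma summable_block_coeff:
  fixes bl :: "(nat \<times> complex) list"
  assumes "\<forall>p\<in>set bl. \<rho> \<le> norm (snd p)" "norm t < \<rho>"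
  shows "summable (\<lambda>n. block_coeff bl n * t ^ n)"
  by (rule summable_norm_cancel[OF summable_norm_block_coeff[OF assms]])

lemma block_series_deriv:
  assumes "\<forall>p\<in>set bl. \<rho> \<le> norm (snd p)" "norm t < \<rho>"
  shows "(block_series bl has_field_derivative (\<Sum>n. diffs (block_coeff bl) n * t ^ n)) (at t)"
  unfolding block_series_def[abs_def]
  by (rule termdiffs_strong'[OF summable_block_coeff[OF assms(1)] assms(2)])

lemma summable_diffs_block_coeff:
  fixes bl :: "(nat \<times> complex) list"
  assumes "\<forall>p\<in>set bl. \<rho> \<le> norm (snd p)" "norm t < \<rho>"
  shows "summable (\<lambda>n. diffs (block_coeff bl) n * t ^ n)"
  by (rule termdiff_converges[OF assms(2) summable_block_coeff[OF assms(1)]])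

text \<open>The operator t d/dt multiplies the coefficient of \<open>t ^ n\<close> by
  \<open>n\<close>, which lowers the first exponent by one.\<close>

lemma block_series_deriv_step:
  assumes \<rho>: "\<forall>p\<in>set ((k, g) # bl). \<rho> \<le> norm (snd p)" and t: "norm t < \<rho>"
  shows "t * (\<Sum>n. diffs (block_coeff ((Suc k, g) # bl)) n * t ^ n) = block_series ((k, g) # bl) t"
proof -
  have "diffs (block_coeff ((Suc k, g) # bl)) n = block_coeff ((k, g) # bl) (Suc n)" for n
    by (simp add: diffs_def del: of_nat_Suc)
  then have "t * (\<Sum>n. diffs (block_coeff ((Suc k, g) # bl)) n * t ^ n)
      = t * (\<Sum>n. block_coeff ((k, g) # bl) (Suc n) * t ^ n)"
    by (simp only:)
  also have "\<dots> = (\<Sum>n. block_coeff ((k, g) # bl) n * t ^ n)"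
    using powser_split_head(1)[OF summable_block_coeff[OF \<rho> t]] by (simp add: mult.commute)
  finally show ?thesis by (simp add: block_series_def)
qed

text \<open>At exponent 1 differentiation cancels the denominator and leaves the convolution of the
  remaining series with that of 1/(g - t). It is verified through the recurrence
  \<open>eSuc\<close>, the coefficient form of multiplication by g - t.\<close>

lemma block_series_deriv_last:
  assumes \<rho>: "\<forall>p\<in>set ((Suc 0, g) # bl). \<rho> \<le> norm (snd p)" and t: "norm t < \<rho>"
  shows "(g - t) * (\<Sum>n. diffs (block_coeff ((Suc 0, g) # bl)) n * t ^ n) = block_series bl t"
proof -
  define e where "e = diffs (block_coeff ((Suc 0, g) # bl))"
  have "\<rho> \<le> norm g" using \<rho> by simp
  then have "0 < norm g" using t norm_ge_zero[of t] by linarith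
  then have g: "g \<noteq> 0" by auto
  have e: "e n = (\<Sum>m\<le>n. block_coeff bl m / g ^ (Suc n - m))" for n
    by (simp add: e_def diffs_def lessThan_Suc_atMost del: of_nat_Suc)
  have e0: "g * e 0 = block_coeff bl 0" using g by (simp add: e)
  have eSuc: "g * e (Suc n) - e n = block_coeff bl (Suc n)" for n
  proof -
    have "g * e (Suc n) = (\<Sum>m\<le>n. g * (block_coeff bl m / g ^ (Suc (Suc n) - m))) + block_coeff bl (Suc n)"
      using g by (simp add: e algebra_simps sum_distrib_left)
    also have "(\<Sum>m\<le>n. g * (block_coeff bl m / g ^ (Suc (Suc n) - m))) = e n"
      unfolding e using g by (intro sum.cong refl) (simp add: Suc_diff_le)
    finally show ?thesis by simp
  qed
  have s: "summable (\<lambda>n. e n * t ^ n)"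
    unfolding e_def by (rule summable_diffs_block_coeff[OF \<rho> t])
  have "(\<lambda>n. block_coeff bl n * t ^ n) = (\<lambda>n. g * (e n * t ^ n) - (if n = 0 then 0 else t * (e (n - 1) * t ^ (n - 1))))"
  proof
    fix n
    show "block_coeff bl n * t ^ n = g * (e n * t ^ n) - (if n = 0 then 0 else t * (e (n - 1) * t ^ (n - 1)))"
    proof (cases n)
      case (Suc m)
      then show ?thesis using eSuc[of m] by (simp add: algebra_simps flip: eSuc)
    qed (simp add: e0[symmetric])
  qed
  moreover have "(\<lambda>n. if n = 0 then 0 else t * (e (n - 1) * t ^ (n - 1))) sums (t * (\<Sum>n. e n * t ^ n))"
    using sums_Suc_iff[of "\<lambda>n. if n = 0 then 0 else t * (e (n - 1) * t ^ (n - 1))" "t * (\<Sum>n. e n * t ^ n)"]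
      sums_mult[OF summable_sums[OF s], of t] by simp
  ultimately have "(\<lambda>n. block_coeff bl n * t ^ n) sums (g * (\<Sum>n. e n * t ^ n) - t * (\<Sum>n. e n * t ^ n))"
    using sums_diff[OF sums_mult[OF summable_sums[OF s], of g]] by simp
  then show ?thesis by (simp add: block_series_def sums_iff e_def algebra_simps)
qed

definition diff_blocks :: "complex \<Rightarrow> complex list \<Rightarrow> (nat \<times> complex) list" where
  "diff_blocks b w = map (\<lambda>(k, c). (k, c - b)) (blocks b 0 w)"

lemma blocks_letters: "(k, c) \<in> set (blocks b n w) \<Longrightarrow> c \<in> set w \<and> c \<noteq> b"
  by (induction b n w rule: blocks.induct) (auto split: if_splits)

text \<open>The witnesses do not depend on the accumulator \<open>n\<close>; hence a further leading
  x_b only raises the first exponent by one.\<close>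

lemma blocks_shift:
  "w \<noteq> [] \<Longrightarrow> last w \<noteq> b \<Longrightarrow> \<exists>k c bl. \<forall>n. blocks b n w = (Suc (n + k), c) # bl"
proof (induction w)
  case (Cons x w)
  show ?case
  proof (cases "x = b")
    case True
    with Cons obtain k c bl where "\<forall>n. blocks b n w = (Suc (n + k), c) # bl" by fastforce
    with True have "\<forall>n. blocks b n (x # w) = (Suc (n + Suc k), c) # bl" by simp
    then show ?thesis by blast
  next
    case False
    then have "\<forall>n. blocks b n (x # w) = (Suc (n + 0), x) # blocks b 0 w" by simp
    then show ?thesis by blast
  qed
qed simp

context
  fixes b :: complex and \<rho> :: real and S :: "complex set"
  assumes \<rho>: "\<forall>c\<in>S. c \<noteq> b \<longrightarrow> \<rho> \<le> cmod (c - b)"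
begin

lemma diff_blocks_norm:
  "set w \<subseteq> S \<Longrightarrow> \<forall>p\<in>set (diff_blocks b w). \<rho> \<le> norm (snd p)"
  unfolding diff_blocks_def using \<rho> blocks_letters by fastforce

lemma LiB_ser_eq:
  assumes w: "set w \<subseteq> S" and z: "cmod (z - b) < \<rho>"
  shows "LiB_ser b w z = (-1) ^ length (diff_blocks b w) * block_series (diff_blocks b w) (z - b)"
proof -
  have len: "length (blocks b 0 w) = length (diff_blocks b w)" by (simp add: diff_blocks_def)
  have "LiB_ser b w z = (-1) ^ length (diff_blocks b w) *
      infsum (block_term (diff_blocks b w) (z - b)) (dec_lists (length (diff_blocks b w)))"
    unfolding LiB_ser_def Let_def len block_term_def[abs_def]
    by (intro arg_cong[where f = "\<lambda>x. _ * x"] infsum_cong prod.cong refl)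
      (auto simp: diff_blocks_def split_beta)
  also have "infsum (block_term (diff_blocks b w) (z - b)) (dec_lists (length (diff_blocks b w)))
      = block_series (diff_blocks b w) (z - b)"
    unfolding block_series_def by (rule infsum_block_term[OF diff_blocks_norm[OF w] z])
  finally show ?thesis .
qed

lemma LiB_ser_Nil [simp]: "LiB_ser b [] z = 1"
proof -
  have "dec_lists 0 = {[]}" by (auto simp: dec_lists_def)
  then show ?thesis by (simp add: LiB_ser_def)
qed

lemma LiB_ser_center:
  assumes w: "set w \<subseteq> S" "w \<noteq> []" "last w \<noteq> b" and "0 < \<rho>"
  shows "LiB_ser b w b = 0"
proof -
  obtain k c bl where "blocks b 0 w = (k, c) # bl" using blocks_shift[OF w(2,3)] by blast
  then show ?thesis
    using LiB_ser_eq[OF w(1), of b] assms(4) by (simp add: diff_blocks_def block_series_at_0)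
qed

text \<open>Includes the centre \<open>z = b\<close>, which holomorphy on the disc needs and which
  the equation in \<open>LiB_ser_deriv\<close> leaves out.\<close>

lemma LiB_ser_deriv_ex:
  assumes w: "set w \<subseteq> S" and z: "cmod (z - b) < \<rho>"
  shows "(LiB_ser b w has_field_derivative
    (-1) ^ length (diff_blocks b w) * (\<Sum>n. diffs (block_coeff (diff_blocks b w)) n * (z - b) ^ n)) (at z)"
proof (rule has_field_derivative_transform_within_open)
  show "((\<lambda>z. (-1) ^ length (diff_blocks b w) * block_series (diff_blocks b w) (z - b)) has_field_derivative
    (-1) ^ length (diff_blocks b w) * (\<Sum>n. diffs (block_coeff (diff_blocks b w)) n * (z - b) ^ n)) (at z)"
  proof -
    have "((\<lambda>z. z - b) has_field_derivative 1) (at z)" by (auto intro!: derivative_eq_intros)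
    from DERIV_chain'[OF this block_series_deriv[OF diff_blocks_norm[OF w] z]]
    show ?thesis by (intro DERIV_cmult) simp
  qed
  show "open (ball b \<rho>)" "z \<in> ball b \<rho>" using z by (auto simp: dist_norm norm_minus_commute)
  show "(-1) ^ length (diff_blocks b w) * block_series (diff_blocks b w) (z - b) = LiB_ser b w z"
    if "z \<in> ball b \<rho>" for z
    using LiB_ser_eq[OF w] that by (simp add: dist_norm norm_minus_commute)
qed

lemma LiB_ser_holomorphic: "set w \<subseteq> S \<Longrightarrow> LiB_ser b w holomorphic_on ball b \<rho>"
  unfolding holomorphic_on_open[OF open_ball]
  by (intro ballI exI, rule LiB_ser_deriv_ex) (auto simp: dist_norm norm_minus_commute)

text \<open>A leading x_b raises the first exponent, any other letter opens a block of exponent 1.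
  In the second case the new sign from (-1)^r turns 1/(c - z) into 1/(z - c).\<close>

lemma LiB_ser_deriv:
  assumes w: "set (c # w) \<subseteq> S" "last (c # w) \<noteq> b" and z: "cmod (z - b) < \<rho>" "z \<noteq> b"
  shows "(LiB_ser b (c # w) has_field_derivative LiB_ser b w z / (z - c)) (at z)"
proof -
  let ?D = "\<Sum>n. diffs (block_coeff (diff_blocks b (c # w))) n * (z - b) ^ n"
  have w': "set w \<subseteq> S" and zc: "z \<noteq> c" using w z \<rho> by auto
  have "(-1) ^ length (diff_blocks b (c # w)) * ?D = LiB_ser b w z / (z - c)"
  proof (cases "c = b")
    case True
    with w(2) have "w \<noteq> []" "last w \<noteq> b" by (auto split: if_splits)
    then obtain k d bl where *: "\<And>n. blocks b n w = (Suc (n + k), d) # bl"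
      using blocks_shift by blast
    let ?bl = "map (\<lambda>(k, c). (k, c - b)) bl"
    have 1: "diff_blocks b (c # w) = (Suc (Suc k), d - b) # ?bl" and 2: "diff_blocks b w = (Suc k, d - b) # ?bl"
      by (simp_all add: diff_blocks_def * True)
    have "(z - b) * ?D = block_series (diff_blocks b w) (z - b)"
      unfolding 1 2 using diff_blocks_norm[OF w', unfolded 2] z(1)
      by (intro block_series_deriv_step) auto
    then have "?D = block_series (diff_blocks b w) (z - b) / (z - c)"
      using z(2) by (simp add: True eq_divide_eq mult.commute)
    moreover have "length (diff_blocks b (c # w)) = length (diff_blocks b w)" by (simp add: 1 2)
    ultimately show ?thesis by (simp add: LiB_ser_eq[OF w' z(1)])
  next
    case False
    then have 1: "diff_blocks b (c # w) = (Suc 0, c - b) # diff_blocks b w" by (simp add: diff_blocks_def)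
    have "(c - b - (z - b)) * ?D = block_series (diff_blocks b w) (z - b)"
      unfolding 1 using diff_blocks_norm[OF w(1), unfolded 1] z(1)
      by (intro block_series_deriv_last) auto
    then have "?D * (z - c) = - block_series (diff_blocks b w) (z - b)"
      by (simp add: algebra_simps eq_neg_iff_add_eq_0)
    then have "?D = - block_series (diff_blocks b w) (z - b) / (z - c)"
      using zc by (simp only: nonzero_eq_divide_eq right_minus_eq not_False_eq_True)
    moreover have "length (diff_blocks b (c # w)) = Suc (length (diff_blocks b w))" by (simp add: 1)
    ultimately show ?thesis by (simp add: LiB_ser_eq[OF w' z(1)])
  qed
  then show ?thesis using LiB_ser_deriv_ex[OF w(1) z(1)] by simp
qed

end

section \<open>The regularised equation near the singular point\<close>

lemma ser_mult_Nil [simp]: "ser_mult F G [] = F [] * G []"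
  by (simp add: ser_mult_def)

lemma ser_mult_Cons:
  "ser_mult F G (c # w) = F [] * G (c # w) + ser_mult (\<lambda>v. F (c # v)) G w"
  unfolding ser_mult_def length_Cons sum.atMost_Suc_shift by simp

lemma ser_mult_add_left: "ser_mult (\<lambda>w. F w + F' w) G w = ser_mult F G w + ser_mult F' G w"
  by (simp add: ser_mult_def algebra_simps sum.distrib)

lemma ser_mult_diff_left: "ser_mult (\<lambda>w. F w - F' w) G w = ser_mult F G w - ser_mult F' G w"
  by (simp add: ser_mult_def algebra_simps sum_subtractf)

lemma ser_mult_divide_left: "ser_mult (\<lambda>w. F w / k) G w = ser_mult F G w / k"
  by (simp add: ser_mult_def sum_divide_distrib)

lemma ser_mult_divide_right: "ser_mult F (\<lambda>w. G w / k) w = ser_mult F G w / k"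
  by (simp add: ser_mult_def sum_divide_distrib)

lemma ser_mult_zero_left: "ser_mult (\<lambda>_. 0) G w = 0"
  by (simp add: ser_mult_def)

lemma ser_mult_const_left: "ser_mult (\<lambda>w. if w = [] then k else 0) G w = k * G w"
  by (cases w) (simp_all add: ser_mult_Cons ser_mult_zero_left)

lemma ser_mult_scale_left: "ser_mult (\<lambda>w. k * F w) G w = k * ser_mult F G w"
  by (simp add: ser_mult_def sum_distrib_left mult.assoc)

lemma ser_mult_assoc: "ser_mult (ser_mult F G) H w = ser_mult F (ser_mult G H) w"
proof (induction w arbitrary: F)
  case (Cons c w)
  have "ser_mult (ser_mult F G) H (c # w) =
      F [] * G [] * H (c # w) + ser_mult (\<lambda>v. F [] * G (c # v) + ser_mult (\<lambda>u. F (c # u)) G v) H w"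
    by (simp add: ser_mult_Cons)
  also have "\<dots> = F [] * ser_mult G H (c # w) + ser_mult (ser_mult (\<lambda>u. F (c # u)) G) H w"
    by (simp add: ser_mult_Cons ser_mult_add_left ser_mult_scale_left algebra_simps)
  also have "\<dots> = ser_mult F (ser_mult G H) (c # w)"
    by (simp add: ser_mult_Cons Cons.IH)
  finally show ?case .
qed simp

text \<open>Both sides are the product F X_b G: X_b is attached to F from the right on one side, and
  to G from the left on the other.\<close>

lemma ser_mult_letter_shift:
  "ser_mult (\<lambda>w. if w \<noteq> [] \<and> last w = b then F (butlast w) else 0) G w =
   ser_mult F (\<lambda>w. if w \<noteq> [] \<and> hd w = b then G (tl w) else 0) w"
proof (induction w arbitrary: F)
  case (Cons c w)
  have split: "(if c # v \<noteq> [] \<and> last (c # v) = b then F (butlast (c # v)) else 0) =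
      (if v = [] then (if c = b then F [] else 0) else 0) +
      (if v \<noteq> [] \<and> last v = b then F (c # butlast v) else 0)" for v
    by auto
  show ?case
    unfolding ser_mult_Cons[of _ _ c w] split ser_mult_add_left ser_mult_const_left
      Cons.IH[of "\<lambda>v. F (c # v)"] by simp
qed simp

lemma ser_exp_Nil [simp]: "ser_exp c l [] = 1"
  by (simp add: ser_exp_def)

lemma ser_exp_inverse: "ser_mult (ser_exp c l) (ser_exp c (- l)) w = (if w = [] then 1 else 0)"
proof (cases "\<forall>x\<in>set w. x = c")
  case True
  let ?n = "length w"
  have "ser_mult (ser_exp c l) (ser_exp c (- l)) w = (\<Sum>i\<le>?n. l ^ i / fact i * ((- l) ^ (?n - i) / fact (?n - i)))"
    unfolding ser_mult_def
    by (intro sum.cong refl) (use True in \<open>auto simp: ser_exp_def dest!: in_set_takeD in_set_dropD\<close>)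
  also have "\<dots> = (\<Sum>i\<le>?n. of_nat (?n choose i) * l ^ i * (- l) ^ (?n - i)) / fact ?n"
    unfolding sum_divide_distrib by (intro sum.cong refl) (simp add: binomial_fact)
  also have "\<dots> = (l + - l) ^ ?n / fact ?n"
    unfolding binomial_ring ..
  also have "\<dots> = (if w = [] then 1 else 0)" by (simp add: power_0_left)
  finally show ?thesis .
next
  case False
  have "ser_exp c l (take i w) * ser_exp c (- l) (drop i w) = 0" for i
  proof -
    have "\<not> ((\<forall>x\<in>set (take i w). x = c) \<and> (\<forall>x\<in>set (drop i w). x = c))"
      using False by (metis Un_iff append_take_drop_id set_append)
    then show ?thesis by (auto simp: ser_exp_def)
  qed
  then have "ser_mult (ser_exp c l) (ser_exp c (- l)) w = 0"
    unfolding ser_mult_def by (intro sum.neutral ballI)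
  moreover have "w \<noteq> []" using False by auto
  ultimately show ?thesis by simp
qed

text \<open>The derivative of exp(l X_b) is l' X_b exp(l X_b), written with X_b on the left so that
  \<open>ser_mult_letter_shift\<close> applies.\<close>

lemma ser_exp_deriv:
  assumes "(l has_field_derivative d) (at z)"
  shows "((\<lambda>z. ser_exp b (l z) w) has_field_derivative
    (if w \<noteq> [] \<and> hd w = b then ser_exp b (l z) (tl w) else 0) * d) (at z)"
proof (cases "\<forall>x\<in>set w. x = b")
  case True
  show ?thesis
  proof (cases w)
    case (Cons c v)
    have "((\<lambda>z. l z ^ Suc (length v) / fact (Suc (length v))) has_field_derivative
        l z ^ length v / fact (length v) * d) (at z)"
      by (rule derivative_eq_intros assms refl | simp add: divide_simps del: of_nat_Suc)+
    moreover have "(\<lambda>z. ser_exp b (l z) w) = (\<lambda>z. l z ^ Suc (length v) / fact (Suc (length v)))"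
      using True Cons by (simp add: ser_exp_def)
    ultimately show ?thesis using True Cons by (simp add: ser_exp_def)
  qed simp
next
  case False
  then have "(if w \<noteq> [] \<and> hd w = b then ser_exp b (l z) (tl w) else 0) = 0"
    by (cases w) (auto simp: ser_exp_def)
  moreover have "(\<lambda>z. ser_exp b (l z) w) = (\<lambda>_. 0)"
    unfolding ser_exp_def if_not_P[OF False] ..
  ultimately show ?thesis by simp
qed

text \<open>The coefficients of \<open>K = H ((z-b)/(a-b))\<^bsup>-X_b\<^esup>\<close>, which satisfies
  \<open>dK/dz = (\<Sum>c. X_c/(z-c)) K - K X_b/(z-b)\<close>.  For a word of length at least two both terms are regular at
  \<open>b\<close> since shorter nonempty coefficients vanish there; for the word \<open>b\<close> the two poles cancel.\<close>

function reg_sol :: "complex \<Rightarrow> real \<Rightarrow> complex list \<Rightarrow> complex \<Rightarrow> complex" where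
  "reg_sol b \<rho> [] = (\<lambda>_. 1)"
| "reg_sol b \<rho> (c # w) = (SOME f. f holomorphic_on ball b \<rho> \<and> f b = 0 \<and>
     (\<forall>z\<in>ball b \<rho> - {b}. (f has_field_derivative
        (reg_sol b \<rho> w z / (z - c)
         - (if last (c # w) = b then reg_sol b \<rho> (butlast (c # w)) z else 0) / (z - b))) (at z)))"
  by pat_completeness auto
termination by (relation "Wellfounded.measure (\<lambda>(b, \<rho>, w). length w)") auto

declare reg_sol.simps(2) [simp del]

text \<open>For \<open>c = b\<close> the singularity is removable, otherwise \<open>c\<close> lies
  outside the open disc. The value of \<open>g\<close> at \<open>b\<close> is left open, since the
  equation for \<open>reg_sol\<close> is imposed on the punctured disc.\<close>

lemma holomorphic_quotient_ex:
  assumes "f holomorphic_on ball b \<rho>" and "if c = b then f b = 0 else \<rho> \<le> cmod (c - b)"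
  shows "\<exists>g. g holomorphic_on ball b \<rho> \<and> (\<forall>z\<in>ball b \<rho> - {b}. g z = f z / (z - c))"
proof (cases "c = b")
  case True
  have "(\<lambda>z. if z = b then deriv f b else f z / (z - b) - f b / (z - b)) holomorphic_on ball b \<rho>"
    by (rule pole_theorem_open[OF assms(1) open_ball]) auto
  then show ?thesis using True assms(2)
    by (intro exI[of _ "\<lambda>z. if z = b then deriv f b else f z / (z - b) - f b / (z - b)"]) auto
next
  case False
  then have "\<forall>z\<in>ball b \<rho>. z - c \<noteq> 0" using assms(2) by (auto simp: dist_norm norm_minus_commute)
  then have "(\<lambda>z. f z / (z - c)) holomorphic_on ball b \<rho>"
    by (intro holomorphic_intros assms(1)) auto
  then show ?thesis by blast
qed

lemma ball_primitive_ex: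
  assumes "f holomorphic_on ball b \<rho>" "0 < \<rho>"
  shows "\<exists>g. g holomorphic_on ball b \<rho> \<and> g b = 0 \<and> (\<forall>z\<in>ball b \<rho>. (g has_field_derivative f z) (at z))"
proof -
  obtain h where h: "\<And>z. z \<in> ball b \<rho> \<Longrightarrow> (h has_field_derivative f z) (at z within ball b \<rho>)"
    using holomorphic_convex_primitive'[OF convex_ball open_ball assms(1)] by blast
  have *: "((\<lambda>z. h z - h b) has_field_derivative f z) (at z)" if "z \<in> ball b \<rho>" for z
    using h[OF that] at_within_open[OF that open_ball] by (auto intro!: derivative_eq_intros)
  then have "(\<lambda>z. h z - h b) holomorphic_on ball b \<rho>"
    unfolding holomorphic_on_open[OF open_ball] by blast
  with * show ?thesis by (intro exI[of _ "\<lambda>z. h z - h b"]) auto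
qed

text \<open>Continuity makes up for the missing derivative at \<open>b\<close>; this is how
  solutions on the punctured disc with the same value at \<open>b\<close> are compared.\<close>

lemma zero_derivative_punctured_ball:
  fixes f :: "complex \<Rightarrow> complex"
  assumes "continuous_on (ball b \<rho>) f" "f b = 0" "0 < \<rho>"
    and "\<And>z. z \<in> ball b \<rho> - {b} \<Longrightarrow> (f has_field_derivative 0) (at z)" and "z \<in> ball b \<rho>"
  shows "f z = 0"
  using DERIV_zero_connected_constant[of "ball b \<rho>" "{b}" f] assms
  by (metis centre_in_ball connected_ball finite.emptyI finite.insertI open_ball)

context
  fixes b :: complex and \<rho> :: real and S :: "complex set"
  assumes \<rho>: "\<forall>c\<in>S. c \<noteq> b \<longrightarrow> \<rho> \<le> cmod (c - b)" and \<rho>0: "0 < \<rho>"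
begin

text \<open>Induction on length, because the right-hand side involves both the tail and
  \<open>butlast w\<close>. Once it extends holomorphically to the disc, a primitive vanishing at
  \<open>b\<close> shows that the choice in \<open>reg_sol\<close> is satisfiable.\<close>

lemma reg_sol_props:
  "set w \<subseteq> S \<Longrightarrow> reg_sol b \<rho> w holomorphic_on ball b \<rho> \<and> reg_sol b \<rho> w b = (if w = [] then 1 else 0) \<and>
   (\<forall>z\<in>ball b \<rho> - {b}. (reg_sol b \<rho> w has_field_derivative
      (case w of [] \<Rightarrow> 0 | c # w' \<Rightarrow> reg_sol b \<rho> w' z / (z - c))
      - (if w \<noteq> [] \<and> last w = b then reg_sol b \<rho> (butlast w) z else 0) / (z - b)) (at z))"
proof (induction "length w" arbitrary: w rule: less_induct)
  case less
  show ?case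
  proof (cases w)
    case (Cons c w')
    let ?R = "\<lambda>z. reg_sol b \<rho> w' z / (z - c) - (if last w = b then reg_sol b \<rho> (butlast w) z else 0) / (z - b)"
    have w': "set w' \<subseteq> S" "c \<in> S" and bw: "set (butlast w) \<subseteq> S"
      using less.prems Cons by (auto dest: in_set_butlastD)
    note IH1 = less.hyps[of w', unfolded Cons, simplified, OF w'(1)]
    have IH2: "reg_sol b \<rho> (butlast w) holomorphic_on ball b \<rho> \<and>
        reg_sol b \<rho> (butlast w) b = (if butlast w = [] then 1 else 0)"
      using less.hyps[of "butlast w", OF _ bw] Cons by simp
    have "\<exists>g. g holomorphic_on ball b \<rho> \<and> (\<forall>z\<in>ball b \<rho> - {b}. g z = ?R z)"
    proof (cases "w' = []")
      case True
      show ?thesis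
      proof (cases "c = b")
        case True
        with \<open>w' = []\<close> Cons show ?thesis by (intro exI[of _ "\<lambda>_. 0"]) auto
      next
        case False
        with \<open>w' = []\<close> Cons show ?thesis
          using holomorphic_quotient_ex[of "\<lambda>_. 1" b \<rho> c] \<rho> w'(2) by simp
      qed
    next
      case False
      then have bw0: "butlast w \<noteq> []" using Cons by simp
      have "if c = b then reg_sol b \<rho> w' b = 0 else \<rho> \<le> cmod (c - b)"
        using IH1 \<rho> w'(2) False by simp
      then obtain g1 where g1: "g1 holomorphic_on ball b \<rho>" "\<forall>z\<in>ball b \<rho> - {b}. g1 z = reg_sol b \<rho> w' z / (z - c)"
        using holomorphic_quotient_ex[of "reg_sol b \<rho> w'" b \<rho> c] IH1 by blast
      obtain g2 where g2: "g2 holomorphic_on ball b \<rho>" "\<forall>z\<in>ball b \<rho> - {b}. g2 z = reg_sol b \<rho> (butlast w) z / (z - b)"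
        using holomorphic_quotient_ex[of "reg_sol b \<rho> (butlast w)" b \<rho> b] IH2 bw0 by auto
      have "(\<lambda>z. g1 z - (if last w = b then 1 else 0) * g2 z) holomorphic_on ball b \<rho>"
        by (intro holomorphic_intros g1 g2)
      then show ?thesis using g1 g2 by (intro exI[of _ "\<lambda>z. g1 z - (if last w = b then 1 else 0) * g2 z"]) auto
    qed
    then obtain g where g: "g holomorphic_on ball b \<rho>" "\<And>z. z \<in> ball b \<rho> - {b} \<Longrightarrow> g z = ?R z" by blast
    obtain h where "h holomorphic_on ball b \<rho>" "h b = 0" "\<And>z. z \<in> ball b \<rho> \<Longrightarrow> (h has_field_derivative g z) (at z)"
      using ball_primitive_ex[OF g(1) \<rho>0] by blast
    then have "\<exists>f. f holomorphic_on ball b \<rho> \<and> f b = 0 \<and>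
        (\<forall>z\<in>ball b \<rho> - {b}. (f has_field_derivative ?R z) (at z))"
      using g(2) by (metis Diff_iff)
    from someI_ex[OF this] show ?thesis
      unfolding Cons by (simp add: reg_sol.simps(2))
  qed simp
qed

lemmas reg_sol_holomorphic = reg_sol_props[THEN conjunct1]
  and reg_sol_center = reg_sol_props[THEN conjunct2, THEN conjunct1]
  and reg_sol_deriv = reg_sol_props[THEN conjunct2, THEN conjunct2, THEN bspec]

text \<open>On powers of one letter, left and right multiplication by X_b coincide, so the two terms
  with a pole at \<open>b\<close> cancel and the coefficient is constant.\<close>

lemma reg_sol_replicate:
  assumes "b \<in> S" "z \<in> ball b \<rho>"
  shows "reg_sol b \<rho> (replicate (Suc n) b) z = 0"
proof (rule zero_derivative_punctured_ball[OF _ _ \<rho>0 _ assms(2)])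
  let ?w = "replicate (Suc n) b"
  have S: "set ?w \<subseteq> S" using assms by auto
  show "continuous_on (ball b \<rho>) (reg_sol b \<rho> ?w)" "reg_sol b \<rho> ?w b = 0"
    using reg_sol_holomorphic[OF S] reg_sol_center[OF S] by (auto intro: holomorphic_on_imp_continuous_on)
  have "?w = replicate n b @ [b]" by (simp add: replicate_append_same)
  then have "last ?w = b" "butlast ?w = replicate n b" by (simp_all only: last_snoc butlast_snoc)
  then show "(reg_sol b \<rho> ?w has_field_derivative 0) (at z)" if "z \<in> ball b \<rho> - {b}" for z
    using reg_sol_deriv[OF S that] by simp
qed

text \<open>Unless the word ends in \<open>b\<close>, the term K X_b/(z-b) is absent; both functions
  then satisfy the same first-letter equation and vanish at \<open>b\<close>. This class of words is
  closed under deletion of the first letter.\<close>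

lemma LiB_ser_eq_reg_sol:
  "set w \<subseteq> S \<Longrightarrow> w = [] \<or> last w \<noteq> b \<Longrightarrow> z \<in> ball b \<rho> \<Longrightarrow> LiB_ser b w z = reg_sol b \<rho> w z"
proof (induction w arbitrary: z)
  case (Cons c w)
  let ?w = "c # w"
  have w: "set w \<subseteq> S" "w = [] \<or> last w \<noteq> b" using Cons.prems by (auto split: if_splits)
  have "LiB_ser b ?w z - reg_sol b \<rho> ?w z = 0"
  proof (rule zero_derivative_punctured_ball[OF _ _ \<rho>0 _ Cons.prems(3)])
    show "continuous_on (ball b \<rho>) (\<lambda>z. LiB_ser b ?w z - reg_sol b \<rho> ?w z)"
      using LiB_ser_holomorphic[OF \<rho> Cons.prems(1)] reg_sol_holomorphic[OF Cons.prems(1)]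
      by (intro continuous_intros holomorphic_on_imp_continuous_on)
    show "LiB_ser b ?w b - reg_sol b \<rho> ?w b = 0"
      using LiB_ser_center[OF \<rho> Cons.prems(1)] reg_sol_center[OF Cons.prems(1)] Cons.prems(2) \<rho>0 by simp
    fix z assume z: "z \<in> ball b \<rho> - {b}"
    then have "cmod (z - b) < \<rho>" by (simp add: dist_norm norm_minus_commute)
    then have "(LiB_ser b ?w has_field_derivative LiB_ser b w z / (z - c)) (at z)"
      using LiB_ser_deriv[OF \<rho> Cons.prems(1)] Cons.prems(2) z by simp
    moreover have "(reg_sol b \<rho> ?w has_field_derivative reg_sol b \<rho> w z / (z - c)) (at z)"
      using reg_sol_deriv[OF Cons.prems(1) z] Cons.prems(2) by (simp split: if_splits)
    ultimately show "((\<lambda>z. LiB_ser b ?w z - reg_sol b \<rho> ?w z) has_field_derivative 0) (at z)"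
      using Cons.IH[OF w, of z] z by (auto intro!: derivative_eq_intros)
  qed
  then show ?case by simp
qed (simp add: LiB_ser_Nil[OF \<rho>])

definition twisted_sol :: "complex \<Rightarrow> complex \<Rightarrow> complex list \<Rightarrow> complex" where
  "twisted_sol l z = ser_mult (\<lambda>w. reg_sol b \<rho> w z) (ser_exp b l)"

lemma twisted_sol_Nil [simp]: "twisted_sol l z [] = 1"
  by (simp add: twisted_sol_def)

text \<open>In the product rule the term -K X_b/(z-b) from K meets the derivative of exp(l X_b); by
  \<open>ser_mult_letter_shift\<close> the two cancel, and only left multiplication by the X_c/(z-c)
  remains.\<close>

lemma twisted_sol_deriv:
  assumes w: "set (c # w) \<subseteq> S" and z: "z \<in> ball b \<rho> - {b}"
    and l: "(l has_field_derivative 1 / (z - b)) (at z)"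
  shows "((\<lambda>z. twisted_sol (l z) z (c # w)) has_field_derivative twisted_sol (l z) z w / (z - c)) (at z)"
proof -
  let ?k = "\<lambda>w. reg_sol b \<rho> w z" and ?E = "ser_exp b (l z)" and ?w = "c # w"
  let ?dL = "\<lambda>w. case w of [] \<Rightarrow> 0 | c # w' \<Rightarrow> reg_sol b \<rho> w' z / (z - c)"
  let ?R = "\<lambda>w. if w \<noteq> [] \<and> last w = b then reg_sol b \<rho> (butlast w) z else 0"
  let ?L = "\<lambda>w. if w \<noteq> [] \<and> hd w = b then ser_exp b (l z) (tl w) else 0"
  have "((\<lambda>z. twisted_sol (l z) z ?w) has_field_derivative
      (\<Sum>i\<le>length ?w. (?dL (take i ?w) - ?R (take i ?w) / (z - b)) * ?E (drop i ?w)
         + ?k (take i ?w) * (?L (drop i ?w) * (1 / (z - b))))) (at z)"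
    unfolding twisted_sol_def ser_mult_def
  proof (rule DERIV_sum)
    fix i
    have "set (take i ?w) \<subseteq> S" using w set_take_subset[of i ?w] by blast
    from DERIV_mult[OF reg_sol_deriv[OF this z] ser_exp_deriv[OF l, of b "drop i ?w"]]
    show "((\<lambda>z. reg_sol b \<rho> (take i ?w) z * ser_exp b (l z) (drop i ?w)) has_field_derivative
      (?dL (take i ?w) - ?R (take i ?w) / (z - b)) * ?E (drop i ?w)
         + ?k (take i ?w) * (?L (drop i ?w) * (1 / (z - b)))) (at z)"
      by (simp only: add.commute mult.commute)
  qed
  also have "(\<Sum>i\<le>length ?w. (?dL (take i ?w) - ?R (take i ?w) / (z - b)) * ?E (drop i ?w)
         + ?k (take i ?w) * (?L (drop i ?w) * (1 / (z - b))))
      = ser_mult (\<lambda>w. ?dL w - ?R w / (z - b)) ?E ?w + ser_mult ?k (\<lambda>w. ?L w / (z - b)) ?w"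
    unfolding ser_mult_def by (simp only: sum.distrib times_divide_eq_right mult_1_right)
  also have "\<dots> = ser_mult ?dL ?E ?w"
    unfolding ser_mult_diff_left ser_mult_divide_left ser_mult_divide_right
      ser_mult_letter_shift[of b ?k ?E] by simp
  also have "\<dots> = twisted_sol (l z) z w / (z - c)"
    by (simp add: ser_mult_Cons ser_mult_divide_left twisted_sol_def)
  finally show ?thesis .
qed

end

section \<open>Geometry of the slit disc\<close>

lemma zero_derivative_constant:
  fixes f :: "complex \<Rightarrow> complex"
  assumes "connected A" "open A" and f: "\<And>z. z \<in> A \<Longrightarrow> (f has_field_derivative 0) (at z)"
    and "x \<in> A" "y \<in> A"
  shows "f x = f y"
proof -
  have "continuous_on A f"
    by (intro continuous_at_imp_continuous_on ballI DERIV_isCont[OF f])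
  then obtain c where c: "\<And>z. z \<in> A \<Longrightarrow> f z = c"
    by (rule DERIV_zero_connected_constant[OF assms(1,2) finite.emptyI]) (use f in blast)+
  show ?thesis by (simp only: c assms(4,5))
qed

lemma log_branch_deriv:
  assumes "open A" "l holomorphic_on A" and l: "\<And>z. z \<in> A \<Longrightarrow> exp (l z) = (z - c) / k" and z: "z \<in> A"
  shows "(l has_field_derivative 1 / (z - c)) (at z)"
proof -
  have nz: "z \<noteq> c" "k \<noteq> 0" using l[OF z] by auto
  obtain d where d: "(l has_field_derivative d) (at z)"
    using assms(1,2) z holomorphic_on_open by blast
  have "((\<lambda>z. exp (l z)) has_field_derivative exp (l z) * d) (at z)"
    by (rule DERIV_chain'[OF d DERIV_exp])
  moreover have "((\<lambda>z. exp (l z)) has_field_derivative 1 / k) (at z)"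
  proof (rule has_field_derivative_transform_within_open)
    show "((\<lambda>z. (z - c) / k) has_field_derivative 1 / k) (at z)"
      using nz by (auto intro!: derivative_eq_intros)
  qed (use assms in auto)
  ultimately have "exp (l z) * d = 1 / k" by (rule DERIV_unique)
  then have "d = 1 / (z - c)" unfolding l[OF z] using nz by (simp add: field_simps)
  with d show ?thesis by simp
qed

locale slit_domain =
  fixes S U :: "complex set" and a b e :: complex and Lb :: "complex \<Rightarrow> complex"
  assumes fin: "finite S" and aS: "a \<in> S" and bS: "b \<in> S" and ab: "a \<noteq> b"
    and U_open: "open U" and U_connected: "connected U" and U_simply_connected: "simply_connected U"
    and U_S: "U \<inter> S = {}" and e: "e \<noteq> 0"
    and slit_disc: "{z. 0 < cmod (z - b) \<and> cmod (z - b) < rho S b} - {b + of_real t * e | t. t \<ge> 0} \<subseteq> U"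
    and Lb_holomorphic: "Lb holomorphic_on U"
    and Lb_exp: "\<And>z. z \<in> U \<Longrightarrow> exp (Lb z) = (z - b) / (a - b)"
begin

abbreviation \<rho> :: real where "\<rho> \<equiv> rho S b"

lemma rho_set: "finite {cmod (c - b) | c. c \<in> S - {b}}" "{cmod (c - b) | c. c \<in> S - {b}} \<noteq> {}"
  using fin aS ab by (auto simp: setcompr_eq_image)

lemma rho_le: "\<forall>c\<in>S. c \<noteq> b \<longrightarrow> \<rho> \<le> cmod (c - b)"
  unfolding rho_def by (intro ballI impI Min_le[OF rho_set(1)]) auto

lemma rho_pos: "0 < \<rho>"
  using Min_in[OF rho_set] unfolding rho_def by auto

text \<open>The rotated coordinate -(z-b)/e sends the ray onto the nonpositive reals, the branch cut
  of \<open>Ln\<close>; the centre \<open>b\<close> goes to 0 and is excluded too.\<close>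

definition slit :: "complex set" where
  "slit = {z \<in> ball b \<rho>. - (z - b) / e \<notin> \<real>\<^sub>\<le>\<^sub>0}"

lemma not_in_U: "c \<in> S \<Longrightarrow> z \<in> U \<Longrightarrow> z \<noteq> c"
  using U_S by blast

lemma slit_subset_ball: "slit \<subseteq> ball b \<rho>" by (auto simp: slit_def)

lemma slit_subset_U: "slit \<subseteq> U"
proof
  fix z assume z: "z \<in> slit"
  have "z \<notin> {b + of_real t * e | t. t \<ge> 0}"
    using z e by (auto simp: slit_def)
  moreover have "z \<noteq> b" using z by (auto simp: slit_def)
  ultimately show "z \<in> U"
    using z slit_disc by (auto simp: slit_def dist_norm norm_minus_commute)
qed

lemma open_slit: "open slit"
proof -
  have "open (ball b \<rho> \<inter> (\<lambda>z. - (z - b) / e) -` (- \<real>\<^sub>\<le>\<^sub>0))"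
    using e by (intro continuous_open_preimage continuous_intros) auto
  moreover have "ball b \<rho> \<inter> (\<lambda>z. - (z - b) / e) -` (- \<real>\<^sub>\<le>\<^sub>0) = slit" by (auto simp: slit_def)
  ultimately show ?thesis by simp
qed

text \<open>The point at distance \<rho>/2 from \<open>b\<close>, opposite to the ray. It normalises
  constants of integration.\<close>

lemma slit_base_point: "b - of_real (\<rho> / (2 * cmod e)) * e \<in> slit"
proof -
  let ?r = "\<rho> / (2 * cmod e)"
  have r: "0 < ?r" using rho_pos e by simp
  have "cmod (of_real ?r * e) = ?r * cmod e"
    unfolding norm_mult norm_of_real using rho_pos by simp
  also have "\<dots> < \<rho>" using rho_pos e by simp
  finally have "b - of_real ?r * e \<in> ball b \<rho>" by (simp add: dist_norm)
  moreover have "- (b - of_real ?r * e - b) / e = of_real ?r" using e by simp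
  moreover have "complex_of_real ?r \<notin> \<real>\<^sub>\<le>\<^sub>0" using r unfolding complex_nonpos_Reals_iff Re_complex_of_real by linarith
  ultimately show ?thesis unfolding slit_def mem_Collect_eq by simp
qed

text \<open>Starlike about the base point, whose rotated coordinate is a positive real: a segment
  from there to a point off the nonpositive axis never meets that axis.\<close>

lemma connected_slit: "connected slit"
proof -
  let ?r = "\<rho> / (2 * cmod e)" and ?p = "b - of_real (\<rho> / (2 * cmod e)) * e"
  have r: "0 < ?r" using rho_pos e by simp
  have "closed_segment ?p z \<subseteq> slit" if z: "z \<in> slit" for z
  proof
    fix x assume x: "x \<in> closed_segment ?p z"
    have "x \<in> ball b \<rho>"
      using closed_segment_subset[OF _ _ convex_ball] slit_base_point z slit_subset_ball x by blast
    obtain u where u: "0 \<le> u" "u \<le> 1" "x = (1 - u) *\<^sub>R ?p + u *\<^sub>R z"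
      using x by (auto simp: in_segment)
    define W where "W = - (z - b) / e"
    have eq: "- (x - b) / e = of_real ((1 - u) * ?r) + of_real u * W"
      using e by (simp add: u(3) W_def scaleR_conv_of_real field_simps)
    have Re_eq: "Re (- (x - b) / e) = (1 - u) * ?r + u * Re W" and Im_eq: "Im (- (x - b) / e) = u * Im W"
      unfolding eq by simp_all
    have W: "0 < Re W \<or> Im W \<noteq> 0" using z by (auto simp: slit_def W_def complex_nonpos_Reals_iff)
    have "0 < Re (- (x - b) / e) \<or> Im (- (x - b) / e) \<noteq> 0"
    proof (cases "u = 0 \<or> Im W = 0")
      case True
      have "0 \<le> u * Re W" if "Im W = 0" using u W that by simp
      moreover have "0 < u * Re W" if "Im W = 0" "u \<noteq> 0" using u W that by simp
      moreover have "0 \<le> (1 - u) * ?r" using u r by (intro mult_nonneg_nonneg) auto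
      ultimately show ?thesis unfolding Re_eq using True r by (cases "u = 0") auto
    next
      case False
      then show ?thesis unfolding Im_eq by simp
    qed
    then have "- (x - b) / e \<notin> \<real>\<^sub>\<le>\<^sub>0" unfolding complex_nonpos_Reals_iff by linarith
    with \<open>x \<in> ball b \<rho>\<close> show "x \<in> slit" by (simp add: slit_def)
  qed
  then have "starlike slit" unfolding starlike_def using slit_base_point by blast
  then show ?thesis by (rule starlike_imp_connected)
qed

lemma transversal_tendsto: "((\<lambda>s. z + of_real s * (\<i> * e)) \<longlongrightarrow> z) (at_right 0)"
  by (rule tendsto_eq_intros refl | simp)+

text \<open>A domain \<open>U\<close> is not assumed to avoid the ray, so limits at \<open>b\<close> within \<open>U\<close> need information at points of the
  ray as well; these are reached from the slit disc along the direction \<open>\<i> e\<close>.\<close>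

lemma transversal_in_slit:
  assumes "z \<in> ball b \<rho>"
  shows "\<forall>\<^sub>F s in at_right 0. z + of_real s * (\<i> * e) \<in> slit"
proof (cases "z \<in> slit")
  case True
  then show ?thesis using topological_tendstoD[OF transversal_tendsto open_slit] by blast
next
  case False
  then have *: "Im (- (z - b) / e) = 0" using assms by (auto simp: slit_def complex_nonpos_Reals_iff)
  have "- (z + of_real s * (\<i> * e) - b) / e \<notin> \<real>\<^sub>\<le>\<^sub>0" if "s > 0" for s
  proof -
    have "- (z + of_real s * (\<i> * e) - b) / e = - (z - b) / e - of_real s * \<i>"
      using e by (simp add: field_simps)
    then have "Im (- (z + of_real s * (\<i> * e) - b) / e) = - s" using * by (simp only: minus_complex.sel) simp
    then show ?thesis using that unfolding complex_nonpos_Reals_iff by linarith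
  qed
  note not_real = this
  have "\<forall>\<^sub>F s in at_right 0. z + of_real s * (\<i> * e) \<in> ball b \<rho>"
    using topological_tendstoD[OF transversal_tendsto open_ball assms] .
  moreover have "\<forall>\<^sub>F s in at_right (0::real). s > 0" by (simp add: eventually_at_filter)
  ultimately show ?thesis
    unfolding slit_def by eventually_elim (use not_real in blast)
qed

lemma slit_dense_eq:
  assumes "isCont f z" "isCont g z" "z \<in> ball b \<rho>" and "\<And>x. x \<in> slit \<Longrightarrow> f x = g x"
  shows "f z = (g z :: complex)"
proof (rule tendsto_unique)
  show "at_right (0::real) \<noteq> bot" by simp
  show "((\<lambda>s. g (z + of_real s * (\<i> * e))) \<longlongrightarrow> g z) (at_right 0)"
    by (rule isCont_tendsto_compose[OF assms(2) transversal_tendsto])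
  have "((\<lambda>s. f (z + of_real s * (\<i> * e))) \<longlongrightarrow> f z) (at_right 0)"
    by (rule isCont_tendsto_compose[OF assms(1) transversal_tendsto])
  then show "((\<lambda>s. g (z + of_real s * (\<i> * e))) \<longlongrightarrow> f z) (at_right 0)"
    by (rule Lim_transform_eventually) (rule eventually_mono[OF transversal_in_slit[OF assms(3)]], rule assms(4))
qed

text \<open>Makes limits at \<open>b\<close> within \<open>U\<close> unique; otherwise every limit
  statement there would hold vacuously.\<close>

lemma b_limit_point: "at b within U \<noteq> bot"
proof
  assume "at b within U = bot"
  have "filterlim (\<lambda>s. b + of_real s * (\<i> * e)) (at b within U) (at_right 0)"
    unfolding filterlim_at
  proof
    show "\<forall>\<^sub>F s in at_right 0. b + of_real s * (\<i> * e) \<in> U \<and> b + of_real s * (\<i> * e) \<noteq> b"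
    proof (rule eventually_mono[OF transversal_in_slit])
      show "b \<in> ball b \<rho>" using rho_pos by simp
      fix s assume "b + of_real s * (\<i> * e) \<in> slit"
      then have "b + of_real s * (\<i> * e) \<in> U" using slit_subset_U by blast
      then show "b + of_real s * (\<i> * e) \<in> U \<and> b + of_real s * (\<i> * e) \<noteq> b"
        using not_in_U[OF bS] by blast
    qed
  qed (rule transversal_tendsto)
  moreover have "\<forall>\<^sub>F z in at b within U. False" by (simp add: \<open>at b within U = bot\<close>)
  ultimately have "\<forall>\<^sub>F s in at_right (0::real). False"
    by (rule eventually_compose_filterlim[rotated])
  then show False by simp
qed

lemma eventually_near_b: "\<forall>\<^sub>F z in at b within U. z \<in> U \<and> z \<in> ball b \<rho> \<and> z \<noteq> b"
  using rho_pos by (auto simp: eventually_at dist_commute intro!: exI[of _ \<rho>])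

lemma Lb_deriv: "z \<in> U \<Longrightarrow> (Lb has_field_derivative 1 / (z - b)) (at z)"
  by (rule log_branch_deriv[OF U_open Lb_holomorphic Lb_exp])

lemma Lb_isCont: "z \<in> U \<Longrightarrow> isCont Lb z"
  using Lb_deriv DERIV_isCont by blast

lemmas constant_on_U = zero_derivative_constant[OF U_connected U_open]
  and constant_on_slit = zero_derivative_constant[OF connected_slit open_slit]

text \<open>On the slit disc \<open>Lb\<close> differs by a constant from \<open>Ln\<close> of the
  rotated coordinate, whose imaginary part is at most pi in modulus. Points of \<open>U\<close> on
  the ray inherit the bound by a limit along \<open>\<i> * e\<close>.\<close>

lemma Im_Lb_bounded: "\<exists>C\<ge>0. \<forall>z\<in>U \<inter> ball b \<rho>. \<bar>Im (Lb z)\<bar> \<le> C"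
proof -
  define g where "g z = Lb z - Ln (- (z - b) / e)" for z
  have "((\<lambda>z. g z) has_field_derivative 0) (at z)" if z: "z \<in> slit" for z
  proof -
    have zU: "z \<in> U" using z slit_subset_U by blast
    have "- (z - b) / e \<notin> \<real>\<^sub>\<le>\<^sub>0" using z by (simp add: slit_def)
    note 1 = has_field_derivative_Ln[OF this]
    have 2: "((\<lambda>z. - (z - b) / e) has_field_derivative - 1 / e) (at z)"
      using e by (auto intro!: derivative_eq_intros)
    have "inverse (- (z - b) / e) * (- 1 / e) = 1 / (z - b)"
      using e not_in_U[OF bS zU] by (simp add: divide_simps)
    with DERIV_chain'[OF 2 1]
    have "((\<lambda>z. Ln (- (z - b) / e)) has_field_derivative 1 / (z - b)) (at z)" by (simp only:)
    from DERIV_diff[OF Lb_deriv[OF zU] this] show ?thesis by (simp add: g_def)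
  qed
  then have const: "g z = g (b - of_real (\<rho> / (2 * cmod e)) * e)" if "z \<in> slit" for z
    by (rule constant_on_slit[OF _ that slit_base_point])
  define C where "C = \<bar>Im (g (b - of_real (\<rho> / (2 * cmod e)) * e))\<bar> + pi"
  have le: "\<bar>Im (Lb z)\<bar> \<le> C" if z: "z \<in> slit" for z
  proof -
    have "- (z - b) / e \<noteq> 0" using z by (auto simp: slit_def)
    then have "\<bar>Im (Ln (- (z - b) / e))\<bar> \<le> pi"
      using mpi_less_Im_Ln[of "- (z - b) / e"] Im_Ln_le_pi[of "- (z - b) / e"] by linarith
    moreover have "Lb z = g z + Ln (- (z - b) / e)" by (simp add: g_def)
    ultimately show ?thesis using const[OF z] by (simp add: C_def)
  qed
  have "\<bar>Im (Lb z)\<bar> \<le> C" if "z \<in> U \<inter> ball b \<rho>" for z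
  proof (rule tendsto_upperbound)
    show "at_right (0::real) \<noteq> bot" by simp
    show "((\<lambda>s. \<bar>Im (Lb (z + of_real s * (\<i> * e)))\<bar>) \<longlongrightarrow> \<bar>Im (Lb z)\<bar>) (at_right 0)"
      by (rule tendsto_rabs[OF tendsto_Im[OF isCont_tendsto_compose[OF Lb_isCont transversal_tendsto]]])
        (use that in blast)
    show "\<forall>\<^sub>F s in at_right 0. \<bar>Im (Lb (z + of_real s * (\<i> * e)))\<bar> \<le> C"
      by (rule eventually_mono[OF transversal_in_slit]) (use that in blast, rule le)
  qed
  moreover have "0 \<le> C" by (simp add: C_def)
  ultimately show ?thesis by blast
qed

section \<open>Growth of the logarithm at the centre\<close>

lemma Re_Lb:
  assumes "z \<in> U"
  shows "Re (Lb z) = ln (cmod (z - b) / cmod (a - b))" "cmod (z - b) = cmod (a - b) * exp (Re (Lb z))"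
proof -
  have *: "exp (Re (Lb z)) = cmod (z - b) / cmod (a - b)"
    using Lb_exp[OF assms] by (simp add: norm_divide flip: norm_exp_eq_Re)
  then show "Re (Lb z) = ln (cmod (z - b) / cmod (a - b))" by (metis ln_exp)
  show "cmod (z - b) = cmod (a - b) * exp (Re (Lb z))" using ab unfolding * by simp
qed

lemma Re_Lb_at_bot: "filterlim (\<lambda>z. Re (Lb z)) at_bot (at b within U)"
proof -
  have "((\<lambda>z. cmod (z - b) / cmod (a - b)) \<longlongrightarrow> 0) (at b within U)"
    by (rule tendsto_eq_intros refl | simp add: ab)+
  moreover have "\<forall>\<^sub>F z in at b within U. cmod (z - b) / cmod (a - b) \<in> {0<..} \<and> cmod (z - b) / cmod (a - b) \<noteq> 0"
    by (rule eventually_mono[OF eventually_near_b]) (use ab in auto)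
  ultimately have "filterlim (\<lambda>z. cmod (z - b) / cmod (a - b)) (at_right 0) (at b within U)"
    by (simp add: filterlim_at)
  then have "filterlim (\<lambda>z. ln (cmod (z - b) / cmod (a - b))) at_bot (at b within U)"
    by (rule filterlim_compose[OF ln_at_0])
  then show ?thesis
    by (rule filterlim_cong[THEN iffD1, OF refl refl, rotated])
      (rule eventually_mono[OF eventually_near_b], use Re_Lb in auto)
qed

text \<open>Put y = C - Re(Lb z), with \<open>C\<close> the bound on the imaginary part. Once Re(Lb
  z) is nonpositive, |Lb z| is at most y and |z - b| is a constant times exp(-y), so the claim
  reduces to y^k/exp(y) tending to 0.\<close>

lemma log_power_limit: "((\<lambda>z. (z - b) * Lb z ^ k) \<longlongrightarrow> 0) (at b within U)"
proof -
  obtain C where C: "0 \<le> C" "\<And>z. z \<in> U \<inter> ball b \<rho> \<Longrightarrow> \<bar>Im (Lb z)\<bar> \<le> C"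
    using Im_Lb_bounded by blast
  have "filterlim (\<lambda>z. C + (- Re (Lb z))) at_top (at b within U)"
    by (intro filterlim_tendsto_add_at_top[OF tendsto_const])
      (rule Re_Lb_at_bot[unfolded filterlim_uminus_at_bot])
  then have "filterlim (\<lambda>z. C - Re (Lb z)) at_top (at b within U)" by simp
  from filterlim_compose[OF tendsto_power_div_exp_0[of k] this]
  have lim: "((\<lambda>z. cmod (a - b) * exp C * ((C - Re (Lb z)) ^ k / exp (C - Re (Lb z)))) \<longlongrightarrow> 0) (at b within U)"
    by (rule tendsto_mult_right_zero)
  have "\<forall>\<^sub>F z in at b within U. Re (Lb z) \<le> 0"
    using Re_Lb_at_bot by (simp add: filterlim_at_bot)
  with eventually_near_b
  have "\<forall>\<^sub>F z in at b within U. norm ((z - b) * Lb z ^ k)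
      \<le> cmod (a - b) * exp C * ((C - Re (Lb z)) ^ k / exp (C - Re (Lb z)))"
  proof eventually_elim
    case (elim z)
    have "cmod (Lb z) \<le> \<bar>Re (Lb z)\<bar> + \<bar>Im (Lb z)\<bar>" by (rule cmod_le)
    also have "\<dots> \<le> C - Re (Lb z)" using elim C(2)[of z] by auto
    finally have "cmod (Lb z) ^ k \<le> (C - Re (Lb z)) ^ k" by (intro power_mono) auto
    moreover have "cmod (z - b) = cmod (a - b) * exp C / exp (C - Re (Lb z))"
      using Re_Lb(2)[of z] elim by (simp add: exp_diff)
    ultimately show ?case
      by (simp add: norm_mult norm_power divide_right_mono mult_left_mono)
  qed
  then show ?thesis by (rule Lim_null_comparison[OF _ lim])
qed

end

section \<open>Analytic continuation and the character property\<close>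

lemma tendsto_sum_mset:
  fixes f :: "'a \<Rightarrow> 'b \<Rightarrow> 'c::topological_comm_monoid_add"
  assumes "\<And>x. x \<in># M \<Longrightarrow> ((\<lambda>z. f x z) \<longlongrightarrow> 0) F"
  shows "((\<lambda>z. \<Sum>x\<in>#M. f x z) \<longlongrightarrow> 0) F"
  using assms
proof (induction M)
  case (add x M)
  have "((\<lambda>z. f x z + (\<Sum>x\<in>#M. f x z)) \<longlongrightarrow> 0 + 0) F"
    by (intro tendsto_add add) (simp_all add: add)
  then show ?case by simp
qed simp

lemma DERIV_sum_mset:
  assumes "\<And>x. x \<in># M \<Longrightarrow> ((\<lambda>z. f x z) has_field_derivative f' x) (at z within A)"
  shows "((\<lambda>z. \<Sum>x\<in>#M. f x z) has_field_derivative (\<Sum>x\<in>#M. f' x)) (at z within A)"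
  using assms
proof (induction M)
  case (add x M)
  have "((\<lambda>z. f x z + (\<Sum>x\<in>#M. f x z)) has_field_derivative f' x + (\<Sum>x\<in>#M. f' x)) (at z within A)"
    by (intro DERIV_add add) (simp_all add: add)
  then show ?case by simp
qed simp

lemma set_shw: "w \<in># shw u v \<Longrightarrow> set w = set u \<union> set v"
  by (induction u v arbitrary: w rule: shw.induct) auto

lemma length_shw: "w \<in># shw u v \<Longrightarrow> length w = length u + length v"
  by (induction u v arbitrary: w rule: shw.induct) auto

lemma size_shw: "size (shw u v) = (length u + length v) choose length u"
  by (induction u v rule: shw.induct) auto

lemma shw_Nil_right [simp]: "shw u [] = {#u#}"
  by (cases u) auto

text \<open>All interleavings coincide as words, so only their number counts.\<close>

lemma shw_replicate: "shw (replicate m x) (replicate n x) = replicate_mset ((m + n) choose m) (replicate (m + n) x)"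
proof -
  have "w = replicate (m + n) x" if "w \<in># shw (replicate m x) (replicate n x)" for w
    using set_shw[OF that] length_shw[OF that] by (intro replicate_eqI) auto
  then have "shw (replicate m x) (replicate n x) = replicate_mset (size (shw (replicate m x) (replicate n x))) (replicate (m + n) x)"
    by (intro set_mset_subset_singletonD) auto
  then show ?thesis by (simp add: size_shw)
qed

lemma sum_mset_divide: "(\<Sum>x\<in>#M. f x / k) = (\<Sum>x\<in>#M. f x) / (k :: 'a::field)"
  by (induction M) (auto simp: add_divide_distrib)

context slit_domain
begin

text \<open>The coefficients of H on \<open>U\<close>. The differential equation on \<open>U\<close>
  fixes each up to a constant of integration; agreement with K exp(Lb X_b) on the slit disc fixes
  that constant.\<close>

primrec word_fun :: "complex list \<Rightarrow> complex \<Rightarrow> complex" where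
  "word_fun [] = (\<lambda>_. 1)"
| "word_fun (c # w) = (SOME f. (\<forall>z\<in>U. (f has_field_derivative word_fun w z / (z - c)) (at z)) \<and>
      (\<forall>z\<in>slit. f z = twisted_sol b \<rho> (Lb z) z (c # w)))"

declare word_fun.simps(2) [simp del]

lemma slit_punctured_ball: "z \<in> slit \<Longrightarrow> z \<in> ball b \<rho> - {b}"
  by (auto simp: slit_def)

text \<open>Simple connectivity gives a primitive on \<open>U\<close>. On the slit disc it has the
  same derivative as the local solution, and connectedness makes their difference the single
  constant \<open>k\<close>.\<close>

lemma word_fun_step:
  assumes "set (c # w) \<subseteq> S" and hol: "word_fun w holomorphic_on U"
    and eq: "\<And>z. z \<in> slit \<Longrightarrow> word_fun w z = twisted_sol b \<rho> (Lb z) z w"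
  shows "(\<forall>z\<in>U. (word_fun (c # w) has_field_derivative word_fun w z / (z - c)) (at z)) \<and>
    (\<forall>z\<in>slit. word_fun (c # w) z = twisted_sol b \<rho> (Lb z) z (c # w))"
proof -
  have "(\<lambda>z. word_fun w z / (z - c)) holomorphic_on U"
    using not_in_U assms(1) by (intro holomorphic_intros hol) auto
  then obtain h where h: "\<And>z. z \<in> U \<Longrightarrow> (h has_field_derivative word_fun w z / (z - c)) (at z)"
    using U_simply_connected unfolding simply_connected_eq_global_primitive[OF U_open] by blast
  let ?p = "b - of_real (\<rho> / (2 * cmod e)) * e"
  let ?T = "\<lambda>z. twisted_sol b \<rho> (Lb z) z (c # w)"
  define k where "k = ?T ?p - h ?p"
  have "((\<lambda>z. ?T z - h z) has_field_derivative 0) (at z)" if z: "z \<in> slit" for z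
  proof -
    have zU: "z \<in> U" using z slit_subset_U by blast
    have "(?T has_field_derivative twisted_sol b \<rho> (Lb z) z w / (z - c)) (at z)"
      by (rule twisted_sol_deriv[OF rho_le rho_pos assms(1) slit_punctured_ball[OF z] Lb_deriv[OF zU]])
    from DERIV_diff[OF this h[OF zU]] show ?thesis by (simp add: eq[OF z])
  qed
  then have "?T z - h z = k" if "z \<in> slit" for z
    unfolding k_def by (rule constant_on_slit[OF _ that slit_base_point])
  then have T: "h z + k = ?T z" if "z \<in> slit" for z using that by (simp add: algebra_simps)
  have "\<exists>f. (\<forall>z\<in>U. (f has_field_derivative word_fun w z / (z - c)) (at z)) \<and> (\<forall>z\<in>slit. f z = ?T z)"
    by (intro exI[of _ "\<lambda>z. h z + k"] conjI ballI T DERIV_cong[OF DERIV_add[OF h DERIV_const]]) auto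
  from someI_ex[OF this] show ?thesis by (simp only: word_fun.simps(2))
qed

lemma word_fun_props:
  "set w \<subseteq> S \<Longrightarrow> word_fun w holomorphic_on U \<and> (\<forall>z\<in>slit. word_fun w z = twisted_sol b \<rho> (Lb z) z w)"
proof (induction w)
  case Nil
  then show ?case by (simp add: twisted_sol_Nil[OF rho_le rho_pos])
next
  case (Cons c w)
  then have "word_fun w holomorphic_on U" "\<And>z. z \<in> slit \<Longrightarrow> word_fun w z = twisted_sol b \<rho> (Lb z) z w" by auto
  from word_fun_step[OF Cons.prems this] show ?case
    unfolding holomorphic_on_open[OF U_open] by blast
qed

lemmas word_fun_holomorphic = word_fun_props[THEN conjunct1]
  and word_fun_slit = word_fun_props[THEN conjunct2, THEN bspec]

lemma word_fun_deriv:
  assumes "set (c # w) \<subseteq> S" "z \<in> U"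
  shows "(word_fun (c # w) has_field_derivative word_fun w z / (z - c)) (at z)"
proof -
  have "set w \<subseteq> S" using assms by simp
  from word_fun_step[OF assms(1) word_fun_holomorphic[OF this] word_fun_slit[OF this]] assms(2)
  show ?thesis by blast
qed

lemma word_fun_isCont: "set w \<subseteq> S \<Longrightarrow> z \<in> U \<Longrightarrow> isCont (word_fun w) z"
  using word_fun_holomorphic U_open holomorphic_on_imp_continuous_on continuous_on_eq_continuous_at by blast

lemma reg_sol_isCont: "set w \<subseteq> S \<Longrightarrow> z \<in> ball b \<rho> \<Longrightarrow> isCont (reg_sol b \<rho> w) z"
  using reg_sol_holomorphic[OF rho_le rho_pos] open_ball holomorphic_on_imp_continuous_on
    continuous_on_eq_continuous_at by blast

text \<open>Extends the local formula to points of \<open>U\<close> on the ray, as limits at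
  \<open>b\<close> are taken within all of \<open>U\<close>.\<close>

lemma word_fun_near_b:
  assumes w: "set w \<subseteq> S" and z: "z \<in> U" "z \<in> ball b \<rho>"
  shows "word_fun w z = ser_mult (\<lambda>w. reg_sol b \<rho> w z) (ser_exp b (Lb z)) w"
proof (rule slit_dense_eq[where z = z])
  have "isCont (\<lambda>z. reg_sol b \<rho> (take i w) z * ser_exp b (Lb z) (drop i w)) z" for i
  proof (intro isCont_mult)
    have "set (take i w) \<subseteq> S" using w set_take_subset[of i w] by blast
    then show "isCont (reg_sol b \<rho> (take i w)) z" using reg_sol_isCont z by blast
    show "isCont (\<lambda>z. ser_exp b (Lb z) (drop i w)) z"
      by (rule DERIV_isCont[OF ser_exp_deriv[OF Lb_deriv[OF z(1)]]])
  qed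
  then show "isCont (\<lambda>z. ser_mult (\<lambda>w. reg_sol b \<rho> w z) (ser_exp b (Lb z)) w) z"
    unfolding ser_mult_def by (intro isCont_sum) blast
qed (use w z word_fun_isCont word_fun_slit[OF w] in \<open>auto simp: twisted_sol_def[OF rho_le rho_pos]\<close>)

text \<open>The coefficient of a nonempty word vanishes at \<open>b\<close>, hence is z - b times a
  convergent difference quotient.\<close>

lemma reg_sol_log_limit:
  assumes "set w \<subseteq> S" "w \<noteq> []"
  shows "((\<lambda>z. reg_sol b \<rho> w z * Lb z ^ k) \<longlongrightarrow> 0) (at b within U)"
proof -
  have b: "b \<in> ball b \<rho>" using rho_pos by simp
  obtain d where "(reg_sol b \<rho> w has_field_derivative d) (at b)"
    using reg_sol_holomorphic[OF rho_le rho_pos assms(1)] b holomorphic_on_open[OF open_ball] by blast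
  then have "((\<lambda>z. (reg_sol b \<rho> w z - reg_sol b \<rho> w b) / (z - b)) \<longlongrightarrow> d) (at b within U)"
    using tendsto_within_subset[OF _ subset_UNIV] unfolding has_field_derivative_iff by blast
  from tendsto_mult[OF this log_power_limit[of k]]
  have "((\<lambda>z. reg_sol b \<rho> w z / (z - b) * ((z - b) * Lb z ^ k)) \<longlongrightarrow> 0) (at b within U)"
    using reg_sol_center[OF rho_le rho_pos assms(1)] assms(2) by simp
  then show ?thesis
    by (rule Lim_transform_eventually) (rule eventually_mono[OF eventually_near_b], simp)
qed

text \<open>A cut contributes only if its suffix consists of letters \<open>b\<close>. Its prefix is
  then nonempty, so a coefficient of K vanishing at \<open>b\<close> faces a power of the
  logarithm.\<close>

lemma word_fun_log_limit:
  assumes w: "set w \<subseteq> S" and nb: "\<not> set w \<subseteq> {b}"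
  shows "((\<lambda>z. word_fun w z * Lb z ^ k) \<longlongrightarrow> 0) (at b within U)"
proof -
  have "((\<lambda>z. reg_sol b \<rho> (take i w) z * ser_exp b (Lb z) (drop i w) * Lb z ^ k) \<longlongrightarrow> 0) (at b within U)" for i
  proof (cases "(\<forall>x\<in>set (drop i w). x = b) \<and> take i w \<noteq> []")
    case True
    have "set (take i w) \<subseteq> S" using w set_take_subset[of i w] by blast
    from reg_sol_log_limit[OF this, of "length (drop i w) + k"] True
    have "((\<lambda>z. reg_sol b \<rho> (take i w) z * Lb z ^ (length (drop i w) + k) / fact (length (drop i w))) \<longlongrightarrow> 0) (at b within U)"
      by (intro tendsto_divide_zero) auto
    then show ?thesis using True by (simp add: ser_exp_def power_add mult.assoc)
  next
    case False
    have "\<not> (\<forall>x\<in>set (drop i w). x = b)"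
    proof
      assume *: "\<forall>x\<in>set (drop i w). x = b"
      with False have "take i w = []" by blast
      with * have "\<forall>x\<in>set w. x = b" by (metis append_Nil append_take_drop_id)
      with nb show False by blast
    qed
    then show ?thesis unfolding ser_exp_def by (simp only: if_False mult_zero_left mult_zero_right tendsto_const)
  qed
  then have "((\<lambda>z. \<Sum>i\<le>length w. reg_sol b \<rho> (take i w) z * ser_exp b (Lb z) (drop i w) * Lb z ^ k) \<longlongrightarrow> 0) (at b within U)"
    by (intro tendsto_null_sum)
  then show ?thesis
    by (rule Lim_transform_eventually)
      (rule eventually_mono[OF eventually_near_b], simp add: word_fun_near_b[OF w] ser_mult_def sum_distrib_right)
qed

text \<open>Both sides have the same derivative on \<open>U\<close> by induction. They agree at the
  base point because \<open>reg_sol\<close> vanishes on nonempty powers of \<open>b\<close>, leaving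
  only the cut with empty prefix.\<close>

lemma word_fun_replicate_ser_exp:
  assumes "z \<in> U"
  shows "word_fun (replicate n b) z = ser_exp b (Lb z) (replicate n b)"
  using assms
proof (induction n arbitrary: z)
  case (Suc n)
  let ?w = "replicate (Suc n) b"
  have S: "set ?w \<subseteq> S" using bS by auto
  let ?f = "\<lambda>z. word_fun ?w z - ser_exp b (Lb z) ?w"
  have "(?f has_field_derivative 0) (at z)" if z: "z \<in> U" for z
  proof -
    have "(word_fun ?w has_field_derivative ser_exp b (Lb z) (replicate n b) / (z - b)) (at z)"
      using word_fun_deriv[of b "replicate n b" z] S z Suc.IH[OF z] by simp
    from DERIV_diff[OF this ser_exp_deriv[OF Lb_deriv[OF z], of b ?w]] show ?thesis by simp
  qed
  then have const: "?f x = ?f y" if "x \<in> U" "y \<in> U" for x y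
    by (rule constant_on_U[OF _ that])
  let ?p = "b - of_real (\<rho> / (2 * cmod e)) * e"
  have p: "?p \<in> U" "?p \<in> ball b \<rho>" using slit_base_point slit_subset_U slit_subset_ball by auto
  have "reg_sol b \<rho> (take i ?w) ?p * ser_exp b (Lb ?p) (drop i ?w)
      = (if i = 0 then ser_exp b (Lb ?p) ?w else 0)" if "i \<le> Suc n" for i
  proof (cases i)
    case (Suc j)
    have "take i ?w = replicate (Suc j) b"
      using that Suc by (simp only: take_replicate min_absorb1)
    then show ?thesis
      using Suc reg_sol_replicate[OF rho_le rho_pos bS p(2), of j] by (simp only: mult_zero_left nat.distinct if_False)
  qed simp
  then have "word_fun ?w ?p = (\<Sum>i\<le>Suc n. if i = 0 then ser_exp b (Lb ?p) ?w else 0)"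
    unfolding word_fun_near_b[OF S p] ser_mult_def length_replicate by (intro sum.cong refl) (simp only: atMost_iff)
  then have "?f ?p = 0" by simp
  then show ?case using const[OF Suc.prems p(1)] by (simp only: diff_self right_minus_eq)
qed simp

lemma word_fun_replicate:
  "z \<in> U \<Longrightarrow> word_fun (replicate n b) z = Lb z ^ n / fact n"
  by (simp add: word_fun_replicate_ser_exp ser_exp_def)

text \<open>If \<open>v\<close> is a power of \<open>b\<close>, its function is a power of the
  logarithm, which \<open>word_fun_log_limit\<close> absorbs; otherwise both factors tend to
  0.\<close>

lemma word_fun_mult_limit:
  assumes "set u \<subseteq> S" "set v \<subseteq> S" and "\<not> set u \<subseteq> {b}"
  shows "((\<lambda>z. word_fun u z * word_fun v z) \<longlongrightarrow> 0) (at b within U)"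
proof (cases "set v \<subseteq> {b}")
  case True
  then have v: "v = replicate (length v) b" by (intro replicate_eqI) auto
  have v': "word_fun v z = Lb z ^ length v / fact (length v)" if "z \<in> U" for z
    using word_fun_replicate[OF that, of "length v"] unfolding v[symmetric] .
  have "((\<lambda>z. word_fun u z * Lb z ^ length v / fact (length v)) \<longlongrightarrow> 0) (at b within U)"
    by (intro tendsto_divide_zero word_fun_log_limit assms)
  then show ?thesis
    by (rule Lim_transform_eventually)
      (rule eventually_mono[OF eventually_near_b], simp add: v')
next
  case False
  then show ?thesis
    using tendsto_mult[OF word_fun_log_limit[OF assms(1,3), of 0] word_fun_log_limit[OF assms(2) False, of 0]] by simp
qed

lemma word_fun_shuffle_replicate:
  assumes "z \<in> U"
  shows "word_fun (replicate m b) z * word_fun (replicate n b) z =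
    (\<Sum>w\<in>#shw (replicate m b) (replicate n b). word_fun w z)"
  unfolding shw_replicate by (simp add: word_fun_replicate[OF assms] binomial_fact power_add)

lemma word_fun_shuffle:
  assumes "set u \<subseteq> S" "set v \<subseteq> S" "z \<in> U"
  shows "word_fun u z * word_fun v z = (\<Sum>w\<in>#shw u v. word_fun w z)"
  using assms
proof (induction u v arbitrary: z rule: shw.induct)
  case (3 x u y v)
  let ?u = "x # u" and ?v = "y # v"
  show ?case
  proof (cases "set ?u \<subseteq> {b} \<and> set ?v \<subseteq> {b}")
    \<comment> \<open>Powers of the logarithm have no limit 0 at \<open>b\<close>, so the identity
      is computed directly: it is the binomial count in \<open>shw_replicate\<close>.\<close>
    case True
    then have uv: "?u = replicate (length ?u) b" "?v = replicate (length ?v) b"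
      by (intro replicate_eqI; auto)+
    show ?thesis
      using word_fun_shuffle_replicate[OF \<open>z \<in> U\<close>, of "length ?u" "length ?v"] unfolding uv[symmetric] .
  next
    case False
    let ?d = "\<lambda>z. word_fun ?u z * word_fun ?v z - (\<Sum>w\<in>#shw ?u ?v. word_fun w z)"
    have Sw: "set w \<subseteq> S" if "w \<in># shw ?u ?v" for w
      using set_shw[OF that] 3(3,4) by blast
    have "(?d has_field_derivative 0) (at z)" if z: "z \<in> U" for z
    proof -
      have "((\<lambda>z. \<Sum>w\<in>#shw ?u ?v. word_fun w z) has_field_derivative
          (\<Sum>w\<in>#shw ?u ?v. case w of [] \<Rightarrow> 0 | c # w' \<Rightarrow> word_fun w' z / (z - c))) (at z)"
      proof (rule DERIV_sum_mset)
        fix w assume w: "w \<in># shw ?u ?v"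
        have "w \<noteq> []" using length_shw[OF w] by auto
        then show "(word_fun w has_field_derivative (case w of [] \<Rightarrow> 0 | c # w' \<Rightarrow> word_fun w' z / (z - c))) (at z)"
          using word_fun_deriv Sw[OF w] z by (cases w) auto
      qed
      also have "(\<Sum>w\<in>#shw ?u ?v. case w of [] \<Rightarrow> 0 | c # w' \<Rightarrow> word_fun w' z / (z - c))
          = (\<Sum>w\<in>#shw u ?v. word_fun w z) / (z - x) + (\<Sum>w\<in>#shw ?u v. word_fun w z) / (z - y)"
        by (simp add: image_mset.compositionality comp_def sum_mset_divide)
      also have "\<dots> = word_fun u z * word_fun ?v z / (z - x) + word_fun ?u z * word_fun v z / (z - y)"
        using 3(1)[OF _ 3(4) z] 3(2)[OF 3(3) _ z] 3(3,4) by simp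
      finally have 1: "((\<lambda>z. \<Sum>w\<in>#shw ?u ?v. word_fun w z) has_field_derivative \<dots>) (at z)" .
      show ?thesis
        by (rule DERIV_cong[OF DERIV_diff[OF DERIV_mult[OF word_fun_deriv[OF 3(3) z] word_fun_deriv[OF 3(4) z]] 1]])
          (simp add: mult.commute)
    qed
    then have const: "?d x = ?d y" if "x \<in> U" "y \<in> U" for x y
      by (rule constant_on_U[OF _ that])
    have "((\<lambda>z. word_fun ?u z * word_fun ?v z) \<longlongrightarrow> 0) (at b within U)"
    proof (cases "set ?u \<subseteq> {b}")
      case True
      with False have "\<not> set ?v \<subseteq> {b}" by blast
      from word_fun_mult_limit[OF 3(4,3) this] show ?thesis by (simp only: mult.commute)
    next
      case False
      then show ?thesis by (rule word_fun_mult_limit[OF 3(3,4)])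
    qed
    moreover have "((\<lambda>z. \<Sum>w\<in>#shw ?u ?v. word_fun w z) \<longlongrightarrow> 0) (at b within U)"
    proof (rule tendsto_sum_mset)
      fix w assume w: "w \<in># shw ?u ?v"
      have "\<not> set w \<subseteq> {b}" using False set_shw[OF w] by blast
      from word_fun_log_limit[OF Sw[OF w] this, of 0]
      show "((\<lambda>z. word_fun w z) \<longlongrightarrow> 0) (at b within U)" by simp
    qed
    ultimately have "(?d \<longlongrightarrow> 0 - 0) (at b within U)" by (rule tendsto_diff)
    moreover have "(?d \<longlongrightarrow> ?d z) (at b within U)"
      by (rule tendsto_eventually, rule eventually_mono[OF eventually_near_b]) (use const 3(5) in blast)
    ultimately have "?d z = 0 - 0" using tendsto_unique[OF b_limit_point] by blast
    then show ?thesis by simp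
  qed
qed simp_all

end

section \<open>Identification with the defined objects\<close>

lemma sum_mset_count:
  assumes "finite A" "set_mset M \<subseteq> A"
  shows "(\<Sum>x\<in>#M. f x) = (\<Sum>x\<in>A. of_nat (count M x) * (f x :: 'b::comm_semiring_1))"
  using assms(2)
proof (induction M)
  case (add x M)
  have "(\<Sum>y\<in>A. of_nat (count (add_mset x M) y) * f y) = (\<Sum>y\<in>A. (if y = x then f y else 0) + of_nat (count M y) * f y)"
    by (intro sum.cong) (auto simp: algebra_simps)
  also have "\<dots> = f x + (\<Sum>y\<in>A. of_nat (count M y) * f y)"
    using add.prems assms(1) by (simp add: sum.distrib)
  finally show ?case using add by simp
qed simp

lemma ser_mult_one_right: "ser_mult F (\<lambda>w. if w = [] then 1 else 0) w = F w"
proof -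
  have "ser_mult F (\<lambda>w. if w = [] then 1 else 0) w = (\<Sum>i\<le>length w. if i = length w then F w else 0)"
    unfolding ser_mult_def by (intro sum.cong) auto
  then show ?thesis by simp
qed

context slit_domain
begin

definition poly_fun :: "ncpoly \<Rightarrow> complex \<Rightarrow> complex" where
  "poly_fun p z = (\<Sum>w\<in>{w. p w \<noteq> 0}. p w * word_fun w z)"

lemma poly_fun_superset:
  assumes "finite A" "{w. p w \<noteq> 0} \<subseteq> A"
  shows "poly_fun p z = (\<Sum>w\<in>A. p w * word_fun w z)"
  unfolding poly_fun_def using assms by (intro sum.mono_neutral_left) auto

lemma poly_fun_word: "poly_fun (word_poly w) z = word_fun w z"
  using poly_fun_superset[of "{w}" "word_poly w"] by (auto simp: word_poly_def)

lemma is_poly_letters: "is_poly S p \<Longrightarrow> p w \<noteq> 0 \<Longrightarrow> set w \<subseteq> S"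
  and is_poly_finite: "is_poly S p \<Longrightarrow> finite {w. p w \<noteq> 0}"
  by (simp_all add: is_poly_def)

lemma poly_fun_add:
  assumes "is_poly S p" "is_poly S q"
  shows "poly_fun (\<lambda>w. p w + q w) z = poly_fun p z + poly_fun q z"
proof -
  let ?A = "{w. p w \<noteq> 0} \<union> {w. q w \<noteq> 0}"
  have fin: "finite ?A" using assms is_poly_finite by blast
  have "poly_fun (\<lambda>w. p w + q w) z = (\<Sum>w\<in>?A. (p w + q w) * word_fun w z)"
    by (rule poly_fun_superset[OF fin]) auto
  also have "\<dots> = poly_fun p z + poly_fun q z"
    using poly_fun_superset[OF fin, of p] poly_fun_superset[OF fin, of q] by (simp add: algebra_simps sum.distrib)
  finally show ?thesis .
qed

lemma poly_fun_scale: "poly_fun (\<lambda>w. k * p w) z = k * poly_fun p z"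
  by (cases "k = 0") (simp_all add: poly_fun_def sum_distrib_left mult.assoc)

lemma poly_fun_shuf:
  assumes "is_poly S p" "is_poly S q" "z \<in> U"
  shows "poly_fun (shuf p q) z = poly_fun p z * poly_fun q z"
proof -
  let ?P = "{w. p w \<noteq> 0}" and ?Q = "{w. q w \<noteq> 0}"
  \<comment> \<open>One finite set containing all shuffles of support words, so that the three sums
    can be exchanged.\<close>
  let ?A = "\<Union>u\<in>?P. \<Union>v\<in>?Q. set_mset (shw u v)"
  have fin: "finite ?A" using is_poly_finite assms by auto
  have "{w. shuf p q w \<noteq> 0} \<subseteq> ?A"
  proof
    fix w assume "w \<in> {w. shuf p q w \<noteq> 0}"
    then have "(\<Sum>u\<in>?P. \<Sum>v\<in>?Q. p u * q v * of_nat (count (shw u v) w)) \<noteq> 0"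
      by (simp add: shuf_def)
    then obtain u where u: "u \<in> ?P" "(\<Sum>v\<in>?Q. p u * q v * of_nat (count (shw u v) w)) \<noteq> 0"
      by (rule sum.not_neutral_contains_not_neutral) (rule that)
    from u(2) obtain v where "v \<in> ?Q" "p u * q v * of_nat (count (shw u v) w) \<noteq> 0"
      by (rule sum.not_neutral_contains_not_neutral) (rule that)
    then have "v \<in> ?Q" "w \<in># shw u v" using not_in_iff by fastforce+
    with u(1) show "w \<in> ?A" by blast
  qed
  then have "poly_fun (shuf p q) z = (\<Sum>w\<in>?A. shuf p q w * word_fun w z)"
    by (rule poly_fun_superset[OF fin])
  also have "\<dots> = (\<Sum>w\<in>?A. \<Sum>u\<in>?P. \<Sum>v\<in>?Q. p u * q v * (of_nat (count (shw u v) w) * word_fun w z))"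
    by (simp only: shuf_def sum_distrib_right mult.assoc)
  also have "\<dots> = (\<Sum>u\<in>?P. \<Sum>w\<in>?A. \<Sum>v\<in>?Q. p u * q v * (of_nat (count (shw u v) w) * word_fun w z))"
    by (rule sum.swap)
  also have "\<dots> = (\<Sum>u\<in>?P. \<Sum>v\<in>?Q. \<Sum>w\<in>?A. p u * q v * (of_nat (count (shw u v) w) * word_fun w z))"
    by (intro sum.cong refl sum.swap)
  also have "\<dots> = (\<Sum>u\<in>?P. \<Sum>v\<in>?Q. (p u * word_fun u z) * (q v * word_fun v z))"
  proof (intro sum.cong refl)
    fix u v assume uv: "u \<in> ?P" "v \<in> ?Q"
    then have "word_fun u z * word_fun v z = (\<Sum>w\<in>#shw u v. word_fun w z)"
      using is_poly_letters assms by (intro word_fun_shuffle) auto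
    also have "\<dots> = (\<Sum>w\<in>?A. of_nat (count (shw u v) w) * word_fun w z)"
      using uv by (intro sum_mset_count fin) blast
    finally show "(\<Sum>w\<in>?A. p u * q v * (of_nat (count (shw u v) w) * word_fun w z)) =
        (p u * word_fun u z) * (q v * word_fun v z)"
      by (simp only: sum_distrib_left[symmetric] mult_ac)
  qed
  also have "\<dots> = poly_fun p z * poly_fun q z"
    by (simp only: poly_fun_def sum_product)
  finally show ?thesis .
qed

lemma poly_fun_holomorphic: "is_poly S p \<Longrightarrow> poly_fun p holomorphic_on U"
  unfolding poly_fun_def[abs_def] using is_poly_letters word_fun_holomorphic
  by (intro holomorphic_intros) auto

text \<open>For a nonempty word every proper cut leaves a suffix ending in a letter other than
  \<open>b\<close>, where the exponential vanishes; only the coefficient of K for the full word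
  survives.\<close>

lemma word_fun_LiB_ser:
  assumes w: "set w \<subseteq> S" "w = [] \<or> last w \<noteq> b" and z: "z \<in> U" "z \<in> ball b \<rho>"
  shows "word_fun w z = LiB_ser b w z"
proof -
  have "reg_sol b \<rho> (take i w) z * ser_exp b (Lb z) (drop i w) = (if i = length w then reg_sol b \<rho> w z else 0)"
    if i: "i \<le> length w" for i
  proof (cases "i = length w")
    case False
    then have "drop i w \<noteq> []" using i by simp
    then have "last w \<in> set (drop i w)" by (metis last_drop last_in_set drop_eq_Nil not_le_imp_less)
    moreover have "last w \<noteq> b" using False i w by auto
    ultimately have "ser_exp b (Lb z) (drop i w) = 0" by (auto simp: ser_exp_def)
    then show ?thesis using False by simp
  qed simp
  then have "word_fun w z = (\<Sum>i\<le>length w. if i = length w then reg_sol b \<rho> w z else 0)"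
    unfolding word_fun_near_b[OF w(1) z] ser_mult_def by (intro sum.cong refl) (simp only: atMost_iff)
  also have "\<dots> = LiB_ser b w z"
    by (simp add: LiB_ser_eq_reg_sol[OF rho_le rho_pos w z(2)])
  finally show ?thesis .
qed

text \<open>\<open>poly_fun\<close>, cut off to 0 outside \<open>U\<close>, satisfies the
  description. Any competitor has the same series on the slit disc, and the identity theorem carries
  the equality over the connected set \<open>U\<close>.\<close>

lemma LiB_eq:
  assumes p: "is_poly S p" "inAb b p" and z: "z \<in> U"
  shows "LiB S U b p z = poly_fun p z"
proof -
  let ?f = "\<lambda>z. if z \<in> U then poly_fun p z else 0"
  have eq: "poly_fun p z = (\<Sum>w\<in>{w. p w \<noteq> 0}. p w * LiB_ser b w z)" if z: "z \<in> U" "cmod (z - b) < rho S b" for z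
    unfolding poly_fun_def
  proof (intro sum.cong refl arg_cong2[where f = "(*)"] word_fun_LiB_ser z(1))
    show "z \<in> ball b \<rho>" using z by (simp add: dist_norm norm_minus_commute)
    fix w assume "w \<in> {w. p w \<noteq> 0}"
    then show "set w \<subseteq> S" "w = [] \<or> last w \<noteq> b"
      using is_poly_letters[OF p(1)] p(2) by (auto simp: inAb_def)
  qed
  have "LiB S U b p = ?f"
    unfolding LiB_def
  proof (rule the_equality)
    have "?f holomorphic_on U"
      by (rule holomorphic_transform[OF poly_fun_holomorphic[OF p(1)]]) simp
    then show "?f holomorphic_on U \<and>
      (\<forall>z\<in>U. cmod (z - b) < rho S b \<longrightarrow> ?f z = (\<Sum>w\<in>{w. p w \<noteq> 0}. p w * LiB_ser b w z)) \<and>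
      (\<forall>z. z \<notin> U \<longrightarrow> ?f z = 0)"
      using eq by simp
  next
    fix g assume g: "g holomorphic_on U \<and>
      (\<forall>z\<in>U. cmod (z - b) < rho S b \<longrightarrow> g z = (\<Sum>w\<in>{w. p w \<noteq> 0}. p w * LiB_ser b w z)) \<and>
      (\<forall>z. z \<notin> U \<longrightarrow> g z = 0)"
    have "g z = poly_fun p z" if "z \<in> U" for z
    proof (rule analytic_continuation_open[OF open_slit U_open _ U_connected slit_subset_U _ poly_fun_holomorphic[OF p(1)] _ that])
      show "slit \<noteq> {}" using slit_base_point by blast
      show "g holomorphic_on U" using g by blast
      show "g x = poly_fun p x" if "x \<in> slit" for x
      proof -
        have "x \<in> U" "cmod (x - b) < rho S b"
          using that slit_subset_U by (auto simp: slit_def dist_norm norm_minus_commute)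
        with g eq show ?thesis by simp
      qed
    qed
    then show "g = ?f" using g by auto
  qed
  then show ?thesis using z by simp
qed

section \<open>Characters of the shuffle algebra and \<open>LiAB\<close>\<close>

definition LiAB_spec :: "complex \<Rightarrow> (ncpoly \<Rightarrow> complex) \<Rightarrow> bool" where
  "LiAB_spec z \<phi> \<longleftrightarrow>
      (\<forall>p q. is_poly S p \<longrightarrow> is_poly S q \<longrightarrow> \<phi> (\<lambda>w. p w + q w) = \<phi> p + \<phi> q) \<and>
      (\<forall>c p. is_poly S p \<longrightarrow> \<phi> (\<lambda>w. c * p w) = c * \<phi> p) \<and>
      (\<forall>p q. is_poly S p \<longrightarrow> is_poly S q \<longrightarrow> \<phi> (shuf p q) = \<phi> p * \<phi> q) \<and>
      (\<forall>q. is_poly S q \<longrightarrow> inAb b q \<longrightarrow> \<phi> q = LiB S U b q z) \<and>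
      \<phi> (word_poly [b]) = Lb z \<and>
      (\<forall>q. \<not> is_poly S q \<longrightarrow> \<phi> q = 0)"

lemma word_fun_letter_b: "z \<in> U \<Longrightarrow> word_fun [b] z = Lb z"
  using word_fun_replicate[of z 1] by simp

lemma is_poly_cf: "p \<in> Pol S \<Longrightarrow> is_poly S (cf p)"
  by (simp add: Pol_def)

lemma LiAB_spec_ring:
  assumes "LiAB_spec z \<phi>"
  shows LiAB_spec_add: "\<And>p q. p \<in> Pol S \<Longrightarrow> q \<in> Pol S \<Longrightarrow> \<phi> (cf (p + q)) = \<phi> (cf p) + \<phi> (cf q)"
    and LiAB_spec_scal: "\<And>k p. p \<in> Pol S \<Longrightarrow> \<phi> (cf (scal k * p)) = k * \<phi> (cf p)"
    and LiAB_spec_mult: "\<And>p q. p \<in> Pol S \<Longrightarrow> q \<in> Pol S \<Longrightarrow> \<phi> (cf (p * q)) = \<phi> (cf p) * \<phi> (cf q)"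
proof -
  have add: "cf (p + q) = (\<lambda>w. cf p w + cf q w)" for p q
    by (rule ext) simp
  fix p q assume "p \<in> Pol S" "q \<in> Pol S"
  then show "\<phi> (cf (p + q)) = \<phi> (cf p) + \<phi> (cf q)" "\<phi> (cf (p * q)) = \<phi> (cf p) * \<phi> (cf q)"
    using assms is_poly_cf unfolding add LiAB_spec_def by (simp_all flip: shuf_cf)
next
  have scal: "cf (scal k * p) = (\<lambda>w. k * cf p w)" for p k
    by (rule ext; simp)
  fix p k assume "p \<in> Pol S"
  then show "\<phi> (cf (scal k * p)) = k * \<phi> (cf p)"
    using assms is_poly_cf unfolding scal LiAB_spec_def by simp
qed

text \<open>Unitality is not among the listed conditions; it follows from agreement with Li^b,
  because the empty word belongs to \<open>A^b\<close>.\<close>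

lemma LiAB_spec_one:
  assumes "LiAB_spec z \<phi>" "z \<in> U"
  shows "\<phi> (cf 1) = 1"
proof -
  have "is_poly S (word_poly [])" "inAb b (word_poly [])"
    using is_poly_cf[OF Pol_one[OF fin]] by (auto simp: cf_1 inAb_def word_poly_def)
  then have "\<phi> (word_poly []) = poly_fun (word_poly []) z"
    using assms LiB_eq unfolding LiAB_spec_def by simp
  then show ?thesis by (simp add: cf_1 poly_fun_word)
qed

lemma LiAB_spec_expansion:
  assumes \<phi>: "LiAB_spec z \<phi>" and z: "z \<in> U" and u: "\<And>j. u j \<in> Pol S" "\<And>j. right_deriv b (u j) = 0"
  shows "\<phi> (cf (\<Sum>j<N. letter b ^ j * u j)) = (\<Sum>j<N. Lb z ^ j * poly_fun (cf (u j)) z)"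
proof -
  interpret R: derivation_var "right_deriv b" "letter b" "Pol S" by (rule derivation_right_deriv[OF fin bS])
  have uj: "\<phi> (cf (u j)) = poly_fun (cf (u j)) z" for j
  proof -
    have "is_poly S (cf (u j))" "inAb b (cf (u j))" using u by (simp_all add: is_poly_cf inAb_iff)
    then show ?thesis using \<phi> LiB_eq z unfolding LiAB_spec_def by simp
  qed
  have zero: "\<phi> (cf 0) = 0" using LiAB_spec_scal[OF \<phi> R.zero_in, of 0] by simp
  have letter: "\<phi> (cf (letter b)) = Lb z" using \<phi> unfolding LiAB_spec_def cf_letter by blast
  have pow: "\<phi> (cf (letter b ^ j)) = Lb z ^ j" for j
    by (induction j) (simp_all add: LiAB_spec_one[OF \<phi> z] LiAB_spec_mult[OF \<phi>] letter R.x_in R.power_in)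
  show ?thesis
  proof (induction N)
    case (Suc N)
    have "(\<Sum>j<N. letter b ^ j * u j) \<in> Pol S" "letter b ^ N * u N \<in> Pol S" "letter b ^ N \<in> Pol S"
      by (intro R.sum_in R.mult_in R.power_in R.x_in u)+
    then show ?case
      by (simp only: sum.lessThan_Suc LiAB_spec_add[OF \<phi>] LiAB_spec_mult[OF \<phi> _ u(1)] pow uj Suc)
  qed (simp only: lessThan_0 sum.empty zero)
qed

lemma LiAB_spec_poly_fun:
  assumes "z \<in> U"
  shows "LiAB_spec z (\<lambda>p. if is_poly S p then poly_fun p z else 0)"
proof -
  have closed: "is_poly S (\<lambda>w. p w + q w)" "is_poly S (\<lambda>w. k * p w)" "is_poly S (shuf p q)"
    if "is_poly S p" "is_poly S q" for p q k
  proof -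
    have Pol: "Sh p \<in> Pol S" "Sh q \<in> Pol S" using that by (simp_all add: Pol_def)
    interpret R: derivation_var "right_deriv b" "letter b" "Pol S" by (rule derivation_right_deriv[OF fin bS])
    have "is_poly S (cf (Sh p + Sh q))" "is_poly S (cf (scal k * Sh p))" "is_poly S (cf (Sh p * Sh q))"
      by (intro is_poly_cf R.add_in Pol_mult[OF fin] Pol Pol_scal[OF fin])+
    moreover have "cf (Sh p + Sh q) = (\<lambda>w. p w + q w)" "cf (scal k * Sh p) = (\<lambda>w. k * p w)"
      by (rule ext; simp)+
    moreover have "cf (Sh p * Sh q) = shuf p q" using shuf_cf[OF Pol] by simp
    ultimately show "is_poly S (\<lambda>w. p w + q w)" "is_poly S (\<lambda>w. k * p w)" "is_poly S (shuf p q)"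
      by simp_all
  qed
  have "is_poly S (word_poly [b])" using bS by (simp add: is_poly_def word_poly_def)
  then show ?thesis
    unfolding LiAB_spec_def
    using closed poly_fun_add poly_fun_scale poly_fun_shuf LiB_eq assms poly_fun_word word_fun_letter_b by simp
qed

text \<open>Evaluated on an expansion in powers of x_b over \<open>A^b\<close>, every admissible map
  gives the same expression in \<open>Lb z\<close>, and \<open>poly_fun\<close> is one such map. Off
  the polynomials the normalisation decides.\<close>

lemma LiAB_spec_unique:
  assumes \<phi>: "LiAB_spec z \<phi>" and z: "z \<in> U"
  shows "\<phi> = (\<lambda>p. if is_poly S p then poly_fun p z else 0)"
proof
  fix p
  show "\<phi> p = (if is_poly S p then poly_fun p z else 0)"
  proof (cases "is_poly S p")
    case True
    then have "Sh p \<in> Pol S" by (simp add: Pol_def)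
    then obtain N u where u: "\<forall>j. u j \<in> Pol S \<and> right_deriv b (u j) = 0" and p: "Sh p = (\<Sum>j<N. letter b ^ j * u j)"
      using decomposition_Ab[OF fin bS] by blast
    have cf_p: "cf (\<Sum>j<N. letter b ^ j * u j) = p" by (simp flip: p)
    have "\<psi> p = (\<Sum>j<N. Lb z ^ j * poly_fun (cf (u j)) z)" if "LiAB_spec z \<psi>" for \<psi>
      unfolding cf_p[symmetric] by (rule LiAB_spec_expansion[OF that z]) (use u in auto)
    from this[OF \<phi>] this[OF LiAB_spec_poly_fun[OF z]] show ?thesis by (rule trans[OF _ sym])
  next
    case False
    then show ?thesis using \<phi> unfolding LiAB_spec_def by simp
  qed
qed

lemma LiAB_eq:
  assumes "z \<in> U"
  shows "LiAB S U a b Lb p z = (if is_poly S p then poly_fun p z else 0)"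
proof -
  have "(THE \<phi>. LiAB_spec z \<phi>) = (\<lambda>p. if is_poly S p then poly_fun p z else 0)"
  proof (rule the_equality)
    show "LiAB_spec z (\<lambda>p. if is_poly S p then poly_fun p z else 0)"
      by (rule LiAB_spec_poly_fun[OF assms])
  qed (rule LiAB_spec_unique[OF _ assms])
  then show ?thesis unfolding LiAB_def LiAB_spec_def by (rule fun_cong)
qed

lemma LiAB_word: "z \<in> U \<Longrightarrow> set w \<subseteq> S \<Longrightarrow> LiAB S U a b Lb (word_poly w) z = word_fun w z"
  using is_poly_cf[OF Pol_word[OF fin]] by (simp add: LiAB_eq poly_fun_word)

lemma LiAB_deriv:
  assumes c: "c \<in> S" and p: "is_poly S p" and z: "z \<in> U"
  shows "((\<lambda>z. LiAB S U a b Lb (lmul c p) z) has_field_derivative LiAB S U a b Lb p z / (z - c)) (at z)"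
proof -
  have supp: "{w. lmul c p w \<noteq> 0} = (#) c ` {w. p w \<noteq> 0}"
  proof (intro set_eqI)
    show "w \<in> {w. lmul c p w \<noteq> 0} \<longleftrightarrow> w \<in> (#) c ` {w. p w \<noteq> 0}" for w
      by (cases w) (auto simp: lmul_def)
  qed
  have poly: "is_poly S (lmul c p)"
    unfolding is_poly_def supp
  proof (intro conjI allI impI)
    show "finite ((#) c ` {w. p w \<noteq> 0})" using is_poly_finite[OF p] by simp
    fix w assume "lmul c p w \<noteq> 0"
    then obtain v where "w = c # v" "p v \<noteq> 0" using supp by blast
    then show "set w \<subseteq> S" using c is_poly_letters[OF p, of v] by simp
  qed
  have "poly_fun (lmul c p) = (\<lambda>z. \<Sum>w\<in>{w. p w \<noteq> 0}. p w * word_fun (c # w) z)"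
    unfolding poly_fun_def[abs_def] supp by (subst sum.reindex) (auto simp: lmul_def)
  moreover have "((\<lambda>z. \<Sum>w\<in>{w. p w \<noteq> 0}. p w * word_fun (c # w) z) has_field_derivative
      (\<Sum>w\<in>{w. p w \<noteq> 0}. p w * (word_fun w z / (z - c)))) (at z)"
    using c is_poly_letters[OF p] z by (intro DERIV_sum DERIV_cmult word_fun_deriv) auto
  moreover have "(\<Sum>w\<in>{w. p w \<noteq> 0}. p w * (word_fun w z / (z - c))) = poly_fun p z / (z - c)"
    by (simp add: poly_fun_def sum_divide_distrib)
  ultimately have "(poly_fun (lmul c p) has_field_derivative poly_fun p z / (z - c)) (at z)" by simp
  then have "(poly_fun (lmul c p) has_field_derivative LiAB S U a b Lb p z / (z - c)) (at z)"
    by (simp add: LiAB_eq[OF z] p)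
  then show ?thesis
    by (rule has_field_derivative_transform_within_open[OF _ U_open z]) (simp add: LiAB_eq poly)
qed

section \<open>The local solution and the factorisation\<close>

lemma is_Hab_word_fun:
  "is_Hab S U b Lb (\<lambda>z w. if z \<in> U \<and> set w \<subseteq> S then word_fun w z else 0)" (is "is_Hab S U b Lb ?H")
  unfolding is_Hab_def
proof (intro conjI allI impI ballI)
  fix w z assume w: "set w \<subseteq> S" and z: "z \<in> U"
  have "(word_fun w has_field_derivative (case w of [] \<Rightarrow> 0 | c # w' \<Rightarrow> ?H z w' / (z - c))) (at z)"
    using w z word_fun_deriv by (cases w) auto
  then show "((\<lambda>z. ?H z w) has_field_derivative (case w of [] \<Rightarrow> 0 | c # w' \<Rightarrow> ?H z w' / (z - c))) (at z)"
    by (rule has_field_derivative_transform_within_open[OF _ U_open z]) (use w in simp)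
next
  fix w assume w: "set w \<subseteq> S"
  have b: "b \<in> ball b \<rho>" using rho_pos by simp
  have "(reg_sol b \<rho> w \<longlongrightarrow> (if w = [] then 1 else 0)) (at b within U)"
    using tendsto_within_subset[OF reg_sol_isCont[OF w b, unfolded isCont_def] subset_UNIV, of U]
    unfolding reg_sol_center[OF rho_le rho_pos w] .
  then show "((\<lambda>z. ser_mult (?H z) (ser_exp b (- Lb z)) w) \<longlongrightarrow> (if w = [] then 1 else 0)) (at b within U)"
  proof (rule Lim_transform_eventually)
    show "\<forall>\<^sub>F z in at b within U. reg_sol b \<rho> w z = ser_mult (?H z) (ser_exp b (- Lb z)) w"
    proof (rule eventually_mono[OF eventually_near_b])
      fix z assume z: "z \<in> U \<and> z \<in> ball b \<rho> \<and> z \<noteq> b"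
      have "ser_mult (?H z) (ser_exp b (- Lb z)) w =
          ser_mult (ser_mult (\<lambda>w. reg_sol b \<rho> w z) (ser_exp b (Lb z))) (ser_exp b (- Lb z)) w"
        \<comment> \<open>Only the outer product is expanded: prefixes are rewritten by
          \<open>word_fun_near_b\<close>, and the intact inner product is then re-associated so that
          the two exponentials cancel and K remains.\<close>
        unfolding ser_mult_def[of _ "ser_exp b (- Lb z)"]
      proof (intro sum.cong refl)
        fix i
        have "set (take i w) \<subseteq> S" using w set_take_subset[of i w] by blast
        then show "?H z (take i w) * ser_exp b (- Lb z) (drop i w) =
            ser_mult (\<lambda>w. reg_sol b \<rho> w z) (ser_exp b (Lb z)) (take i w) * ser_exp b (- Lb z) (drop i w)"
          using word_fun_near_b z by simp
      qed
      also have "\<dots> = reg_sol b \<rho> w z"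
        by (simp only: ser_mult_assoc ser_exp_inverse[abs_def] ser_mult_one_right)
      finally show "reg_sol b \<rho> w z = ser_mult (?H z) (ser_exp b (- Lb z)) w" by simp
    qed
  qed
qed

lemma is_Hab_unique:
  assumes H: "is_Hab S U b Lb H" and H': "is_Hab S U b Lb H'"
  shows "set w \<subseteq> S \<Longrightarrow> z \<in> U \<Longrightarrow> H z w = H' z w"
proof (induction "length w" arbitrary: w z rule: less_induct)
  case less
  let ?d = "\<lambda>z. H z w - H' z w"
  have "(?d has_field_derivative 0) (at z)" if z: "z \<in> U" for z
  proof -
    have "((\<lambda>z. H z w) has_field_derivative (case w of [] \<Rightarrow> 0 | c # w' \<Rightarrow> H z w' / (z - c))) (at z)"
      "((\<lambda>z. H' z w) has_field_derivative (case w of [] \<Rightarrow> 0 | c # w' \<Rightarrow> H' z w' / (z - c))) (at z)"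
      using H H' less.prems(1) z unfolding is_Hab_def by blast+
    from DERIV_diff[OF this]
    have "(?d has_field_derivative (case w of [] \<Rightarrow> 0 | c # w' \<Rightarrow> H z w' / (z - c))
        - (case w of [] \<Rightarrow> 0 | c # w' \<Rightarrow> H' z w' / (z - c))) (at z)" .
    moreover have "(case w of [] \<Rightarrow> 0 | c # w' \<Rightarrow> H z w' / (z - c)) = (case w of [] \<Rightarrow> 0 | c # w' \<Rightarrow> H' z w' / (z - c))"
      using less.hyps[OF _ _ z] less.prems(1) by (cases w) auto
    ultimately show ?thesis by simp
  qed
  then have const: "?d x = ?d y" if "x \<in> U" "y \<in> U" for x y
    by (rule constant_on_U[OF _ that])
  \<comment> \<open>Shorter prefixes agree by induction, so only the cut at the end of
    \<open>w\<close> survives, where the exponential has coefficient 1. The limit condition thus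
    becomes a condition on the constant \<open>?d\<close>.\<close>
  have eq: "ser_mult (H x) (ser_exp b (- Lb x)) w - ser_mult (H' x) (ser_exp b (- Lb x)) w = ?d x"
    if x: "x \<in> U" for x
  proof -
    have "H x (take i w) = H' x (take i w)" if "i < length w" for i
      using that less.prems(1) set_take_subset[of i w] by (intro less.hyps x) auto
    then show ?thesis
      unfolding ser_mult_def by (simp add: lessThan_Suc_atMost[symmetric])
  qed
  let ?s = "\<lambda>H x. ser_mult (H x) (ser_exp b (- Lb x)) w"
  have "(?s H \<longlongrightarrow> (if w = [] then 1 else 0)) (at b within U)" "(?s H' \<longlongrightarrow> (if w = [] then 1 else 0)) (at b within U)"
    using H H' less.prems(1) unfolding is_Hab_def by blast+
  from tendsto_diff[OF this] have "((\<lambda>x. ?s H x - ?s H' x) \<longlongrightarrow> 0) (at b within U)" by simp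
  moreover have "?s H x - ?s H' x = ?d z" if "x \<in> U" for x
    by (rule trans[OF eq[OF that] const[OF that less.prems(2)]])
  then have "((\<lambda>x. ?s H x - ?s H' x) \<longlongrightarrow> ?d z) (at b within U)"
    by (intro tendsto_eventually eventually_mono[OF eventually_near_b]) blast
  ultimately have "?d z = 0" using tendsto_unique[OF b_limit_point] by blast
  then show ?case by simp
qed

lemma Hab_eq:
  assumes "z \<in> U" "set w \<subseteq> S"
  shows "Hab S U b Lb z w = word_fun w z"
proof -
  let ?H = "\<lambda>z w. if z \<in> U \<and> set w \<subseteq> S then word_fun w z else 0"
  have "Hab S U b Lb = ?H"
    unfolding Hab_def
  proof (rule the_equality)
    show "is_Hab S U b Lb ?H \<and> (\<forall>z w. z \<notin> U \<or> \<not> set w \<subseteq> S \<longrightarrow> ?H z w = 0)"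
      using is_Hab_word_fun by auto
    fix H assume H: "is_Hab S U b Lb H \<and> (\<forall>z w. z \<notin> U \<or> \<not> set w \<subseteq> S \<longrightarrow> H z w = 0)"
    show "H = ?H"
    proof (intro ext)
      show "H z w = ?H z w" for z w
        using is_Hab_unique[OF _ is_Hab_word_fun, of H w z] H by (cases "z \<in> U \<and> set w \<subseteq> S") auto
    qed
  qed
  then show ?thesis using assms by simp
qed

text \<open>Both are primitives of 1/(z - a) on the connected set \<open>U\<close>, and both tend to
  0 at \<open>b\<close>: the left one because the word is not a power of \<open>b\<close>, the right
  one by \<open>lim\<close>.\<close>

lemma word_fun_letter_a:
  assumes La: "La holomorphic_on U" "\<And>z. z \<in> U \<Longrightarrow> exp (La z) = (z - a) / (b - a)"
    and lim: "(La \<longlongrightarrow> 0) (at b within U)" and z: "z \<in> U"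
  shows "word_fun [a] z = La z"
proof -
  let ?d = "\<lambda>z. word_fun [a] z - La z"
  have "(?d has_field_derivative 0) (at z)" if z: "z \<in> U" for z
    using DERIV_diff[OF word_fun_deriv[of a "[]" z] log_branch_deriv[OF U_open La z]] aS z by simp
  then have const: "?d x = ?d y" if "x \<in> U" "y \<in> U" for x y
    by (rule constant_on_U[OF _ that])
  have "((\<lambda>z. word_fun [a] z) \<longlongrightarrow> 0) (at b within U)"
    using word_fun_log_limit[of "[a]" 0] aS ab by simp
  from tendsto_diff[OF this lim] have "(?d \<longlongrightarrow> 0) (at b within U)" by simp
  moreover have "(?d \<longlongrightarrow> ?d z) (at b within U)"
    by (rule tendsto_eventually, rule eventually_mono[OF eventually_near_b]) (use const z in blast)
  ultimately have "?d z = 0" using tendsto_unique[OF b_limit_point] by blast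
  then show ?thesis by simp
qed

lemma word_fun_regab:
  assumes La: "La holomorphic_on U" "\<And>z. z \<in> U \<Longrightarrow> exp (La z) = (z - a) / (b - a)"
    and lim: "(La \<longlongrightarrow> 0) (at b within U)" and z: "z \<in> U" and w: "set w \<subseteq> S"
  shows "word_fun w z =
    ser_mult (ser_mult (ser_exp a (La z)) (\<lambda>v. LiAB S U a b Lb (regab S a b (word_poly v)) z)) (ser_exp b (Lb z)) w"
proof -
  let ?\<phi> = "\<lambda>p. LiAB S U a b Lb (cf p) z"
  have spec: "LiAB_spec z (\<lambda>p. LiAB S U a b Lb p z)"
    using LiAB_spec_poly_fun[OF z] by (simp add: LiAB_eq[OF z])
  have "?\<phi> (Sh (word_poly w)) =
    ser_mult (ser_mult (ser_exp a (?\<phi> (letter a))) (\<lambda>v. ?\<phi> (Sh (regab S a b (word_poly v)))))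
      (ser_exp b (?\<phi> (letter b))) w"
    by (rule hom_word_regab[OF fin aS bS ab])
      (rule LiAB_spec_add[OF spec] LiAB_spec_scal[OF spec] LiAB_spec_mult[OF spec]
        LiAB_spec_one[OF spec z] w; assumption)+
  then show ?thesis
    using LiAB_word[OF z] aS bS w
    by (simp add: cf_letter word_fun_letter_b[OF z] word_fun_letter_a[OF La lim z])
qed

end

theorem mainTheorem3:
  fixes S U :: "complex set" and a b :: complex and La Lb :: "complex \<Rightarrow> complex"
  assumes "finite S" and "a \<in> S" and "b \<in> S" and "a \<noteq> b"
    and "admissible_domain S b U"
    and "Lb holomorphic_on U" and "\<forall>z\<in>U. exp (Lb z) = (z - b) / (a - b)"
    and "La holomorphic_on U" and "\<forall>z\<in>U. exp (La z) = (z - a) / (b - a)"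
    and "(La \<longlongrightarrow> 0) (at b within U)"
  shows "(\<forall>c\<in>S. \<forall>p. is_poly S p \<longrightarrow> (\<forall>z\<in>U.
            ((\<lambda>z. LiAB S U a b Lb (lmul c p) z) has_field_derivative
               LiAB S U a b Lb p z / (z - c)) (at z)))
       \<and> (\<forall>z\<in>U. \<forall>w. set w \<subseteq> S \<longrightarrow> Hab S U b Lb z w = LiAB S U a b Lb (word_poly w) z)
       \<and> (\<forall>z\<in>U. \<forall>w. set w \<subseteq> S \<longrightarrow>
            Hab S U b Lb z w =
              ser_mult (ser_mult (ser_exp a (La z)) (\<lambda>v. LiAB S U a b Lb (regab S a b (word_poly v)) z))
                       (ser_exp b (Lb z)) w)"
proof -
  obtain e where "slit_domain S U a b e Lb"
    using assms unfolding admissible_domain_def slit_domain_def by blast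
  then interpret slit_domain S U a b e Lb .
  have La: "La holomorphic_on U" "\<And>z. z \<in> U \<Longrightarrow> exp (La z) = (z - a) / (b - a)"
    using assms by auto
  show ?thesis
    using LiAB_deriv Hab_eq LiAB_word word_fun_regab[OF La assms(10)] by simp
qed

end
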